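(* Let $\varphi:\mathbb{R}\to\mathbb{R}$ be a ($C^\infty$) diffeomorphism with $\varphi(\eta)=\eta$ for $|\eta|\ge 1$ and whose restriction to $(-1,1)$ is non-linear. Let $2<p<\infty$. For a symbol $\sigma$ on $\mathbb{R}^2$ consider the operator, initially defined on $\mathcal{S}(\mathbb{R})$, $$Af(x)=\int_{\mathbb{R}} e^{2\pi i \varphi(\eta)x}\,\sigma(x,\eta)\,\hat f(\eta)\,d\eta .$$ If $\sigma(x,\eta)=1$ for all $(x,\eta)$, then $A$ is not bounded as an operator from $L^p(\mathbb{R})$ to $L^p(\mathbb{R})$. More precisely, if $\sigma(x,\eta)=\langle x\rangle^{\tilde m}$ with $\tilde m\in\mathbb{R}$, then $A:L^p(\mathbb{R})\to L^p(\mathbb{R})$ is bounded if and only if $$\tilde m\le -\left(\frac12-\frac1p\right).$$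
   Context: The Fourier transform is $\hat f(\eta)=\int f(t)e^{-2\pi i t\eta}\,dt$, and $\langle x\rangle=(1+|x|^2)^{1/2}$. "Bounded on $L^p$" means that $A$, initially defined on the Schwartz space $\mathcal{S}(\mathbb{R})$, extends to a bounded operator $L^p(\mathbb{R})\to L^p(\mathbb{R})$, i.e. $\|Af\|_{L^p}\le C\|f\|_{L^p}$ for all $f\in\mathcal{S}(\mathbb{R})$. *)

theory Defs
  imports "HOL-Analysis.Analysis"
begin

definition iter_deriv :: "nat \<Rightarrow> (real \<Rightarrow> 'a::real_normed_vector) \<Rightarrow> real \<Rightarrow> 'a" where
  "iter_deriv n f = ((\<lambda>g t. vector_derivative g (at t)) ^^ n) f"

text \<open>
  \<^const>\<open>vector_derivative\<close> is an arbitrary value where no derivative exists, so smoothness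
  demands differentiability at every stage.
\<close>

definition smooth_real :: "(real \<Rightarrow> 'a::real_normed_vector) \<Rightarrow> bool" where
  "smooth_real f \<longleftrightarrow> (\<forall>n t. iter_deriv n f differentiable at t)"

definition diffeomorphism_real :: "(real \<Rightarrow> real) \<Rightarrow> bool" where
  "diffeomorphism_real \<phi> \<longleftrightarrow> bij \<phi> \<and> smooth_real \<phi> \<and> smooth_real (inv \<phi>)"

definition schwartz_space :: "(real \<Rightarrow> complex) set" where
  "schwartz_space =
    {f. smooth_real f \<and> (\<forall>k n. bounded (range (\<lambda>t. t ^ k *\<^sub>R iter_deriv n f t)))}"

definition fourier_transform :: "(real \<Rightarrow> complex) \<Rightarrow> real \<Rightarrow> complex" where
  "fourier_transform f \<eta> =
    (LINT t|lborel. f t * exp (- 2 * complex_of_real pi * \<i> * complex_of_real t * complex_of_real \<eta>))"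

definition japanese_bracket :: "real \<Rightarrow> real" where
  "japanese_bracket x = sqrt (1 + \<bar>x\<bar>\<^sup>2)"

text \<open>Symbols are complex-valued functions of \<open>x\<close> and \<open>\<eta>\<close>, in this order.\<close>

definition fourier_integral_operator ::
    "(real \<Rightarrow> real) \<Rightarrow> (real \<Rightarrow> real \<Rightarrow> complex) \<Rightarrow> (real \<Rightarrow> complex) \<Rightarrow> real \<Rightarrow> complex" where
  "fourier_integral_operator \<phi> \<sigma> f x =
    (LINT \<eta>|lborel. exp (2 * complex_of_real pi * \<i> * complex_of_real (\<phi> \<eta>) * complex_of_real x)
      * \<sigma> x \<eta> * fourier_transform f \<eta>)"

definition in_Lp :: "real \<Rightarrow> (real \<Rightarrow> complex) \<Rightarrow> bool" where
  "in_Lp p f \<longleftrightarrow> f \<in> borel_measurable lborel \<and> integrable lborel (\<lambda>x. norm (f x) powr p)"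

definition Lp_norm :: "real \<Rightarrow> (real \<Rightarrow> complex) \<Rightarrow> real" where
  "Lp_norm p f = (LINT x|lborel. norm (f x) powr p) powr (1 / p)"

text \<open>
  The membership \<^term>\<open>in_Lp p (A f)\<close> is needed alongside the estimate: the Bochner integral in
  \<^const>\<open>Lp_norm\<close> is \<open>0\<close> when \<open>norm (A f x) powr p\<close> is not integrable.
\<close>

definition bounded_on_Lp :: "real \<Rightarrow> ((real \<Rightarrow> complex) \<Rightarrow> real \<Rightarrow> complex) \<Rightarrow> bool" where
  "bounded_on_Lp p A \<longleftrightarrow>
    (\<exists>C. \<forall>f\<in>schwartz_space. in_Lp p (A f) \<and> Lp_norm p (A f) \<le> C * Lp_norm p f)"

end

theory Submission
  imports Defs "HOL-Probability.Probability"
begin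

text \<open>
  Write \<open>e(t) = exp(2\<pi>it)\<close> and \<open>T F x = \<integral> e(\<phi>(\<eta>) x) F(\<eta>) d\<eta>\<close>, so that the operator is
  \<open>\<langle>x\<rangle>\<^sup>m T (f\<hat>)\<close>.

  Sufficiency: by Fourier inversion \<open>T (f\<hat>) = f + B f\<close>, where \<open>B\<close> only sees \<open>\<bar>\<eta>\<bar> \<le> 1\<close>.
  The operator \<open>g = \<langle>x\<rangle>\<^bsup>-1/2\<^esup> B f\<close> is bounded from \<open>L\<^sup>2(dx)\<close> to \<open>L\<^sup>2(\<langle>x\<rangle> dx)\<close>
  by Plancherel, and on \<open>L\<^sup>\<infinity>\<close> because its kernel is the Fourier transform of a compactly supported
  function whose derivative is \<open>O(\<langle>x\<rangle>)\<close>, which makes the \<open>L\<^sup>1\<close> norm of that transform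
  \<open>O(\<langle>x\<rangle>\<^bsup>1/2\<^esup>)\<close>. Marcinkiewicz interpolation with respect to the measure \<open>\<langle>x\<rangle> dx\<close> yields
  exactly the endpoint weight \<open>\<langle>x\<rangle>\<^bsup>1 - p/2\<^esup>\<close>.

  Necessity: on an interval where \<open>\<phi>''\<close> does not vanish, let \<open>f\<hat> = e(-\<mu> \<phi>)\<close>. By
  van der Corput and Plancherel, \<open>\<parallel>f\<parallel>\<^sub>p = O(\<mu>\<^bsup>-(1/2 - 1/p)\<^esup>)\<close>, whereas \<open>T (f\<hat>)\<close> focuses
  near \<open>x = \<mu>\<close>, where it is bounded below.
\<close>

section \<open>Oscillatory integrals and Gaussians\<close>

text \<open>\<open>osc_int\<close> covers the Fourier transform (\<open>\<Phi> = uminus\<close>),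
  its inverse (identity phase) and the operator itself (\<open>\<Phi> = \<phi>\<close>), so a single
  L^2 estimate serves both as Plancherel (only the inequality is used) and as the L^2 bound for the
  operator.

  Subtracting the identity phase confines everything to a compact range of \<eta>. This also lets
  the interpolation act on truncations of f, which stay integrable but lose smoothness, so that
  their transforms need not be integrable. Dividing by <x>^(1/2) makes the sup estimate free of
  weights, and the measure <x> dx undoes that division at p = 2. At exponent p the weight 1 - p/2 =
  -p (1/2 - 1/p) remains, which is p times the claimed threshold.

  In the converse the sharply truncated packet is not a Schwartz function; it is reached by Gaussian
  damping and Fatou. The window around x = \<mu> has a length independent of \<mu>, so comparing
  powers gives \<mu>^(m p) = O(\<mu>^(1 - p/2)), the same exponent. Non-linearity serves to find a
  point where the second derivative is nonzero.\<close>

definition osc_int :: "(real \<Rightarrow> real) \<Rightarrow> (real \<Rightarrow> complex) \<Rightarrow> real \<Rightarrow> complex" where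
  "osc_int \<Phi> F x = (LINT \<eta>|lborel. cis (2 * pi * \<Phi> \<eta> * x) * F \<eta>)"

lemma measurable_cis [measurable]: "cis \<in> borel_measurable borel"
  by (intro borel_measurable_continuous_onI continuous_intros)

lemma measurable_cnj [measurable]: "cnj \<in> borel_measurable borel"
  by (intro borel_measurable_continuous_onI continuous_intros)

text \<open>No integrability is assumed: for a non-integrable function the Bochner integral is 0 by
  default and the bound is trivial. Later estimates can thus pass to nonnegative integrals without
  side conditions.\<close>

lemma norm_integral_le_nn_integral:
  fixes f :: "'a \<Rightarrow> 'b::{banach, second_countable_topology}"
  shows "ennreal (norm (integral\<^sup>L M f)) \<le> (\<integral>\<^sup>+x. ennreal (norm (f x)) \<partial>M)"
  using integral_norm_bound_ennreal[of M f] not_integrable_integral_eq[of M f] by fastforce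

lemma osc_int_measurable [measurable]:
  assumes [measurable]: "\<Phi> \<in> borel_measurable borel" "F \<in> borel_measurable borel"
  shows "osc_int \<Phi> F \<in> borel_measurable borel"
  unfolding osc_int_def by measurable

lemma integrable_cis_mult:
  assumes [measurable]: "\<theta> \<in> borel_measurable borel" and F: "integrable lborel F"
  shows "integrable lborel (\<lambda>\<eta>. cis (\<theta> \<eta>) * F \<eta>)"
  by (rule Bochner_Integration.integrable_bound[OF F]) (use F in \<open>auto simp: norm_mult\<close>)

lemma norm_osc_int_le:
  assumes "integrable lborel F"
  shows "norm (osc_int \<Phi> F x) \<le> (LINT \<eta>|lborel. norm (F \<eta>))"
  unfolding osc_int_def
  by (rule order_trans[OF integral_norm_bound]) (simp add: norm_mult)

lemma osc_int_add:
  assumes "\<Phi> \<in> borel_measurable borel" "integrable lborel F" "integrable lborel G"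
  shows "osc_int \<Phi> (\<lambda>\<eta>. F \<eta> + G \<eta>) x = osc_int \<Phi> F x + osc_int \<Phi> G x"
  unfolding osc_int_def using assms
  by (subst Bochner_Integration.integral_add[symmetric])
     (auto simp: distrib_left intro!: integrable_cis_mult)

lemma fourier_transform_eq: "fourier_transform f = osc_int uminus f"
proof
  fix \<eta>
  have "exp (- 2 * complex_of_real pi * \<i> * complex_of_real t * complex_of_real \<eta>) = cis (2 * pi * - t * \<eta>)" for t
    by (simp add: cis_conv_exp mult_ac)
  then show "fourier_transform f \<eta> = osc_int uminus f \<eta>"
    by (simp add: fourier_transform_def osc_int_def mult.commute)
qed

lemma fourier_integral_operator_eq:
  "fourier_integral_operator \<phi> (\<lambda>x \<eta>. w x) f x = w x * osc_int \<phi> (osc_int uminus f) x"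
proof -
  have "exp (2 * complex_of_real pi * \<i> * complex_of_real (\<phi> \<eta>) * complex_of_real x) * w x * F
      = w x * (cis (2 * pi * \<phi> \<eta> * x) * F)" for \<eta> F
    by (simp add: cis_conv_exp mult_ac)
  then show ?thesis
    unfolding fourier_integral_operator_def fourier_transform_eq osc_int_def[of \<phi>]
    by (simp only: integral_mult_right_zero)
qed

text \<open>The integrand is dominated by B |u(x)| |v(y)|, which is integrable on the product. Every
  use below has a unimodular \<open>cis\<close> kernel, hence \<open>B = 1\<close>.\<close>

lemma Fubini_bounded_kernel:
  fixes u v :: "real \<Rightarrow> complex" and k :: "real \<Rightarrow> real \<Rightarrow> complex"
  assumes u: "integrable lborel u" and v: "integrable lborel v"
    and k [measurable]: "case_prod k \<in> borel_measurable (borel \<Otimes>\<^sub>M borel)"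
    and bd: "\<And>x y. norm (k x y) \<le> B"
  shows "(LINT x|lborel. u x * (LINT y|lborel. k x y * v y)) = (LINT y|lborel. v y * (LINT x|lborel. k x y * u x))"
proof -
  have [measurable]: "u \<in> borel_measurable borel" "v \<in> borel_measurable borel"
    using u v by (auto dest: borel_measurable_integrable)
  have k': "(\<lambda>p. k (fst p) (snd p)) \<in> borel_measurable (borel \<Otimes>\<^sub>M borel)"
    using k by (simp add: case_prod_beta')
  note [measurable] = k'
  have bb: "0 \<le> B" using bd[of 0 0] norm_ge_zero order_trans by blast
  have "integrable (lborel \<Otimes>\<^sub>M lborel) (case_prod (\<lambda>x y. u x * v y))"
  proof (subst integrable_iff_bounded, intro conjI)
    show "case_prod (\<lambda>x y. u x * v y) \<in> borel_measurable (lborel \<Otimes>\<^sub>M lborel)" by measurable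
    have "(\<integral>\<^sup>+p. ennreal (norm (case p of (x, y) \<Rightarrow> u x * v y)) \<partial>(lborel \<Otimes>\<^sub>M lborel))
        = (\<integral>\<^sup>+x. \<integral>\<^sup>+y. ennreal (norm (u x)) * ennreal (norm (v y)) \<partial>lborel \<partial>lborel)"
      by (subst lborel.nn_integral_fst[symmetric]) (simp_all add: norm_mult ennreal_mult)
    also have "\<dots> = (\<integral>\<^sup>+x. ennreal (norm (u x)) \<partial>lborel) * (\<integral>\<^sup>+y. ennreal (norm (v y)) \<partial>lborel)"
      by (simp add: nn_integral_cmult nn_integral_multc)
    also have "\<dots> < \<infinity>"
      using u v by (simp add: integrable_iff_bounded ennreal_mult_less_top)
    finally show "(\<integral>\<^sup>+p. ennreal (norm (case p of (x, y) \<Rightarrow> u x * v y)) \<partial>(lborel \<Otimes>\<^sub>M lborel)) < \<infinity>" .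
  qed
  then have "integrable (lborel \<Otimes>\<^sub>M lborel) (\<lambda>p. of_real B * (case p of (x, y) \<Rightarrow> u x * v y))"
    by (rule integrable_mult_right)
  then have "integrable (lborel \<Otimes>\<^sub>M lborel) (case_prod (\<lambda>x y. k x y * (u x * v y)))"
  proof (rule Bochner_Integration.integrable_bound)
    show "AE p in lborel \<Otimes>\<^sub>M lborel. norm (case p of (x, y) \<Rightarrow> k x y * (u x * v y))
        \<le> norm (complex_of_real B * (case p of (x, y) \<Rightarrow> u x * v y))"
      using bd bb by (auto intro!: AE_I2 mult_right_mono simp: norm_mult)
  qed (simp add: case_prod_beta')
  from lborel_pair.Fubini_integral[OF this] show ?thesis
    by (simp flip: integral_mult_right_zero add: mult_ac)
qed

section \<open>The self-dual Gaussian and its dilates\<close>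

definition gauss :: "real \<Rightarrow> real \<Rightarrow> real" where
  "gauss \<epsilon> x = exp (- pi * (\<epsilon> * x)\<^sup>2)"

lemma gauss_measurable [measurable]: "gauss \<epsilon> \<in> borel_measurable borel"
  unfolding gauss_def by measurable

lemma gauss_pos [simp]: "gauss \<epsilon> x > 0" and gauss_nonneg [simp]: "gauss \<epsilon> x \<ge> 0" and gauss_le_1 [simp]: "gauss \<epsilon> x \<le> 1"
  by (auto simp: gauss_def)

text \<open>This is the characteristic function of the standard normal law after rescaling: with c =
  sqrt(2 pi), \<open>gauss 1 x\<close> is c times the normal density at c x, and the frequency
  becomes t = c y.\<close>

lemma fourier_std_gauss:
  shows "integrable lborel (gauss 1)"
    and "(LINT x|lborel. cis (2 * pi * y * x) * gauss 1 x) = gauss 1 y"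
proof -
  define c where "c = sqrt (2 * pi)"
  have c: "c > 0" "c\<^sup>2 = 2 * pi" by (auto simp: c_def)
  have eq: "gauss 1 x = c * std_normal_density (0 + c * x)" for x
    using c by (simp add: std_normal_density_def gauss_def power_mult_distrib c_def)
  have "integrable lborel (\<lambda>x. std_normal_density (0 + c * x))"
    using integrable_std_normal_moment[of 0] c by (intro lborel_integrable_real_affine) auto
  then show I: "integrable lborel (gauss 1)"
    unfolding eq by (rule integrable_mult_right)
  define t where "t = c * y"
  have t: "2 * pi * y = t * c" using c by (simp add: t_def power2_eq_square algebra_simps)
  have "complex_of_real (gauss 1 y) = char std_normal_distribution t"
    using c by (simp add: char_std_normal_distribution gauss_def t_def power_mult_distrib del: of_real_exp)
  also have "\<dots> = (LINT x|lborel. std_normal_density x *\<^sub>R iexp (t * x))"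
    unfolding char_def by (subst integral_density) auto
  also have "\<dots> = c *\<^sub>R (LINT x|lborel. std_normal_density (0 + c * x) *\<^sub>R iexp (t * (0 + c * x)))"
    using c by (subst lborel_integral_real_affine[where c=c and t=0]) auto
  also have "\<dots> = (LINT x|lborel. cis (2 * pi * y * x) * gauss 1 x)"
    unfolding eq t by (subst integral_scaleR_right[symmetric]) (simp add: cis_conv_exp scaleR_conv_of_real mult_ac)
  finally show "(LINT x|lborel. cis (2 * pi * y * x) * gauss 1 x) = gauss 1 y" by simp
qed

lemma integral_gauss_1: "(LINT x|lborel. gauss 1 x) = 1"
proof -
  have "complex_of_real (LINT x|lborel. gauss 1 x) = of_real (gauss 1 0)"
    using fourier_std_gauss(2)[of 0] by (simp del: of_real_1)
  then have "(LINT x|lborel. gauss 1 x) = gauss 1 0" unfolding of_real_eq_iff .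
  then show ?thesis by (simp add: gauss_def[of 1 0])
qed

lemma integrable_gauss: 
  assumes "\<epsilon> \<noteq> 0" shows "integrable lborel (gauss \<epsilon>)"
  using lborel_integrable_real_affine[OF fourier_std_gauss(1) assms, of 0]
  by (simp add: gauss_def[abs_def])

lemma fourier_gauss:
  assumes "\<epsilon> > 0"
  shows "(LINT x|lborel. cis (2 * pi * y * x) * gauss \<epsilon> x) = gauss (1 / \<epsilon>) y / \<epsilon>"
proof -
  have "complex_of_real (gauss 1 (y / \<epsilon>)) = (LINT x|lborel. cis (2 * pi * (y / \<epsilon>) * x) * gauss 1 x)"
    by (rule fourier_std_gauss(2)[symmetric])
  also have "\<dots> = \<bar>\<epsilon>\<bar> *\<^sub>R (LINT x|lborel. cis (2 * pi * (y / \<epsilon>) * (0 + \<epsilon> * x)) * gauss 1 (0 + \<epsilon> * x))"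
    using assms by (subst lborel_integral_real_affine[where c=\<epsilon> and t=0]) auto
  also have "\<dots> = \<epsilon> * (LINT x|lborel. cis (2 * pi * y * x) * gauss \<epsilon> x)"
    using assms by (simp add: gauss_def scaleR_conv_of_real mult.assoc)
  finally show ?thesis using assms by (simp add: gauss_def field_simps)
qed

lemma nn_integral_gauss:
  assumes "\<epsilon> > 0" "a \<noteq> 0"
  shows "(\<integral>\<^sup>+x. ennreal (gauss \<epsilon> (a * (x - y))) \<partial>lborel) = ennreal (1 / (\<epsilon> * \<bar>a\<bar>))"
proof -
  have "(\<integral>\<^sup>+x. ennreal (gauss 1 x) \<partial>lborel) = ennreal (LINT x|lborel. gauss 1 x)"
    by (rule nn_integral_eq_integral[OF fourier_std_gauss(1)]) simp
  then have 1: "(\<integral>\<^sup>+x. ennreal (gauss 1 x) \<partial>lborel) = 1" by (simp add: integral_gauss_1)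
  have "(\<integral>\<^sup>+x. ennreal (gauss 1 x) \<partial>lborel)
      = ennreal (\<epsilon> * \<bar>a\<bar>) * (\<integral>\<^sup>+x. ennreal (gauss 1 (- \<epsilon> * a * y + (\<epsilon> * a) * x)) \<partial>lborel)"
    using assms by (subst nn_integral_real_affine[where c="\<epsilon> * a" and t="- \<epsilon> * a * y"]) (auto simp: abs_mult)
  also have "(\<lambda>x. gauss 1 (- \<epsilon> * a * y + (\<epsilon> * a) * x)) = (\<lambda>x. gauss \<epsilon> (a * (x - y)))"
    by (auto simp: gauss_def algebra_simps)
  finally have "ennreal (\<epsilon> * \<bar>a\<bar>) * (\<integral>\<^sup>+x. ennreal (gauss \<epsilon> (a * (x - y))) \<partial>lborel) = 1"
    using 1 by simp
  then have "ennreal (1 / (\<epsilon> * \<bar>a\<bar>)) * (ennreal (\<epsilon> * \<bar>a\<bar>) * (\<integral>\<^sup>+x. ennreal (gauss \<epsilon> (a * (x - y))) \<partial>lborel)) = ennreal (1 / (\<epsilon> * \<bar>a\<bar>))"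
    by simp
  then show ?thesis using assms by (simp add: mult.assoc[symmetric] flip: ennreal_mult)
qed

text \<open>Write the square of the norm as \<open>osc_int\<close> times its conjugate and exchange
  integrals twice; the remaining x-integral is the Fourier transform of
  \<open>gauss \<epsilon>\<close> at \<open>\<Phi> \<eta> - \<Phi> \<xi>\<close>. The Gaussian
  supplies the integrability in x for both exchanges, since \<open>osc_int\<close> itself is only
  known to be bounded.\<close>

lemma osc_int_energy_gauss:
  assumes [measurable]: "\<Phi> \<in> borel_measurable borel" and F: "integrable lborel F" and \<epsilon>: "\<epsilon> > 0"
  shows "(LINT x|lborel. complex_of_real (gauss \<epsilon> x * (norm (osc_int \<Phi> F x))\<^sup>2))
    = (LINT \<eta>|lborel. F \<eta> * (LINT \<xi>|lborel. cnj (F \<xi>) * of_real (gauss (1 / \<epsilon>) (\<Phi> \<eta> - \<Phi> \<xi>) / \<epsilon>)))"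
proof -
  have [measurable]: "F \<in> borel_measurable borel" using F by auto
  have G: "integrable lborel (\<lambda>x. complex_of_real (gauss \<epsilon> x))"
    using integrable_gauss[of \<epsilon>] \<epsilon> by (intro integrable_of_real) auto
  have cF: "integrable lborel (\<lambda>x. cnj (F x))" using F by simp
  define u where "u = (\<lambda>x. complex_of_real (gauss \<epsilon> x) * cnj (osc_int \<Phi> F x))"
  have u: "integrable lborel u"
    unfolding u_def
  proof (rule Bochner_Integration.integrable_bound[OF integrable_mult_right[OF G, of "of_real (LINT \<eta>|lborel. norm (F \<eta>))"]])
    show "AE x in lborel. norm (complex_of_real (gauss \<epsilon> x) * cnj (osc_int \<Phi> F x))
        \<le> norm (complex_of_real (LINT \<eta>|lborel. norm (F \<eta>)) * complex_of_real (gauss \<epsilon> x))"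
      using norm_osc_int_le[OF F, of \<Phi>]
      by (intro AE_I2) (simp add: norm_mult mult.commute mult_left_mono abs_of_nonneg del: integral_complex_of_real)
  qed simp
  have cn: "cnj (osc_int \<Phi> F x) = (LINT \<xi>|lborel. cis (- (2 * pi * \<Phi> \<xi> * x)) * cnj (F \<xi>))" for x
    unfolding osc_int_def Bochner_Integration.integral_cnj[symmetric] by (simp only: complex_cnj_mult cis_cnj)
  have inner: "(LINT x|lborel. cis (2 * pi * \<Phi> \<eta> * x) * u x)
      = (LINT \<xi>|lborel. cnj (F \<xi>) * of_real (gauss (1 / \<epsilon>) (\<Phi> \<eta> - \<Phi> \<xi>) / \<epsilon>))" for \<eta>
  proof -
    have "(LINT x|lborel. cis (2 * pi * \<Phi> \<eta> * x) * u x)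
        = (LINT x|lborel. (cis (2 * pi * \<Phi> \<eta> * x) * complex_of_real (gauss \<epsilon> x)) *
            (LINT \<xi>|lborel. cis (- (2 * pi * \<Phi> \<xi> * x)) * cnj (F \<xi>)))"
      by (simp add: u_def cn mult.assoc)
    also have "\<dots> = (LINT \<xi>|lborel. cnj (F \<xi>) * (LINT x|lborel. cis (- (2 * pi * \<Phi> \<xi> * x)) * (cis (2 * pi * \<Phi> \<eta> * x) * complex_of_real (gauss \<epsilon> x))))"
      by (rule Fubini_bounded_kernel[where B=1]) (use cF G in \<open>auto intro!: integrable_cis_mult\<close>)
    also have "(\<lambda>\<xi>. LINT x|lborel. cis (- (2 * pi * \<Phi> \<xi> * x)) * (cis (2 * pi * \<Phi> \<eta> * x) * complex_of_real (gauss \<epsilon> x)))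
       = (\<lambda>\<xi>. of_real (gauss (1 / \<epsilon>) (\<Phi> \<eta> - \<Phi> \<xi>) / \<epsilon>))"
    proof
      fix \<xi>
      have "cis (- (2 * pi * \<Phi> \<xi> * x)) * (cis (2 * pi * \<Phi> \<eta> * x) * complex_of_real (gauss \<epsilon> x))
         = cis (2 * pi * (\<Phi> \<eta> - \<Phi> \<xi>) * x) * gauss \<epsilon> x" for x
        by (simp add: mult.assoc[symmetric] cis_mult) (simp add: algebra_simps)
      then show "(LINT x|lborel. cis (- (2 * pi * \<Phi> \<xi> * x)) * (cis (2 * pi * \<Phi> \<eta> * x) * complex_of_real (gauss \<epsilon> x)))
          = of_real (gauss (1 / \<epsilon>) (\<Phi> \<eta> - \<Phi> \<xi>) / \<epsilon>)"
        by (simp only: fourier_gauss[OF \<epsilon>])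
    qed
    finally show ?thesis .
  qed
  have "complex_of_real (gauss \<epsilon> x * (norm (osc_int \<Phi> F x))\<^sup>2) = u x * (LINT \<eta>|lborel. cis (2 * pi * \<Phi> \<eta> * x) * F \<eta>)" for x
    unfolding u_def osc_int_def[symmetric] of_real_mult complex_norm_square by (simp add: mult_ac)
  then have "(LINT x|lborel. complex_of_real (gauss \<epsilon> x * (norm (osc_int \<Phi> F x))\<^sup>2))
      = (LINT x|lborel. u x * (LINT \<eta>|lborel. cis (2 * pi * \<Phi> \<eta> * x) * F \<eta>))" by (simp only:)
  also have "\<dots> = (LINT \<eta>|lborel. F \<eta> * (LINT x|lborel. cis (2 * pi * \<Phi> \<eta> * x) * u x))"
    by (rule Fubini_bounded_kernel[where B=1]) (use u F in auto)
  finally show ?thesis unfolding inner .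
qed

text \<open>
  The Gaussian regularisation turns the square of the norm into a quadratic form with a positive
  kernel, which the expansion hypothesis dominates by a convolution kernel of mass \<open>L\<close>.
\<close>

lemma osc_int_L2_bound:
  assumes [measurable]: "\<Phi> \<in> borel_measurable borel" and F: "integrable lborel F" and L: "L > 0"
    and exp: "\<And>\<eta> \<xi>. \<bar>\<eta> - \<xi>\<bar> \<le> L * \<bar>\<Phi> \<eta> - \<Phi> \<xi>\<bar>"
  shows "(\<integral>\<^sup>+x. ennreal ((norm (osc_int \<Phi> F x))\<^sup>2) \<partial>lborel) \<le> ennreal L * (\<integral>\<^sup>+\<eta>. ennreal ((norm (F \<eta>))\<^sup>2) \<partial>lborel)"
proof -
  have [measurable]: "F \<in> borel_measurable borel" using F by auto
  let ?N = "\<integral>\<^sup>+\<eta>. ennreal ((norm (F \<eta>))\<^sup>2) \<partial>lborel"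
  have reg: "(\<integral>\<^sup>+x. ennreal (gauss \<epsilon> x * (norm (osc_int \<Phi> F x))\<^sup>2) \<partial>lborel) \<le> ennreal L * ?N"
    if \<epsilon>: "\<epsilon> > 0" for \<epsilon>
  proof -
    let ?k = "\<lambda>\<eta> \<xi>. gauss (1 / \<epsilon>) (\<Phi> \<eta> - \<Phi> \<xi>) / \<epsilon>"
    have ksym: "?k \<eta> \<xi> = ?k \<xi> \<eta>" for \<eta> \<xi>
      by (simp add: gauss_def power2_eq_square algebra_simps)
    \<comment> \<open>Schur test: the expansion hypothesis allows replacing
      \<open>\<Phi> \<xi> - \<Phi> \<eta>\<close> by \<open>(\<xi> - \<eta>) / L\<close> inside the
      Gaussian, and the resulting mass is L for every \<epsilon>.\<close>
    have kint: "(\<integral>\<^sup>+\<xi>. ennreal (?k \<xi> \<eta>) \<partial>lborel) \<le> ennreal L" for \<eta>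
    proof -
      have "gauss (1 / \<epsilon>) (\<Phi> \<xi> - \<Phi> \<eta>) \<le> gauss (1 / \<epsilon>) (1 / L * (\<xi> - \<eta>))" for \<xi>
      proof -
        have "\<bar>1 / \<epsilon> * (1 / L * (\<xi> - \<eta>))\<bar> \<le> \<bar>1 / \<epsilon> * (\<Phi> \<xi> - \<Phi> \<eta>)\<bar>"
          using exp[of \<xi> \<eta>] L \<epsilon> by (simp add: abs_mult field_simps)
        then have "(1 / \<epsilon> * (1 / L * (\<xi> - \<eta>)))\<^sup>2 \<le> (1 / \<epsilon> * (\<Phi> \<xi> - \<Phi> \<eta>))\<^sup>2"
          by (simp only: abs_le_square_iff)
        then show ?thesis unfolding gauss_def by simp
      qed
      then have "(\<integral>\<^sup>+\<xi>. ennreal (?k \<xi> \<eta>) \<partial>lborel) \<le> (\<integral>\<^sup>+\<xi>. ennreal (1 / \<epsilon>) * ennreal (gauss (1 / \<epsilon>) (1 / L * (\<xi> - \<eta>))) \<partial>lborel)"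
        using \<epsilon> by (intro nn_integral_mono) (simp add: ennreal_mult[symmetric] divide_right_mono)
      also have "\<dots> = ennreal (1 / \<epsilon>) * ennreal (1 / (1 / \<epsilon> * \<bar>1 / L\<bar>))"
        using \<epsilon> L by (subst nn_integral_cmult, simp, subst nn_integral_gauss) simp_all
      also have "\<dots> = ennreal L" using \<epsilon> L by (simp add: ennreal_mult[symmetric])
      finally show ?thesis .
    qed
    have Gi: "integrable lborel (gauss \<epsilon>)" using \<epsilon> by (intro integrable_gauss) auto
    have I: "integrable lborel (\<lambda>x. gauss \<epsilon> x * (norm (osc_int \<Phi> F x))\<^sup>2)"
    proof (rule Bochner_Integration.integrable_bound[OF integrable_mult_left[OF Gi, of "(LINT \<eta>|lborel. norm (F \<eta>))\<^sup>2"]])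
      show "AE x in lborel. norm (gauss \<epsilon> x * (norm (osc_int \<Phi> F x))\<^sup>2) \<le> norm (gauss \<epsilon> x * (LINT \<eta>|lborel. norm (F \<eta>))\<^sup>2)"
        using norm_osc_int_le[OF F, of \<Phi>] by (intro AE_I2) (simp add: abs_mult mult_left_mono power_mono)
    qed simp
    have "(\<integral>\<^sup>+x. ennreal (gauss \<epsilon> x * (norm (osc_int \<Phi> F x))\<^sup>2) \<partial>lborel)
        = ennreal (LINT x|lborel. gauss \<epsilon> x * (norm (osc_int \<Phi> F x))\<^sup>2)"
      by (rule nn_integral_eq_integral[OF I]) simp
    also have "\<dots> \<le> ennreal (norm (LINT x|lborel. complex_of_real (gauss \<epsilon> x * (norm (osc_int \<Phi> F x))\<^sup>2)))"
      unfolding integral_complex_of_real by (simp add: ennreal_leI)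
    also have "\<dots> = ennreal (norm (LINT \<eta>|lborel. F \<eta> * (LINT \<xi>|lborel. cnj (F \<xi>) * of_real (?k \<eta> \<xi>))))"
      using osc_int_energy_gauss[OF _ F \<epsilon>, of \<Phi>] by simp
    also have "\<dots> \<le> (\<integral>\<^sup>+\<eta>. ennreal (norm (F \<eta>)) * ennreal (norm (LINT \<xi>|lborel. cnj (F \<xi>) * of_real (?k \<eta> \<xi>))) \<partial>lborel)"
      unfolding ennreal_mult[OF norm_ge_zero norm_ge_zero, symmetric] norm_mult[symmetric]
      by (rule norm_integral_le_nn_integral) 
    also have "\<dots> \<le> (\<integral>\<^sup>+\<eta>. ennreal (norm (F \<eta>)) * (\<integral>\<^sup>+\<xi>. ennreal (norm (F \<xi>) * ?k \<eta> \<xi>) \<partial>lborel) \<partial>lborel)"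
    proof (intro nn_integral_mono mult_left_mono)
      fix \<eta>
      have "ennreal (norm (LINT \<xi>|lborel. cnj (F \<xi>) * of_real (?k \<eta> \<xi>))) \<le> (\<integral>\<^sup>+\<xi>. ennreal (norm (cnj (F \<xi>) * of_real (?k \<eta> \<xi>))) \<partial>lborel)"
        by (rule norm_integral_le_nn_integral)
      also have "\<dots> = (\<integral>\<^sup>+\<xi>. ennreal (norm (F \<xi>) * ?k \<eta> \<xi>) \<partial>lborel)"
        using \<epsilon> by (simp add: norm_mult norm_divide)
      finally show "ennreal (norm (LINT \<xi>|lborel. cnj (F \<xi>) * of_real (?k \<eta> \<xi>))) \<le> \<dots>" .
    qed simp
    also have "\<dots> = (\<integral>\<^sup>+\<eta>. \<integral>\<^sup>+\<xi>. ennreal (norm (F \<eta>) * norm (F \<xi>) * ?k \<eta> \<xi>) \<partial>lborel \<partial>lborel)"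
      using \<epsilon> by (subst nn_integral_cmult[symmetric]) (simp_all add: ennreal_mult'[symmetric] mult.assoc)
    \<comment> \<open>2ab \<le> a^2 + b^2 splits the quadratic form into two halves. Symmetry of the
      kernel lets Tonelli identify them, and each costs L/2.\<close>
    also have "\<dots> \<le> (\<integral>\<^sup>+\<eta>. \<integral>\<^sup>+\<xi>. ennreal ((norm (F \<eta>))\<^sup>2 / 2 * ?k \<xi> \<eta>) + ennreal ((norm (F \<xi>))\<^sup>2 / 2 * ?k \<eta> \<xi>) \<partial>lborel \<partial>lborel)"
    proof (intro nn_integral_mono)
      fix \<eta> \<xi>
      have "norm (F \<eta>) * norm (F \<xi>) \<le> (norm (F \<eta>))\<^sup>2 / 2 + (norm (F \<xi>))\<^sup>2 / 2"
        using sum_squares_bound[of "norm (F \<eta>)" "norm (F \<xi>)"] by simp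
      then have "norm (F \<eta>) * norm (F \<xi>) * ?k \<eta> \<xi> \<le> ((norm (F \<eta>))\<^sup>2 / 2 + (norm (F \<xi>))\<^sup>2 / 2) * ?k \<eta> \<xi>"
        using \<epsilon> by (intro mult_right_mono) auto
      then show "ennreal (norm (F \<eta>) * norm (F \<xi>) * ?k \<eta> \<xi>) \<le> ennreal ((norm (F \<eta>))\<^sup>2 / 2 * ?k \<xi> \<eta>) + ennreal ((norm (F \<xi>))\<^sup>2 / 2 * ?k \<eta> \<xi>)"
        unfolding ksym[of \<xi> \<eta>] distrib_right using \<epsilon> by (simp add: ennreal_leI flip: ennreal_plus)
    qed
    also have "\<dots> = (\<integral>\<^sup>+\<eta>. \<integral>\<^sup>+\<xi>. ennreal ((norm (F \<eta>))\<^sup>2 / 2 * ?k \<xi> \<eta>) \<partial>lborel \<partial>lborel)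
                 + (\<integral>\<^sup>+\<eta>. \<integral>\<^sup>+\<xi>. ennreal ((norm (F \<xi>))\<^sup>2 / 2 * ?k \<eta> \<xi>) \<partial>lborel \<partial>lborel)"
      by (simp add: nn_integral_add)
    also have "(\<integral>\<^sup>+\<eta>. \<integral>\<^sup>+\<xi>. ennreal ((norm (F \<xi>))\<^sup>2 / 2 * ?k \<eta> \<xi>) \<partial>lborel \<partial>lborel)
        = (\<integral>\<^sup>+\<eta>. \<integral>\<^sup>+\<xi>. ennreal ((norm (F \<eta>))\<^sup>2 / 2 * ?k \<xi> \<eta>) \<partial>lborel \<partial>lborel)"
      by (rule lborel_pair.Fubini') measurable
    also have "(\<integral>\<^sup>+\<eta>. \<integral>\<^sup>+\<xi>. ennreal ((norm (F \<eta>))\<^sup>2 / 2 * ?k \<xi> \<eta>) \<partial>lborel \<partial>lborel) 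
        \<le> (\<integral>\<^sup>+\<eta>. ennreal ((norm (F \<eta>))\<^sup>2 / 2) * ennreal L \<partial>lborel)"
    proof (intro nn_integral_mono)
      fix \<eta>
      have "(\<integral>\<^sup>+\<xi>. ennreal ((norm (F \<eta>))\<^sup>2 / 2 * ?k \<xi> \<eta>) \<partial>lborel) = ennreal ((norm (F \<eta>))\<^sup>2 / 2) * (\<integral>\<^sup>+\<xi>. ennreal (?k \<xi> \<eta>) \<partial>lborel)"
        using \<epsilon> by (subst nn_integral_cmult[symmetric]) (simp_all add: ennreal_mult[symmetric])
      also have "\<dots> \<le> ennreal ((norm (F \<eta>))\<^sup>2 / 2) * ennreal L" by (intro mult_left_mono kint) simp
      finally show "(\<integral>\<^sup>+\<xi>. ennreal ((norm (F \<eta>))\<^sup>2 / 2 * ?k \<xi> \<eta>) \<partial>lborel) \<le> \<dots>" .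
    qed
    also have "(\<integral>\<^sup>+\<eta>. ennreal ((norm (F \<eta>))\<^sup>2 / 2) * ennreal L \<partial>lborel) = ennreal (L / 2) * ?N"
      using L by (subst nn_integral_cmult[symmetric]) (simp_all add: ennreal_mult[symmetric] mult.commute)
    finally have "(\<integral>\<^sup>+x. ennreal (gauss \<epsilon> x * (norm (osc_int \<Phi> F x))\<^sup>2) \<partial>lborel) \<le> ennreal (L / 2) * ?N + ennreal (L / 2) * ?N"
      by (simp add: add_mono)
    also have "\<dots> = ennreal L * ?N"
      using L by (subst distrib_right[symmetric]) (simp flip: ennreal_plus)
    finally show ?thesis .
  qed
  \<comment> \<open>The weight tends to 1 pointwise and the bound is uniform in \<epsilon>, so Fatou
    removes the regularisation.\<close>
  have lim: "(\<lambda>n. ennreal (gauss (1 / Suc n) x * (norm (osc_int \<Phi> F x))\<^sup>2)) \<longlonglongrightarrow> ennreal ((norm (osc_int \<Phi> F x))\<^sup>2)" for x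
  proof -
    have "(\<lambda>n. 1 / real (Suc n)) \<longlonglongrightarrow> 0" using LIMSEQ_inverse_real_of_nat by (simp add: inverse_eq_divide)
    then have "(\<lambda>n. gauss (1 / Suc n) x * (norm (osc_int \<Phi> F x))\<^sup>2) \<longlonglongrightarrow> exp (- pi * (0 * x)\<^sup>2) * (norm (osc_int \<Phi> F x))\<^sup>2"
      unfolding gauss_def by (intro tendsto_intros)
    then show ?thesis by (intro tendsto_ennrealI) simp
  qed
  have "(\<integral>\<^sup>+x. ennreal ((norm (osc_int \<Phi> F x))\<^sup>2) \<partial>lborel)
      = (\<integral>\<^sup>+x. liminf (\<lambda>n. ennreal (gauss (1 / Suc n) x * (norm (osc_int \<Phi> F x))\<^sup>2)) \<partial>lborel)"
    using lim_imp_Liminf[OF sequentially_bot lim] by simp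
  also have "\<dots> \<le> liminf (\<lambda>n. \<integral>\<^sup>+x. ennreal (gauss (1 / Suc n) x * (norm (osc_int \<Phi> F x))\<^sup>2) \<partial>lborel)"
    by (rule nn_integral_liminf) simp
  also have "\<dots> \<le> liminf (\<lambda>n. ennreal L * ?N)"
    by (intro Liminf_mono always_eventually allI reg) simp
  also have "\<dots> = ennreal L * ?N" by (simp add: Liminf_const)
  finally show ?thesis .
qed

section \<open>Fourier transforms of differentiable functions\<close>

lemma has_vector_derivative_cis [derivative_intros]:
  assumes "(\<theta> has_real_derivative \<theta>') (at t within S)"
  shows "((\<lambda>t. cis (\<theta> t)) has_vector_derivative \<i> * of_real \<theta>' * cis (\<theta> t)) (at t within S)"
proof -
  have "((\<lambda>t. iexp (\<theta> t)) has_vector_derivative \<theta>' *\<^sub>R (\<i> * iexp (\<theta> t))) (at t within S)"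
    using vector_diff_chain_within[OF assms[unfolded has_real_derivative_iff_has_vector_derivative] has_vector_derivative_iexp]
    by (simp add: comp_def)
  then show ?thesis by (simp add: cis_conv_exp scaleR_conv_of_real mult_ac)
qed

lemma integral_deriv_eq_0:
  fixes v :: "real \<Rightarrow> complex"
  assumes "\<And>t. (v has_vector_derivative v' t) (at t)" "continuous_on UNIV v'" "integrable lborel v'"
    and "(v \<longlongrightarrow> 0) at_top" "(v \<longlongrightarrow> 0) at_bot"
  shows "(LINT t|lborel. v' t) = 0"
proof -
  have "(LBINT x=-\<infinity>..\<infinity>. v' x) = 0 - 0"
    by (rule interval_integral_FTC_integrable[where F=v])
       (use assms in \<open>auto simp: ereal_tendsto_simps set_integrable_def continuous_on_eq_continuous_at\<close>)
  then show ?thesis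
    by (simp add: interval_lebesgue_integral_def set_lebesgue_integral_def)
qed

text \<open>Integration by parts: the derivative of the product of \<open>cis\<close> and
  \<open>u\<close> has integral 0, because \<open>u\<close> vanishes at both ends.\<close>

lemma fourier_deriv:
  assumes du: "\<And>t. (u has_vector_derivative u' t) (at t)" and cu': "continuous_on UNIV u'"
    and iu: "integrable lborel u" and iu': "integrable lborel u'"
    and lim: "(u \<longlongrightarrow> 0) at_top" "(u \<longlongrightarrow> 0) at_bot"
  shows "osc_int uminus u' \<eta> = 2 * pi * \<eta> * \<i> * osc_int uminus u \<eta>"
proof -
  let ?c = "\<lambda>t. cis (2 * pi * - t * \<eta>)"
  let ?v' = "\<lambda>t. ?c t * u' t - 2 * pi * \<eta> * \<i> * (?c t * u t)"
  have cu: "continuous_on UNIV u"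
    using du by (intro continuous_at_imp_continuous_on) (auto intro: has_vector_derivative_continuous)
  have d: "((\<lambda>t. ?c t * u t) has_vector_derivative ?v' t) (at t)" for t
  proof -
    have "(?c has_vector_derivative \<i> * of_real (- (2 * pi * \<eta>)) * ?c t) (at t)"
      by (rule has_vector_derivative_cis) (auto intro!: derivative_eq_intros)
    from has_vector_derivative_mult[OF this du] show ?thesis by (simp add: algebra_simps)
  qed
  have i: "integrable lborel (\<lambda>t. ?c t * u t)" "integrable lborel (\<lambda>t. ?c t * u' t)"
    by (auto intro!: integrable_cis_mult iu iu')
  have l: "((\<lambda>t. ?c t * u t) \<longlongrightarrow> 0) F" if "(u \<longlongrightarrow> 0) F" for F
    using that by (subst tendsto_norm_zero_iff[symmetric]) (simp add: norm_mult tendsto_norm_zero)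
  have "(LINT t|lborel. ?v' t) = 0"
  proof (rule integral_deriv_eq_0[OF d])
    show "continuous_on UNIV ?v'" by (intro continuous_intros cu cu')
    show "integrable lborel ?v'" using i by (intro Bochner_Integration.integrable_diff integrable_mult_right)
  qed (use l lim in auto)
  also have "(LINT t|lborel. ?v' t) = osc_int uminus u' \<eta> - 2 * pi * \<eta> * \<i> * osc_int uminus u \<eta>"
    unfolding osc_int_def
    by (subst Bochner_Integration.integral_diff[OF i(2) integrable_mult_right[OF i(1)]]) (simp only: integral_mult_right_zero)
  finally show ?thesis by simp
qed

lemma integrable_inverse_1_plus_square_UNIV: "integrable lborel (\<lambda>x::real. 1 / (1 + x\<^sup>2))"
  using integrable_inverse_1_plus_square by (simp add: set_integrable_def inverse_eq_divide)

lemma nn_integral_Poisson_kernel: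
  assumes "R > 0"
  shows "(\<integral>\<^sup>+y. ennreal (1 / (1 + (y / R)\<^sup>2)) \<partial>lborel) = ennreal (pi * R)"
proof -
  have "(\<integral>\<^sup>+y. ennreal (1 / (1 + y\<^sup>2)) \<partial>lborel) = ennreal (LINT y|lborel. 1 / (1 + y\<^sup>2))"
    by (rule nn_integral_eq_integral[OF integrable_inverse_1_plus_square_UNIV]) simp
  also have "(LINT y|lborel. 1 / (1 + y\<^sup>2)) = pi"
    using LBINT_inverse_1_plus_square
    by (simp add: interval_lebesgue_integral_def set_lebesgue_integral_def inverse_eq_divide)
  finally have 1: "(\<integral>\<^sup>+y. ennreal (1 / (1 + y\<^sup>2)) \<partial>lborel) = ennreal pi" .
  have "(\<integral>\<^sup>+y. ennreal (1 / (1 + (y / R)\<^sup>2)) \<partial>lborel) = ennreal R * (\<integral>\<^sup>+y. ennreal (1 / (1 + y\<^sup>2)) \<partial>lborel)"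
    using assms by (subst nn_integral_real_affine[where c=R and t=0]) auto
  then show ?thesis using assms by (simp add: 1 ennreal_mult mult.commute)
qed

text \<open>
  Replaces the Cauchy--Schwarz inequality against the weight \<open>1 + (y/R)\<^sup>2\<close> by a pointwise
  arithmetic--geometric mean inequality; \<open>R\<close> is the scale at which \<open>u\<close> varies.
\<close>

lemma fourier_L1_bound:
  assumes du: "\<And>t. (u has_vector_derivative u' t) (at t)" and cu': "continuous_on UNIV u'"
    and iu: "integrable lborel u" and iu': "integrable lborel u'"
    and lim: "(u \<longlongrightarrow> 0) at_top" "(u \<longlongrightarrow> 0) at_bot"
    and a: "(\<integral>\<^sup>+t. ennreal ((norm (u t))\<^sup>2) \<partial>lborel) \<le> ennreal a"
    and b: "(\<integral>\<^sup>+t. ennreal ((norm (u' t))\<^sup>2) \<partial>lborel) \<le> ennreal b"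
    and ab: "a \<ge> 0" "b \<ge> 0" and R: "R > 0"
  shows "(\<integral>\<^sup>+y. ennreal (norm (osc_int uminus u y)) \<partial>lborel)
    \<le> ennreal (sqrt R / 2 * (a + b / (4 * pi\<^sup>2 * R\<^sup>2) + pi))"
proof -
  let ?U = "osc_int uminus u" and ?V = "osc_int uminus u'"
  \<comment> \<open>With k = 1 + (y/R)^2 and n the norm of the transform, s r = 1/4 gives n \<le> s
    k n^2 + r/k. The split between s and r is balanced so that all three terms are of order sqrt R
    when a = O(1) and b = O(R^2).\<close>
  define s where "s = sqrt R / 2"
  define q where "q = sqrt R / 2 / (4 * pi\<^sup>2 * R\<^sup>2)"
  define r where "r = 1 / (2 * sqrt R)"
  have pos: "s \<ge> 0" "q \<ge> 0" "r \<ge> 0" using R by (auto simp: s_def q_def r_def)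
  have [measurable]: "u \<in> borel_measurable borel" "u' \<in> borel_measurable borel" using iu iu' by auto
  have P: "(\<integral>\<^sup>+y. ennreal ((norm (osc_int uminus w y))\<^sup>2) \<partial>lborel) \<le> (\<integral>\<^sup>+t. ennreal ((norm (w t))\<^sup>2) \<partial>lborel)"
    if "integrable lborel w" for w
    using osc_int_L2_bound[OF _ that, of uminus 1] by simp
  have pt: "norm (?U y) \<le> s * (norm (?U y))\<^sup>2 + q * (norm (?V y))\<^sup>2 + r * (1 / (1 + (y / R)\<^sup>2))" for y
  proof -
    define n where "n = norm (?U y)"
    define k where "k = 1 + (y / R)\<^sup>2"
    have k: "k > 0" unfolding k_def by (simp add: add_pos_nonneg)
    have V: "(norm (?V y))\<^sup>2 = (2 * pi * y)\<^sup>2 * n\<^sup>2"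
      unfolding fourier_deriv[OF du cu' iu iu' lim] n_def by (simp add: norm_mult power_mult_distrib abs_mult)
    have "0 \<le> (R * k * n - sqrt R)\<^sup>2 * (1 / (2 * sqrt R * R * k))" using R k by simp
    also have "\<dots> = s * k * n\<^sup>2 + r * (1 / k) - n"
    proof -
      define w where "w = sqrt R"
      have w: "w > 0" "R = w * w" using R by (auto simp: w_def)
      have "(w * w * k * n - w)\<^sup>2 * (1 / (2 * w * (w * w) * k)) = w / 2 * k * n\<^sup>2 + 1 / (2 * w) * (1 / k) - n"
        using w k by (simp add: field_simps power2_eq_square)
      then show ?thesis unfolding s_def r_def w_def[symmetric] w(2)[symmetric] .
    qed
    \<comment> \<open>The part (y/R)^2 n^2 of k n^2 is expressed through the transform of
      \<open>u'\<close>, whose norm is 2 pi |y| n; this is the origin of 4 pi^2 R^2 in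
      \<open>q\<close>.\<close>
    also have "s * k * n\<^sup>2 = s * n\<^sup>2 + q * (norm (?V y))\<^sup>2"
      unfolding V s_def q_def k_def using R by (simp add: power_divide power_mult_distrib distrib_left distrib_right)
    finally show ?thesis by (simp add: n_def k_def)
  qed
  have "(\<integral>\<^sup>+y. ennreal (norm (?U y)) \<partial>lborel)
      \<le> (\<integral>\<^sup>+y. ennreal s * ennreal ((norm (?U y))\<^sup>2) + ennreal q * ennreal ((norm (?V y))\<^sup>2) + ennreal r * ennreal (1 / (1 + (y / R)\<^sup>2)) \<partial>lborel)"
    using pos pt by (intro nn_integral_mono) (simp add: ennreal_mult[symmetric] ennreal_leI flip: ennreal_plus)
  also have "\<dots> = ennreal s * (\<integral>\<^sup>+y. ennreal ((norm (?U y))\<^sup>2) \<partial>lborel) + ennreal q * (\<integral>\<^sup>+y. ennreal ((norm (?V y))\<^sup>2) \<partial>lborel)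
      + ennreal r * ennreal (pi * R)"
    by (simp add: nn_integral_add nn_integral_cmult nn_integral_Poisson_kernel[OF R])
  also have "\<dots> \<le> ennreal s * ennreal a + ennreal q * ennreal b + ennreal r * ennreal (pi * R)"
    by (intro add_mono mult_left_mono order_refl order_trans[OF P a] order_trans[OF P b] iu iu') auto
  also have "\<dots> = ennreal (s * a + q * b + r * (pi * R))"
    using pos ab R by (simp add: ennreal_mult[symmetric] flip: ennreal_plus)
  also have "s * a + q * b + r * (pi * R) = sqrt R / 2 * (a + b / (4 * pi\<^sup>2 * R\<^sup>2) + pi)"
  proof -
    have "r * (pi * R) = sqrt R / 2 * pi"
      using R real_div_sqrt[of R] by (simp add: r_def field_simps)
    then show ?thesis by (simp add: s_def q_def distrib_left)
  qed
  finally show ?thesis .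
qed

text \<open>A Gaussian factor in \<eta> permits Fubini and turns the left side into an average of f
  around x. The substitution t = x - \<epsilon> s moves \<epsilon> into the argument of f, so both
  sides converge as \<epsilon> tends to 0 by dominated convergence with fixed majorants.\<close>

lemma fourier_inversion:
  assumes f: "integrable lborel f" and cf: "continuous_on UNIV f" and bf: "\<And>t. norm (f t) \<le> B"
    and fh: "integrable lborel (osc_int uminus f)"
  shows "osc_int (\<lambda>\<eta>. \<eta>) (osc_int uminus f) x = f x"
proof -
  have [measurable]: "f \<in> borel_measurable borel" using f by auto
  have B0: "B \<ge> 0" using bf[of 0] norm_ge_zero order_trans by blast
  have reg: "(LINT \<eta>|lborel. (gauss \<epsilon> \<eta> * cis (2 * pi * \<eta> * x)) * osc_int uminus f \<eta>)
      = (LINT s|lborel. f (x - \<epsilon> * s) * gauss 1 s)" if \<epsilon>: "\<epsilon> > 0" for \<epsilon>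
  proof -
    have G: "integrable lborel (\<lambda>\<eta>. complex_of_real (gauss \<epsilon> \<eta>) * cis (2 * pi * \<eta> * x))"
      using integrable_gauss[of \<epsilon>] \<epsilon> by (subst mult.commute) (auto intro!: integrable_cis_mult integrable_of_real)
    have "(LINT \<eta>|lborel. (gauss \<epsilon> \<eta> * cis (2 * pi * \<eta> * x)) * osc_int uminus f \<eta>)
        = (LINT t|lborel. f t * (LINT \<eta>|lborel. cis (2 * pi * - t * \<eta>) * (gauss \<epsilon> \<eta> * cis (2 * pi * \<eta> * x))))"
      unfolding osc_int_def by (rule Fubini_bounded_kernel[where B=1]) (use G f in auto)
    also have "(\<lambda>t. LINT \<eta>|lborel. cis (2 * pi * - t * \<eta>) * (gauss \<epsilon> \<eta> * cis (2 * pi * \<eta> * x))) = (\<lambda>t. of_real (gauss (1 / \<epsilon>) (x - t) / \<epsilon>))"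
    proof
      fix t
      have "cis (2 * pi * - t * \<eta>) * (gauss \<epsilon> \<eta> * cis (2 * pi * \<eta> * x)) = cis (2 * pi * (x - t) * \<eta>) * gauss \<epsilon> \<eta>" for \<eta>
      proof -
        have "cis (2 * pi * - t * \<eta>) * cis (2 * pi * \<eta> * x) = cis (2 * pi * (x - t) * \<eta>)"
          unfolding cis_mult by (simp add: algebra_simps)
        then show ?thesis by (simp only: mult_ac)
      qed
      then show "(LINT \<eta>|lborel. cis (2 * pi * - t * \<eta>) * (gauss \<epsilon> \<eta> * cis (2 * pi * \<eta> * x))) = of_real (gauss (1 / \<epsilon>) (x - t) / \<epsilon>)"
        by (simp only: fourier_gauss[OF \<epsilon>])
    qed
    also have "(LINT t|lborel. f t * of_real (gauss (1 / \<epsilon>) (x - t) / \<epsilon>))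
        = \<bar>- \<epsilon>\<bar> *\<^sub>R (LINT s|lborel. f (x + - \<epsilon> * s) * of_real (gauss (1 / \<epsilon>) (x - (x + - \<epsilon> * s)) / \<epsilon>))"
      using \<epsilon> by (subst lborel_integral_real_affine[where c="-\<epsilon>" and t=x]) auto
    also have "\<dots> = (LINT s|lborel. f (x - \<epsilon> * s) * gauss 1 s)"
      using \<epsilon> unfolding integral_scaleR_right[symmetric]
      by (simp add: gauss_def scaleR_conv_of_real mult_ac)
    finally show ?thesis .
  qed
  let ?\<epsilon> = "\<lambda>n. 1 / real (Suc n)"
  have e0: "?\<epsilon> \<longlonglongrightarrow> 0" using LIMSEQ_inverse_real_of_nat by (simp add: inverse_eq_divide)
  have "(\<lambda>n. LINT \<eta>|lborel. (gauss (?\<epsilon> n) \<eta> * cis (2 * pi * \<eta> * x)) * osc_int uminus f \<eta>)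
      \<longlonglongrightarrow> (LINT \<eta>|lborel. cis (2 * pi * \<eta> * x) * osc_int uminus f \<eta>)"
  proof (rule integral_dominated_convergence[where w="\<lambda>\<eta>. norm (osc_int uminus f \<eta>)"])
    show "AE \<eta> in lborel. (\<lambda>n. (gauss (?\<epsilon> n) \<eta> * cis (2 * pi * \<eta> * x)) * osc_int uminus f \<eta>)
        \<longlonglongrightarrow> cis (2 * pi * \<eta> * x) * osc_int uminus f \<eta>"
    proof (rule AE_I2)
      fix \<eta>
      have "(\<lambda>n. (gauss (?\<epsilon> n) \<eta> * cis (2 * pi * \<eta> * x)) * osc_int uminus f \<eta>)
          \<longlonglongrightarrow> (of_real (exp (- pi * (0 * \<eta>)\<^sup>2)) * cis (2 * pi * \<eta> * x)) * osc_int uminus f \<eta>"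
        unfolding gauss_def by (intro tendsto_intros e0)
      then show "(\<lambda>n. (gauss (?\<epsilon> n) \<eta> * cis (2 * pi * \<eta> * x)) * osc_int uminus f \<eta>)
        \<longlonglongrightarrow> cis (2 * pi * \<eta> * x) * osc_int uminus f \<eta>" by simp
    qed
  qed (use fh in \<open>auto simp: norm_mult mult_left_le_one_le\<close>)
  moreover have "(\<lambda>n. LINT s|lborel. f (x - ?\<epsilon> n * s) * gauss 1 s) \<longlonglongrightarrow> (LINT s|lborel. f x * gauss 1 s)"
  proof (rule integral_dominated_convergence[where w="\<lambda>s. B * gauss 1 s"])
    show "integrable lborel (\<lambda>s. B * gauss 1 s)" using fourier_std_gauss(1) by simp
    show "AE s in lborel. (\<lambda>n. f (x - ?\<epsilon> n * s) * gauss 1 s) \<longlonglongrightarrow> f x * gauss 1 s"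
    proof (rule AE_I2)
      fix s
      have "(\<lambda>n. x - ?\<epsilon> n * s) \<longlonglongrightarrow> x - 0 * s" by (intro tendsto_intros e0)
      then have "(\<lambda>n. f (x - ?\<epsilon> n * s)) \<longlonglongrightarrow> f x"
        using cf by (intro isCont_tendsto_compose[of x f]) (auto simp: continuous_on_eq_continuous_at)
      then show "(\<lambda>n. f (x - ?\<epsilon> n * s) * gauss 1 s) \<longlonglongrightarrow> f x * gauss 1 s" by (intro tendsto_intros)
    qed
    show "AE s in lborel. norm (f (x - ?\<epsilon> n * s) * complex_of_real (gauss 1 s)) \<le> B * gauss 1 s" for n
      using bf by (intro AE_I2) (simp add: norm_mult mult_right_mono)
  qed auto
  ultimately have "(LINT \<eta>|lborel. cis (2 * pi * \<eta> * x) * osc_int uminus f \<eta>) = (LINT s|lborel. f x * gauss 1 s)"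
    by (simp add: reg LIMSEQ_unique)
  also have "\<dots> = f x" by (simp add: integral_gauss_1)
  finally show ?thesis by (simp add: osc_int_def)
qed

section \<open>Schwartz functions\<close>

lemma iter_deriv_0 [simp]: "iter_deriv 0 f = f" and
  iter_deriv_Suc: "iter_deriv (Suc n) f = (\<lambda>t. vector_derivative (iter_deriv n f) (at t))"
  by (simp_all add: iter_deriv_def)

lemma smooth_real_has_derivative:
  "smooth_real f \<Longrightarrow> (iter_deriv n f has_vector_derivative iter_deriv (Suc n) f t) (at t)"
  by (simp add: smooth_real_def iter_deriv_Suc vector_derivative_works[symmetric])

lemma smooth_real_continuous: "smooth_real f \<Longrightarrow> continuous_on UNIV (iter_deriv n f)"
  by (simp add: smooth_real_def differentiable_imp_continuous_on differentiable_on_def differentiable_at_withinI)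

lemma schwartz_decay:
  assumes "f \<in> schwartz_space"
  obtains C where "C > 0" "\<And>t. norm (iter_deriv n f t) \<le> C * (1 / (1 + t\<^sup>2))"
proof -
  have "bounded (range (\<lambda>t. t ^ 0 *\<^sub>R iter_deriv n f t))" "bounded (range (\<lambda>t. t ^ 2 *\<^sub>R iter_deriv n f t))"
    using assms unfolding schwartz_space_def by blast+
  then obtain a b where a: "\<And>t. norm (iter_deriv n f t) \<le> a" and b: "\<And>t. norm (t ^ 2 *\<^sub>R iter_deriv n f t) \<le> b"
    by (auto simp: bounded_iff)
  have a0: "a \<ge> 0" "b \<ge> 0" using a[of 0] b[of 0] norm_ge_zero order_trans by blast+
  have "norm (iter_deriv n f t) \<le> (a + b + 1) * (1 / (1 + t\<^sup>2))" for t
  proof -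
    have "(1 + t\<^sup>2) * norm (iter_deriv n f t) \<le> a + b + 1" using a[of t] b[of t] by (simp add: distrib_right)
    then show ?thesis by (simp add: field_simps add_pos_nonneg)
  qed
  with a0 show ?thesis by (intro that[of "a + b + 1"]) auto
qed

text \<open>Gathers what the L^1 bound and Fourier inversion ask of f and its derivative. Apart from
  continuity, everything follows from the decay C/(1 + t^2).\<close>

lemma schwartz_facts:
  assumes "f \<in> schwartz_space"
  shows "continuous_on UNIV (iter_deriv n f)" "integrable lborel (iter_deriv n f)"
    "\<exists>B. \<forall>t. norm (iter_deriv n f t) \<le> B"
    "(iter_deriv n f \<longlongrightarrow> 0) at_top" "(iter_deriv n f \<longlongrightarrow> 0) at_bot"
    "\<exists>a\<ge>0. (\<integral>\<^sup>+t. ennreal ((norm (iter_deriv n f t))\<^sup>2) \<partial>lborel) \<le> ennreal a"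
proof -
  obtain C where C: "C > 0" "\<And>t. norm (iter_deriv n f t) \<le> C * (1 / (1 + t\<^sup>2))" using schwartz_decay[OF assms] by blast
  show c: "continuous_on UNIV (iter_deriv n f)" using assms by (intro smooth_real_continuous) (simp add: schwartz_space_def)
  then have [measurable]: "iter_deriv n f \<in> borel_measurable borel" by (rule borel_measurable_continuous_onI)
  have I: "integrable lborel (\<lambda>t. C * (1 / (1 + t\<^sup>2)))" by (intro integrable_mult_right integrable_inverse_1_plus_square_UNIV)
  show "integrable lborel (iter_deriv n f)"
    by (rule Bochner_Integration.integrable_bound[OF I]) (use C in \<open>auto simp: add_nonneg_nonneg\<close>)
  have B: "norm (iter_deriv n f t) \<le> C" for t
  proof -
    have "C * (1 / (1 + t\<^sup>2)) \<le> C * 1"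
      using C(1) by (intro mult_left_mono) (simp_all add: divide_le_eq add_pos_nonneg)
    then show ?thesis using C(2)[of t] by simp
  qed
  then show "\<exists>B. \<forall>t. norm (iter_deriv n f t) \<le> B" by blast
  have "((\<lambda>t::real. C * (1 / (1 + t\<^sup>2))) \<longlongrightarrow> 0) at_top" "((\<lambda>t::real. C * (1 / (1 + t\<^sup>2))) \<longlongrightarrow> 0) at_bot"
    by real_asymp+
  then show "(iter_deriv n f \<longlongrightarrow> 0) at_top" "(iter_deriv n f \<longlongrightarrow> 0) at_bot"
    using C(2) by (auto elim!: Lim_null_comparison[rotated] intro!: always_eventually)
  have "(\<integral>\<^sup>+t. ennreal ((norm (iter_deriv n f t))\<^sup>2) \<partial>lborel) \<le> (\<integral>\<^sup>+t. ennreal (C * (C * (1 / (1 + t\<^sup>2)))) \<partial>lborel)"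
    unfolding power2_eq_square[of "norm _"] using C(1)
    by (intro nn_integral_mono ennreal_leI mult_mono B C(2)) auto
  also have "\<dots> = ennreal (LINT t|lborel. C * (C * (1 / (1 + t\<^sup>2))))"
    using C(1) by (intro nn_integral_eq_integral integrable_mult_right I) auto
  finally show "\<exists>a\<ge>0. (\<integral>\<^sup>+t. ennreal ((norm (iter_deriv n f t))\<^sup>2) \<partial>lborel) \<le> ennreal a"
    using C(1) by (intro exI[of _ "LINT t|lborel. C * (C * (1 / (1 + t\<^sup>2)))"]) (auto intro!: integral_nonneg_AE)
qed

text \<open>The L^1 bound at scale R = 1; square integrability of f and of one derivative pays for
  integrability of the transform.\<close>

lemma schwartz_fourier_integrable:
  assumes "f \<in> schwartz_space"
  shows "integrable lborel (osc_int uminus f)"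
proof -
  note F0 = schwartz_facts[OF assms, of 0, unfolded iter_deriv_0] and F1 = schwartz_facts[OF assms, of "Suc 0"]
  have d: "(f has_vector_derivative iter_deriv (Suc 0) f t) (at t)" for t
    using smooth_real_has_derivative[of f 0 t] assms by (simp add: schwartz_space_def)
  obtain a b where "a \<ge> 0" "(\<integral>\<^sup>+t. ennreal ((norm (f t))\<^sup>2) \<partial>lborel) \<le> ennreal a"
    "b \<ge> 0" "(\<integral>\<^sup>+t. ennreal ((norm (iter_deriv (Suc 0) f t))\<^sup>2) \<partial>lborel) \<le> ennreal b"
    using F0(6) F1(6) by blast
  from fourier_L1_bound[OF d F1(1) F0(2) F1(2) F0(4,5) this(2,4,1,3) zero_less_one]
  have "(\<integral>\<^sup>+y. ennreal (norm (osc_int uminus f y)) \<partial>lborel) < \<infinity>"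
    unfolding infinity_ennreal_def by (rule order_le_less_trans[OF _ ennreal_less_top])
  then show ?thesis using F0(2) by (auto simp: integrable_iff_bounded)
qed

lemma schwartz_inversion:
  assumes "f \<in> schwartz_space"
  shows "osc_int (\<lambda>\<eta>. \<eta>) (osc_int uminus f) x = f x"
proof -
  obtain B where "\<And>t. norm (f t) \<le> B" using schwartz_facts(3)[OF assms, of 0] by auto
  then show ?thesis
    using schwartz_facts(1,2)[OF assms, of 0] schwartz_fourier_integrable[OF assms]
    by (intro fourier_inversion) auto
qed

section \<open>Interpolation\<close>

lemma nn_integral_powr_Ioo:
  assumes "a > -1" "c \<ge> 0"
  shows "(\<integral>\<^sup>+\<alpha>. ennreal (\<alpha> powr a) * indicator {0<..<c} \<alpha> \<partial>lborel) = ennreal (c powr (a + 1) / (a + 1))"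
proof -
  have "(\<integral>\<^sup>+\<alpha>. ennreal (\<alpha> powr a) * indicator {0..c} \<alpha> \<partial>lborel) = ennreal (c powr (a + 1) / (a + 1))"
    by (rule nn_integral_has_integral_lebesgue'[OF _ has_integral_powr_from_0[OF assms]]) simp
  moreover have "(\<integral>\<^sup>+\<alpha>. ennreal (\<alpha> powr a) * indicator {0<..<c} \<alpha> \<partial>lborel) = (\<integral>\<^sup>+\<alpha>. ennreal (\<alpha> powr a) * indicator {0..c} \<alpha> \<partial>lborel)"
  proof (rule nn_integral_cong_AE)
    show "AE \<alpha> in lborel. ennreal (\<alpha> powr a) * indicator {0<..<c} \<alpha> = ennreal (\<alpha> powr a) * indicator {0..c} \<alpha>"
      using AE_lborel_singleton[of c] by eventually_elim (auto split: split_indicator)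
  qed
  ultimately show ?thesis by simp
qed

text \<open>The part of Marcinkiewicz interpolation that no longer mentions the operator.
  \<open>weak\<close> is what Chebyshev gives at height \<alpha> once the part of f below \<alpha>/C
  has been absorbed by the sup bound; \<open>w\<close> is the density of the target measure.
  Integrating over \<alpha> and exchanging by Tonelli turns the truncated squares of f into p-th
  powers.\<close>

lemma Marcinkiewicz_level_sets:
  fixes w g :: "real \<Rightarrow> real" and f :: "real \<Rightarrow> complex"
  assumes [measurable]: "w \<in> borel_measurable borel" "g \<in> borel_measurable borel" "f \<in> borel_measurable borel"
    and nn: "\<And>x. w x \<ge> 0" "\<And>x. g x \<ge> 0" and C: "C > 0" and D: "D \<ge> 0" and p: "p > 2"
    and weak: "\<And>\<alpha>. \<alpha> > 0 \<Longrightarrow> (\<integral>\<^sup>+x. ennreal (w x) * indicator {x. \<alpha> < g x} x \<partial>lborel)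
      \<le> ennreal (D / \<alpha>\<^sup>2) * (\<integral>\<^sup>+t. ennreal ((norm (f t))\<^sup>2) * indicator {t. \<alpha> < C * norm (f t)} t \<partial>lborel)"
  shows "(\<integral>\<^sup>+x. ennreal (w x * g x powr p) \<partial>lborel)
    \<le> ennreal (D * p * C powr (p - 2) / (p - 2)) * (\<integral>\<^sup>+t. ennreal (norm (f t) powr p) \<partial>lborel)"
proof -
  \<comment> \<open>Layer cake: g^p is the integral of p \<alpha>^(p-1) over 0 < \<alpha> <
    g.\<close>
  have "(\<integral>\<^sup>+x. ennreal (w x * g x powr p) \<partial>lborel)
      = (\<integral>\<^sup>+x. \<integral>\<^sup>+\<alpha>. ennreal (p * \<alpha> powr (p - 1)) * indicator {0<..} \<alpha> * (ennreal (w x) * indicator {x. \<alpha> < g x} x) \<partial>lborel \<partial>lborel)"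
  proof (rule nn_integral_cong)
    fix x
    have "(\<integral>\<^sup>+\<alpha>. ennreal (p * \<alpha> powr (p - 1)) * indicator {0<..} \<alpha> * (ennreal (w x) * indicator {x. \<alpha> < g x} x) \<partial>lborel)
        = (\<integral>\<^sup>+\<alpha>. ennreal (p * w x) * (ennreal (\<alpha> powr (p - 1)) * indicator {0<..<g x} \<alpha>) \<partial>lborel)"
      using nn p by (intro nn_integral_cong) (auto simp: ennreal_mult[symmetric] mult_ac split: split_indicator)
    also have "\<dots> = ennreal (p * w x) * (\<integral>\<^sup>+\<alpha>. ennreal (\<alpha> powr (p - 1)) * indicator {0<..<g x} \<alpha> \<partial>lborel)"
      by (rule nn_integral_cmult) measurable
    also have "\<dots> = ennreal (p * w x) * ennreal (g x powr p / p)"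
      using nn_integral_powr_Ioo[of "p - 1" "g x"] nn p by simp
    also have "\<dots> = ennreal (w x * g x powr p)"
      using nn p by (simp add: ennreal_mult[symmetric])
    finally show "ennreal (w x * g x powr p) = (\<integral>\<^sup>+\<alpha>. ennreal (p * \<alpha> powr (p - 1)) * indicator {0<..} \<alpha> * (ennreal (w x) * indicator {x. \<alpha> < g x} x) \<partial>lborel)" by simp
  qed
  also have "\<dots> = (\<integral>\<^sup>+\<alpha>. \<integral>\<^sup>+x. ennreal (p * \<alpha> powr (p - 1)) * indicator {0<..} \<alpha> * (ennreal (w x) * indicator {x. \<alpha> < g x} x) \<partial>lborel \<partial>lborel)"
    by (rule lborel_pair.Fubini') measurable
  also have "\<dots> = (\<integral>\<^sup>+\<alpha>. ennreal (p * \<alpha> powr (p - 1)) * indicator {0<..} \<alpha> * (\<integral>\<^sup>+x. ennreal (w x) * indicator {x. \<alpha> < g x} x \<partial>lborel) \<partial>lborel)"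
    by (intro nn_integral_cong nn_integral_cmult) measurable
  also have "\<dots> \<le> (\<integral>\<^sup>+\<alpha>. ennreal (p * \<alpha> powr (p - 1)) * indicator {0<..} \<alpha> *
      (ennreal (D / \<alpha>\<^sup>2) * (\<integral>\<^sup>+t. ennreal ((norm (f t))\<^sup>2) * indicator {t. \<alpha> < C * norm (f t)} t \<partial>lborel)) \<partial>lborel)"
  proof (rule nn_integral_mono)
    fix \<alpha> :: real
    show "ennreal (p * \<alpha> powr (p - 1)) * indicator {0<..} \<alpha> * (\<integral>\<^sup>+x. ennreal (w x) * indicator {x. \<alpha> < g x} x \<partial>lborel)
      \<le> ennreal (p * \<alpha> powr (p - 1)) * indicator {0<..} \<alpha> *
      (ennreal (D / \<alpha>\<^sup>2) * (\<integral>\<^sup>+t. ennreal ((norm (f t))\<^sup>2) * indicator {t. \<alpha> < C * norm (f t)} t \<partial>lborel))"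
      using weak[of \<alpha>] by (cases "\<alpha> > 0") (auto intro!: mult_left_mono)
  qed
  also have "\<dots> = (\<integral>\<^sup>+\<alpha>. \<integral>\<^sup>+t. ennreal (p * \<alpha> powr (p - 1)) * indicator {0<..} \<alpha> * ennreal (D / \<alpha>\<^sup>2) *
      (ennreal ((norm (f t))\<^sup>2) * indicator {t. \<alpha> < C * norm (f t)} t) \<partial>lborel \<partial>lborel)"
    unfolding mult.assoc[symmetric, of _ "ennreal (D / _)"]
    by (intro nn_integral_cong nn_integral_cmult[symmetric]) measurable
  also have "\<dots> = (\<integral>\<^sup>+t. \<integral>\<^sup>+\<alpha>. ennreal (p * \<alpha> powr (p - 1)) * indicator {0<..} \<alpha> * ennreal (D / \<alpha>\<^sup>2) *
      (ennreal ((norm (f t))\<^sup>2) * indicator {t. \<alpha> < C * norm (f t)} t) \<partial>lborel \<partial>lborel)"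
    by (rule lborel_pair.Fubini'[symmetric]) measurable
  also have "\<dots> = (\<integral>\<^sup>+t. ennreal (D * p * C powr (p - 2) / (p - 2)) * ennreal (norm (f t) powr p) \<partial>lborel)"
  proof (rule nn_integral_cong)
    fix t
    let ?n = "norm (f t)"
    have "(\<integral>\<^sup>+\<alpha>. ennreal (p * \<alpha> powr (p - 1)) * indicator {0<..} \<alpha> * ennreal (D / \<alpha>\<^sup>2) *
      (ennreal (?n\<^sup>2) * indicator {t. \<alpha> < C * norm (f t)} t) \<partial>lborel)
      = (\<integral>\<^sup>+\<alpha>. ennreal (D * p * ?n\<^sup>2) * (ennreal (\<alpha> powr (p - 3)) * indicator {0<..<C * ?n} \<alpha>) \<partial>lborel)"
    proof (rule nn_integral_cong)
      fix \<alpha> :: real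
      have "\<alpha> powr (p - 1) / \<alpha>\<^sup>2 = \<alpha> powr (p - 3)" if "\<alpha> > 0"
        using that powr_diff[of \<alpha> "p - 1" 2] by (simp add: powr_numeral)
      then have "p * \<alpha> powr (p - 1) * (D / \<alpha>\<^sup>2) * ?n\<^sup>2 = D * p * ?n\<^sup>2 * \<alpha> powr (p - 3)" if "\<alpha> > 0"
        using that by (simp add: field_simps)
      then show "ennreal (p * \<alpha> powr (p - 1)) * indicator {0<..} \<alpha> * ennreal (D / \<alpha>\<^sup>2) *
        (ennreal (?n\<^sup>2) * indicator {t. \<alpha> < C * norm (f t)} t)
        = ennreal (D * p * ?n\<^sup>2) * (ennreal (\<alpha> powr (p - 3)) * indicator {0<..<C * ?n} \<alpha>)"
        using p D by (auto simp: ennreal_mult[symmetric] split: split_indicator)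
    qed
    \<comment> \<open>The exponent p - 3 exceeds -1 exactly because p > 2; this makes the integral
      over small levels converge.\<close>
    also have "\<dots> = ennreal (D * p * ?n\<^sup>2) * ennreal ((C * ?n) powr (p - 2) / (p - 2))"
      using nn_integral_powr_Ioo[of "p - 3" "C * ?n"] C p by (subst nn_integral_cmult) auto
    also have "\<dots> = ennreal (D * p * ?n\<^sup>2 * ((C * ?n) powr (p - 2) / (p - 2)))"
      using D p by (intro ennreal_mult[symmetric]) auto
    also have "D * p * ?n\<^sup>2 * ((C * ?n) powr (p - 2) / (p - 2)) = D * p * C powr (p - 2) / (p - 2) * ?n powr p"
    proof (cases "f t = 0")
      case False
      then have "?n\<^sup>2 * ?n powr (p - 2) = ?n powr p"
        using powr_add[of ?n 2 "p - 2"] by (simp add: powr_numeral)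
      then show ?thesis using C by (simp add: powr_mult field_simps)
    qed auto
    finally show "(\<integral>\<^sup>+\<alpha>. ennreal (p * \<alpha> powr (p - 1)) * indicator {0<..} \<alpha> * ennreal (D / \<alpha>\<^sup>2) *
      (ennreal (?n\<^sup>2) * indicator {t. \<alpha> < C * norm (f t)} t) \<partial>lborel)
      = ennreal (D * p * C powr (p - 2) / (p - 2)) * ennreal (?n powr p)"
      using D p by (simp add: ennreal_mult[symmetric])
  qed
  finally show ?thesis by (simp add: nn_integral_cmult)
qed

text \<open>The operator B of the overview. The two exponentials are subtracted under the integral
  so that the multiplier vanishes wherever \<open>\<phi>\<close> is the identity, and the expression
  makes sense even if the transform of f is not integrable.\<close>

definition phase_diff :: "(real \<Rightarrow> real) \<Rightarrow> (real \<Rightarrow> complex) \<Rightarrow> real \<Rightarrow> complex" where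
  "phase_diff \<phi> f x = (LINT \<eta>|lborel. (cis (2 * pi * \<phi> \<eta> * x) - cis (2 * pi * \<eta> * x)) * osc_int uminus f \<eta>)"

lemma japanese_bracket_ge_1: "japanese_bracket x \<ge> 1" and japanese_bracket_ge_abs: "\<bar>x\<bar> \<le> japanese_bracket x"
  by (auto simp: japanese_bracket_def intro!: real_le_rsqrt)

lemma japanese_bracket_pos [simp]: "japanese_bracket x > 0" "japanese_bracket x \<ge> 0"
  using japanese_bracket_ge_1[of x] by linarith+

lemma japanese_bracket_measurable [measurable]: "japanese_bracket \<in> borel_measurable borel"
  unfolding japanese_bracket_def by measurable

lemma deriv_eq_1_of_id_outside:
  fixes \<phi> \<phi>' :: "real \<Rightarrow> real"
  assumes d\<phi>: "\<And>\<eta>. (\<phi> has_real_derivative \<phi>' \<eta>) (at \<eta>)"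
    and id: "\<And>\<eta>. \<bar>\<eta>\<bar> \<ge> 1 \<Longrightarrow> \<phi> \<eta> = \<eta>" and \<eta>: "\<bar>\<eta>\<bar> > 1"
  shows "\<phi>' \<eta> = 1"
proof -
  have "open {\<eta>::real. \<bar>\<eta>\<bar> > 1}" by (intro open_Collect_less continuous_intros)
  then have "(\<phi> has_real_derivative 1) (at \<eta>)"
    using \<eta> id by (intro has_field_derivative_transform_within_open[OF DERIV_ident]) auto
  then show ?thesis using d\<phi> DERIV_unique by blast
qed

text \<open>As a function of \<eta> the difference is supported in [-1,1]; its squared L^2 norm is
  O(1) and that of its derivative is O(x^2). The L^1 bound at the scale R = <x> on which it varies
  therefore gives <x>^(1/2).\<close>

lemma cis_diff_kernel_L1:
  assumes d\<phi>: "\<And>\<eta>. (\<phi> has_real_derivative \<phi>' \<eta>) (at \<eta>)" and c\<phi>': "continuous_on UNIV \<phi>'"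
    and id: "\<And>\<eta>. \<bar>\<eta>\<bar> \<ge> 1 \<Longrightarrow> \<phi> \<eta> = \<eta>" and M: "\<And>\<eta>. \<bar>\<phi>' \<eta>\<bar> \<le> M"
  shows "integrable lborel (\<lambda>\<eta>. cis (2 * pi * \<phi> \<eta> * x) - cis (2 * pi * \<eta> * x))" (is "integrable _ ?h")
    and "(\<integral>\<^sup>+y. ennreal (norm (osc_int uminus (\<lambda>\<eta>. cis (2 * pi * \<phi> \<eta> * x) - cis (2 * pi * \<eta> * x)) y)) \<partial>lborel)
      \<le> ennreal ((6 + (M + 1)\<^sup>2) * sqrt (japanese_bracket x))"
proof -
  let ?h' = "\<lambda>\<eta>. \<i> * of_real (2 * pi * x) * (of_real (\<phi>' \<eta>) * cis (2 * pi * \<phi> \<eta> * x) - cis (2 * pi * \<eta> * x))"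
  have M0: "M \<ge> 0" using M[of 0] by linarith
  have c\<phi>: "continuous_on UNIV \<phi>" using d\<phi> by (intro continuous_at_imp_continuous_on) (auto intro: DERIV_isCont)
  have dh: "(?h has_vector_derivative ?h' \<eta>) (at \<eta>)" for \<eta>
  proof -
    have "((\<lambda>\<eta>. cis (2 * pi * \<phi> \<eta> * x)) has_vector_derivative \<i> * of_real (2 * pi * \<phi>' \<eta> * x) * cis (2 * pi * \<phi> \<eta> * x)) (at \<eta>)"
      by (rule has_vector_derivative_cis) (auto intro!: derivative_eq_intros d\<phi>)
    moreover have "((\<lambda>\<eta>. cis (2 * pi * \<eta> * x)) has_vector_derivative \<i> * of_real (2 * pi * x) * cis (2 * pi * \<eta> * x)) (at \<eta>)"
      by (rule has_vector_derivative_cis) (auto intro!: derivative_eq_intros)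
    ultimately show ?thesis
      by (rule has_vector_derivative_eq_rhs[OF has_vector_derivative_diff]) (simp add: algebra_simps)
  qed
  have ch: "continuous_on UNIV ?h" "continuous_on UNIV ?h'"
    by (intro continuous_intros c\<phi> c\<phi>')+
  note [measurable] = borel_measurable_continuous_onI[OF ch(1)]
  have h0: "?h \<eta> = 0" if "\<bar>\<eta>\<bar> \<ge> 1" for \<eta> using id[OF that] by simp
  have \<phi>'1: "\<phi>' \<eta> = 1" if "\<bar>\<eta>\<bar> > 1" for \<eta>
    by (rule deriv_eq_1_of_id_outside[OF d\<phi> _ that]) (rule id)
  have h'0: "?h' \<eta> = 0" if "\<bar>\<eta>\<bar> > 1" for \<eta> using id[of \<eta>] that \<phi>'1[OF that] by simp
  have hb: "norm (?h \<eta>) \<le> 2 * indicator {-1..1} \<eta>" for \<eta>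
  proof (cases "\<eta> \<in> {-1..1}")
    case True
    then show ?thesis using norm_triangle_ineq4[of "cis (2 * pi * \<phi> \<eta> * x)" "cis (2 * pi * \<eta> * x)"] by simp
  next
    case False
    then have "\<bar>\<eta>\<bar> \<ge> 1" by auto
    then show ?thesis using h0 by simp
  qed
  let ?m = "2 * pi * \<bar>x\<bar> * (M + 1)"
  have m0: "?m \<ge> 0" using M0 by simp
  have h'b: "norm (?h' \<eta>) \<le> ?m * indicator {-1..1} \<eta>" for \<eta>
  proof (cases "\<eta> \<in> {-1..1}")
    case True
    have "norm (of_real (\<phi>' \<eta>) * cis (2 * pi * \<phi> \<eta> * x) - cis (2 * pi * \<eta> * x)) \<le> \<bar>\<phi>' \<eta>\<bar> + 1"
      by (rule order_trans[OF norm_triangle_ineq4]) (simp add: norm_mult)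
    also have "\<dots> \<le> M + 1" using M by simp
    finally show ?thesis using True by (simp add: norm_mult abs_mult mult_left_mono)
  next
    case False
    then have "\<bar>\<eta>\<bar> > 1" by auto
    from h'0[OF this] show ?thesis using False by (simp only: norm_zero indicator_simps) simp
  qed
  have I: "integrable lborel (\<lambda>\<eta>. c * indicator {-1..1::real} \<eta>)" for c :: real
    by (intro integrable_mult_right integrable_real_indicator) (simp_all add: emeasure_lborel_Icc_eq)
  show hi: "integrable lborel ?h"
    by (rule Bochner_Integration.integrable_bound[OF I[of 2]]) (use hb in auto)
  have h'i: "integrable lborel ?h'"
  proof (rule Bochner_Integration.integrable_bound[OF I[of ?m]])
    show "?h' \<in> borel_measurable lborel" using borel_measurable_continuous_onI[OF ch(2)] by (simp only: measurable_lborel1 measurable_lborel2)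
    show "AE \<eta> in lborel. norm (?h' \<eta>) \<le> norm (?m * indicator {-1..1} \<eta>)"
      by (intro AE_I2 order_trans[OF h'b]) simp
  qed
  have lim: "(?h \<longlongrightarrow> 0) at_top" "(?h \<longlongrightarrow> 0) at_bot"
    by (rule tendsto_eventually, rule eventually_mono[OF eventually_ge_at_top[of 1]], rule h0, simp)
       (rule tendsto_eventually, rule eventually_mono[OF eventually_le_at_bot[of "-1"]], rule h0, simp)
  have sq: "(\<integral>\<^sup>+\<eta>. ennreal ((norm (k \<eta>))\<^sup>2) \<partial>lborel) \<le> ennreal (2 * c\<^sup>2)"
    if "\<And>\<eta>. norm (k \<eta>) \<le> c * indicator {-1..1} \<eta>" for c and k :: "real \<Rightarrow> complex"
  proof -
    have "(norm (k \<eta>))\<^sup>2 \<le> c\<^sup>2 * indicator {-1..1} \<eta>" for \<eta>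
      using power_mono[OF that[of \<eta>] norm_ge_zero, of 2] by (auto split: split_indicator_asm)
    then have "(\<integral>\<^sup>+\<eta>. ennreal ((norm (k \<eta>))\<^sup>2) \<partial>lborel) \<le> (\<integral>\<^sup>+\<eta>. ennreal (c\<^sup>2) * indicator {-1..1::real} \<eta> \<partial>lborel)"
      by (intro nn_integral_mono) (simp add: ennreal_leI ennreal_mult[symmetric] flip: ennreal_indicator)
    also have "\<dots> = ennreal (2 * c\<^sup>2)"
      by (simp add: nn_integral_cmult_indicator ennreal_mult[symmetric] mult.commute flip: ennreal_numeral)
    finally show ?thesis .
  qed
  define R where "R = japanese_bracket x"
  have R: "R > 0" "R \<ge> 1" "x\<^sup>2 \<le> R\<^sup>2"
    using japanese_bracket_ge_1[of x] by (auto simp: R_def) (simp add: japanese_bracket_def)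
  have "(\<integral>\<^sup>+y. ennreal (norm (osc_int uminus ?h y)) \<partial>lborel)
      \<le> ennreal (sqrt R / 2 * (2 * 2\<^sup>2 + (2 * ?m\<^sup>2) / (4 * pi\<^sup>2 * R\<^sup>2) + pi))"
    by (rule fourier_L1_bound[OF dh ch(2) hi h'i lim sq[OF hb] sq[OF h'b]]) (use R in auto)
  also have "\<dots> \<le> ennreal ((6 + (M + 1)\<^sup>2) * sqrt R)"
  proof (rule ennreal_leI)
    have "(2 * ?m\<^sup>2) / (4 * pi\<^sup>2 * R\<^sup>2) = 2 * (M + 1)\<^sup>2 * (x\<^sup>2 / R\<^sup>2)"
      by (simp add: power_mult_distrib)
    also have "\<dots> \<le> 2 * (M + 1)\<^sup>2 * 1" using R by (intro mult_left_mono) auto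
    finally have "2 * 2\<^sup>2 + (2 * ?m\<^sup>2) / (4 * pi\<^sup>2 * R\<^sup>2) + pi \<le> 8 + 2 * (M + 1)\<^sup>2 + 4" using pi_less_4 by simp
    \<comment> \<open>Half of 8 + 2 (M+1)^2 + 4 is the stated constant. The 8 comes from a function
      bounded by 2 on an interval of length 2, the 4 from pi < 4.\<close>
    from mult_left_mono[OF this, of "sqrt R / 2"]
    show "sqrt R / 2 * (2 * 2\<^sup>2 + (2 * ?m\<^sup>2) / (4 * pi\<^sup>2 * R\<^sup>2) + pi) \<le> (6 + (M + 1)\<^sup>2) * sqrt R"
      using R by (simp add: algebra_simps)
  qed
  finally show "(\<integral>\<^sup>+y. ennreal (norm (osc_int uminus ?h y)) \<partial>lborel) \<le> ennreal ((6 + (M + 1)\<^sup>2) * sqrt (japanese_bracket x))"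
    by (simp add: R_def)
qed

section \<open>Sufficiency\<close>

text \<open>Pointwise, |f|^p = |f|^(p-2) |f|^2. Serves twice: for finiteness of the L^p norm of a
  Schwartz function, and for the quantitative bound on the wave packets.\<close>

lemma nn_integral_powr_le_sup_L2:
  fixes f :: "real \<Rightarrow> complex"
  assumes [measurable]: "f \<in> borel_measurable borel" and S: "\<And>t. norm (f t) \<le> S" and p: "p > 2"
  shows "(\<integral>\<^sup>+t. ennreal (norm (f t) powr p) \<partial>lborel) \<le> ennreal (S powr (p - 2)) * (\<integral>\<^sup>+t. ennreal ((norm (f t))\<^sup>2) \<partial>lborel)"
proof -
  have "norm (f t) powr p \<le> S powr (p - 2) * (norm (f t))\<^sup>2" for t
  proof (cases "f t = 0")
    case False
    then have "norm (f t) powr p = norm (f t) powr (p - 2) * (norm (f t))\<^sup>2"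
      using powr_add[of "norm (f t)" "p - 2" 2] by (simp add: powr_numeral)
    also have "\<dots> \<le> S powr (p - 2) * (norm (f t))\<^sup>2"
      using S p by (intro mult_right_mono powr_mono2) auto
    finally show ?thesis .
  qed auto
  then have "(\<integral>\<^sup>+t. ennreal (norm (f t) powr p) \<partial>lborel) \<le> (\<integral>\<^sup>+t. ennreal (S powr (p - 2)) * ennreal ((norm (f t))\<^sup>2) \<partial>lborel)"
    by (intro nn_integral_mono) (simp add: ennreal_mult[symmetric] ennreal_leI)
  then show ?thesis by (simp add: nn_integral_cmult)
qed

text \<open>The transform of an integrable function is bounded, hence integrable after the cutoff.
  This keeps the operator usable for the non-smooth truncations of f that arise in the
  interpolation.\<close>

lemma osc_int_integrable_cutoff:
  assumes "integrable lborel f"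
  shows "integrable lborel (\<lambda>\<eta>. indicator {-1..1} \<eta> * osc_int uminus f \<eta>)"
proof (rule Bochner_Integration.integrable_bound)
  show "integrable lborel (\<lambda>\<eta>. (LINT t|lborel. norm (f t)) * indicator {-1..1::real} \<eta>)"
    by (intro integrable_mult_right integrable_real_indicator) (simp_all add: emeasure_lborel_Icc_eq)
  show "(\<lambda>\<eta>. indicator {-1..1} \<eta> * osc_int uminus f \<eta>) \<in> borel_measurable lborel"
    using assms by measurable
qed (use norm_osc_int_le[OF assms, of uminus] in \<open>auto intro!: AE_I2 split: split_indicator\<close>)

text \<open>First-order data only: \<open>M\<close> will come from compactness, and \<open>L\<close>
  is a Lipschitz constant of the inverse of \<open>\<phi>\<close>. The second derivative enters the
  necessity lemmas as an explicit hypothesis.\<close>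

locale phase =
  fixes \<phi> \<phi>' :: "real \<Rightarrow> real" and M L :: real
  assumes deriv: "\<And>\<eta>. (\<phi> has_real_derivative \<phi>' \<eta>) (at \<eta>)"
    and cont_deriv: "continuous_on UNIV \<phi>'"
    and id_outside: "\<And>\<eta>. \<bar>\<eta>\<bar> \<ge> 1 \<Longrightarrow> \<phi> \<eta> = \<eta>"
    and deriv_bound: "\<And>\<eta>. \<bar>\<phi>' \<eta>\<bar> \<le> M"
    and L_pos: "L > 0"
    and expansive: "\<And>\<eta> \<xi>. \<bar>\<eta> - \<xi>\<bar> \<le> L * \<bar>\<phi> \<eta> - \<phi> \<xi>\<bar>"
begin

lemma continuous: "continuous_on UNIV \<phi>"
  using deriv by (intro continuous_at_imp_continuous_on) (auto intro: DERIV_isCont)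

lemma measurable_phase [measurable]: "\<phi> \<in> borel_measurable borel"
  by (intro borel_measurable_continuous_onI continuous)

lemma phase_diff_measurable [measurable]: "f \<in> borel_measurable borel \<Longrightarrow> phase_diff \<phi> f \<in> borel_measurable borel"
proof -
  assume [measurable]: "f \<in> borel_measurable borel"
  have [measurable]: "snd \<in> borel_measurable (borel \<Otimes>\<^sub>M lborel)"
    using measurable_snd[of borel lborel] by (simp only: measurable_lborel1)
  show ?thesis unfolding phase_diff_def by measurable
qed

text \<open>The multiplier vanishes for |\<eta>| \<ge> 1, so the indicator can be inserted freely;
  afterwards the two exponentials are integrable separately.\<close>

lemma phase_diff_eq:
  assumes "integrable lborel f"
  shows "phase_diff \<phi> f x = osc_int \<phi> (\<lambda>\<eta>. indicator {-1..1} \<eta> * osc_int uminus f \<eta>) x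
    - osc_int (\<lambda>\<eta>. \<eta>) (\<lambda>\<eta>. indicator {-1..1} \<eta> * osc_int uminus f \<eta>) x"
proof -
  note I = osc_int_integrable_cutoff[OF assms]
  show ?thesis
    unfolding phase_diff_def osc_int_def[of \<phi>] osc_int_def[of "\<lambda>\<eta>. \<eta>"]
  proof (subst Bochner_Integration.integral_diff[symmetric])
    show "integrable lborel (\<lambda>\<eta>. cis (2 * pi * \<phi> \<eta> * x) * (indicator {-1..1} \<eta> * osc_int uminus f \<eta>))"
      "integrable lborel (\<lambda>\<eta>. cis (2 * pi * \<eta> * x) * (indicator {-1..1} \<eta> * osc_int uminus f \<eta>))"
      using I by (auto intro!: integrable_cis_mult)
    have "(cis (2 * pi * \<phi> \<eta> * x) - cis (2 * pi * \<eta> * x)) * osc_int uminus f \<eta>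
      = cis (2 * pi * \<phi> \<eta> * x) * (indicator {-1..1} \<eta> * osc_int uminus f \<eta>)
        - cis (2 * pi * \<eta> * x) * (indicator {-1..1} \<eta> * osc_int uminus f \<eta>)" for \<eta>
    proof (cases "\<bar>\<eta>\<bar> \<ge> 1")
      case True
      then show ?thesis using id_outside by simp
    next
      case False
      then have "indicator {-1..1} \<eta> = (1::complex)" by (auto simp: indicator_def)
      then show ?thesis by (simp only: left_diff_distrib mult_1)
    qed
    then show "(LINT \<eta>|lborel. (cis (2 * pi * \<phi> \<eta> * x) - cis (2 * pi * \<eta> * x)) * osc_int uminus f \<eta>) =
      (LINT \<eta>|lborel. cis (2 * pi * \<phi> \<eta> * x) * (indicator {-1..1} \<eta> * osc_int uminus f \<eta>)
        - cis (2 * pi * \<eta> * x) * (indicator {-1..1} \<eta> * osc_int uminus f \<eta>))" by simp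
  qed
qed

lemma phase_diff_add:
  assumes f: "integrable lborel f" and g: "integrable lborel g"
  shows "phase_diff \<phi> (\<lambda>t. f t + g t) x = phase_diff \<phi> f x + phase_diff \<phi> g x"
proof -
  have eq: "osc_int uminus (\<lambda>t. f t + g t) \<eta> = osc_int uminus f \<eta> + osc_int uminus g \<eta>" for \<eta>
    using f g by (intro osc_int_add) auto
  show ?thesis
    using f g by (simp add: phase_diff_eq eq distrib_left osc_int_add osc_int_integrable_cutoff)
qed

text \<open>Both exponentials fall under the same L^2 estimate, with constant \<open>L\<close> for
  \<open>\<phi>\<close> and 1 for the identity; (a+b)^2 \<le> 2a^2 + 2b^2 supplies the factor
  2.\<close>

lemma phase_diff_L2:
  assumes f: "integrable lborel f"
  shows "(\<integral>\<^sup>+x. ennreal ((norm (phase_diff \<phi> f x))\<^sup>2) \<partial>lborel)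
    \<le> ennreal (2 * (L + 1)) * (\<integral>\<^sup>+t. ennreal ((norm (f t))\<^sup>2) \<partial>lborel)"
proof -
  have [measurable]: "f \<in> borel_measurable borel" using f by auto
  define F where "F = (\<lambda>\<eta>. indicator {-1..1} \<eta> * osc_int uminus f \<eta>)"
  let ?N = "\<integral>\<^sup>+t. ennreal ((norm (f t))\<^sup>2) \<partial>lborel"
  have F: "integrable lborel F" unfolding F_def by (rule osc_int_integrable_cutoff[OF f])
  have [measurable]: "F \<in> borel_measurable borel" using F by auto
  have "(\<integral>\<^sup>+\<eta>. ennreal ((norm (F \<eta>))\<^sup>2) \<partial>lborel) \<le> (\<integral>\<^sup>+\<eta>. ennreal ((norm (osc_int uminus f \<eta>))\<^sup>2) \<partial>lborel)"
    unfolding F_def by (intro nn_integral_mono ennreal_leI) (auto split: split_indicator)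
  also have "\<dots> \<le> ?N" using osc_int_L2_bound[OF _ f, of uminus 1] by simp
  finally have FN: "(\<integral>\<^sup>+\<eta>. ennreal ((norm (F \<eta>))\<^sup>2) \<partial>lborel) \<le> ?N" .
  have "(norm (phase_diff \<phi> f x))\<^sup>2 \<le> 2 * (norm (osc_int \<phi> F x))\<^sup>2 + 2 * (norm (osc_int (\<lambda>\<eta>. \<eta>) F x))\<^sup>2" for x
  proof -
    let ?a = "norm (osc_int \<phi> F x)" and ?b = "norm (osc_int (\<lambda>\<eta>. \<eta>) F x)"
    have "(norm (phase_diff \<phi> f x))\<^sup>2 \<le> (?a + ?b)\<^sup>2"
      unfolding phase_diff_eq[OF f] F_def[symmetric] by (intro power_mono norm_triangle_ineq4) auto
    also have "\<dots> \<le> 2 * ?a\<^sup>2 + 2 * ?b\<^sup>2"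
      using sum_squares_bound[of ?a ?b] by (simp add: power2_sum)
    finally show ?thesis .
  qed
  then have "(\<integral>\<^sup>+x. ennreal ((norm (phase_diff \<phi> f x))\<^sup>2) \<partial>lborel)
      \<le> (\<integral>\<^sup>+x. 2 * ennreal ((norm (osc_int \<phi> F x))\<^sup>2) + 2 * ennreal ((norm (osc_int (\<lambda>\<eta>. \<eta>) F x))\<^sup>2) \<partial>lborel)"
    by (intro nn_integral_mono) (simp add: ennreal_leI ennreal_mult[symmetric] flip: ennreal_plus ennreal_numeral)
  also have "\<dots> = 2 * (\<integral>\<^sup>+x. ennreal ((norm (osc_int \<phi> F x))\<^sup>2) \<partial>lborel) + 2 * (\<integral>\<^sup>+x. ennreal ((norm (osc_int (\<lambda>\<eta>. \<eta>) F x))\<^sup>2) \<partial>lborel)"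
    by (simp add: nn_integral_add nn_integral_cmult)
  also have "\<dots> \<le> 2 * (ennreal L * ?N) + 2 * (ennreal 1 * ?N)"
    by (intro add_mono mult_left_mono order_trans[OF osc_int_L2_bound[OF _ F L_pos expansive] mult_left_mono[OF FN]]
        order_trans[OF osc_int_L2_bound[OF _ F zero_less_one] mult_left_mono[OF FN]]) auto
  also have "\<dots> = ennreal (2 * (L + 1)) * ?N"
    using L_pos by (simp add: ennreal_mult distrib_left distrib_right mult.assoc)
  finally show ?thesis .
qed

text \<open>Fubini moves the Fourier transform from f onto the difference of exponentials, whose
  transform has L^1 norm O(<x>^(1/2)). Integrability of f is qualitative: the bound depends on f
  only through \<tau>.\<close>

lemma phase_diff_sup:
  assumes f: "integrable lborel f" and \<tau>: "\<And>t. norm (f t) \<le> \<tau>"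
  shows "norm (phase_diff \<phi> f x) \<le> \<tau> * (6 + (M + 1)\<^sup>2) * sqrt (japanese_bracket x)"
proof -
  let ?h = "\<lambda>\<eta>. cis (2 * pi * \<phi> \<eta> * x) - cis (2 * pi * \<eta> * x)"
  note K = cis_diff_kernel_L1[OF deriv cont_deriv id_outside deriv_bound, of x]
  have [measurable]: "f \<in> borel_measurable borel" using f by auto
  have \<tau>0: "\<tau> \<ge> 0" using \<tau>[of 0] norm_ge_zero order_trans by blast
  have "phase_diff \<phi> f x = (LINT t|lborel. f t * (LINT \<eta>|lborel. cis (2 * pi * - t * \<eta>) * ?h \<eta>))"
    unfolding phase_diff_def osc_int_def by (rule Fubini_bounded_kernel[where B=1]) (use K(1) f in auto)
  also have "\<dots> = (LINT t|lborel. f t * osc_int uminus ?h t)"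
    by (simp add: osc_int_def mult.commute mult.left_commute)
  finally have "ennreal (norm (phase_diff \<phi> f x)) \<le> (\<integral>\<^sup>+t. ennreal (norm (f t * osc_int uminus ?h t)) \<partial>lborel)"
    using norm_integral_le_nn_integral[of lborel "\<lambda>t. f t * osc_int uminus ?h t"] by simp
  also have "\<dots> \<le> (\<integral>\<^sup>+t. ennreal \<tau> * ennreal (norm (osc_int uminus ?h t)) \<partial>lborel)"
    using \<tau> \<tau>0 by (intro nn_integral_mono) (simp add: norm_mult ennreal_mult[symmetric] ennreal_leI mult_right_mono)
  also have "\<dots> = ennreal \<tau> * (\<integral>\<^sup>+t. ennreal (norm (osc_int uminus ?h t)) \<partial>lborel)"
    by (intro nn_integral_cmult) measurable
  also have "\<dots> \<le> ennreal \<tau> * ennreal ((6 + (M + 1)\<^sup>2) * sqrt (japanese_bracket x))"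
    by (intro mult_left_mono K(2)) auto
  also have "\<dots> = ennreal (\<tau> * (6 + (M + 1)\<^sup>2) * sqrt (japanese_bracket x))"
    using \<tau>0 by (simp add: ennreal_mult[symmetric] mult.assoc add_nonneg_nonneg)
  finally show ?thesis
    by (rule ennreal_le_iff[THEN iffD1, rotated]) (use \<tau>0 in \<open>simp add: add_nonneg_nonneg\<close>)
qed

lemma phase_diff_weighted_Lp:
  assumes p: "p > 2"
  obtains K where "K \<ge> 0"
    "\<And>f. integrable lborel f \<Longrightarrow>
      (\<integral>\<^sup>+x. ennreal (japanese_bracket x powr (1 - p / 2) * norm (phase_diff \<phi> f x) powr p) \<partial>lborel)
        \<le> ennreal K * (\<integral>\<^sup>+t. ennreal (norm (f t) powr p) \<partial>lborel)"
proof -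
  define C where "C = 6 + (M + 1)\<^sup>2"
  have C: "C > 0" by (simp add: C_def add_pos_nonneg)
  \<comment> \<open>8 (L + 1) is the L^2 constant 2 (L + 1) times the factor 4 lost in applying
    Chebyshev at height \<alpha>/2.\<close>
  let ?D = "8 * (L + 1)"
  let ?K = "?D * p * (2 * C) powr (p - 2) / (p - 2)"
  have K: "?K \<ge> 0" using L_pos p by simp
  have "(\<integral>\<^sup>+x. ennreal (japanese_bracket x powr (1 - p / 2) * norm (phase_diff \<phi> f x) powr p) \<partial>lborel)
        \<le> ennreal ?K * (\<integral>\<^sup>+t. ennreal (norm (f t) powr p) \<partial>lborel)" if f: "integrable lborel f" for f
  proof -
    have [measurable]: "f \<in> borel_measurable borel" using f by auto
    define g where "g = (\<lambda>x. norm (phase_diff \<phi> f x) / sqrt (japanese_bracket x))"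
    have [measurable]: "g \<in> borel_measurable borel" unfolding g_def by measurable
    have weak: "(\<integral>\<^sup>+x. ennreal (japanese_bracket x) * indicator {x. \<alpha> < g x} x \<partial>lborel)
      \<le> ennreal (?D / \<alpha>\<^sup>2) * (\<integral>\<^sup>+t. ennreal ((norm (f t))\<^sup>2) * indicator {t. \<alpha> < 2 * C * norm (f t)} t \<partial>lborel)"
      if \<alpha>: "\<alpha> > 0" for \<alpha>
    proof -
      \<comment> \<open>on the complement of \<open>S\<close> the sup bound contributes at most \<open>\<alpha> / 2\<close> to \<open>g\<close>\<close>
      define S where "S = {t. \<alpha> < 2 * C * norm (f t)}"
      have [measurable]: "S \<in> sets borel" unfolding S_def by measurable
      define f1 where "f1 = (\<lambda>t. indicator S t * f t)"
      define f2 where "f2 = (\<lambda>t. indicator (- S) t * f t)"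
      have f12: "integrable lborel f1" "integrable lborel f2"
        unfolding f1_def f2_def by (auto intro!: Bochner_Integration.integrable_bound[OF f] split: split_indicator)
      have [measurable]: "f1 \<in> borel_measurable borel" using f12 by auto
      have split: "f = (\<lambda>t. f1 t + f2 t)" by (auto simp: f1_def f2_def split: split_indicator)
      have "norm (f2 t) \<le> \<alpha> / (2 * C)" for t
        using C \<alpha> by (auto simp: f2_def S_def field_simps split: split_indicator)
      from phase_diff_sup[OF f12(2) this]
      have f2b: "norm (phase_diff \<phi> f2 x) \<le> \<alpha> / 2 * sqrt (japanese_bracket x)" for x
        using C by (simp add: C_def[symmetric])
      \<comment> \<open>Chebyshev in pointwise form: \<open>\<alpha> < g x\<close> forces the
        contribution of \<open>f1\<close> to be at least \<alpha>/2 times <x>^(1/2), and squaring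
        produces the density <x>.\<close>
      have pt: "japanese_bracket x \<le> 4 / \<alpha>\<^sup>2 * (norm (phase_diff \<phi> f1 x))\<^sup>2" if "\<alpha> < g x" for x
      proof -
        have "\<alpha> * sqrt (japanese_bracket x) < norm (phase_diff \<phi> f x)"
          using that by (simp add: g_def field_simps)
        also have "\<dots> \<le> norm (phase_diff \<phi> f1 x) + norm (phase_diff \<phi> f2 x)"
          using phase_diff_add[OF f12] split norm_triangle_ineq by metis
        finally have "\<alpha> / 2 * sqrt (japanese_bracket x) \<le> norm (phase_diff \<phi> f1 x)"
          using f2b[of x] by simp
        from power_mono[OF this, of 2] have "\<alpha>\<^sup>2 / 4 * japanese_bracket x \<le> (norm (phase_diff \<phi> f1 x))\<^sup>2"
          using \<alpha> by (simp add: power_mult_distrib power_divide)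
        then show ?thesis using \<alpha> by (simp add: field_simps)
      qed
      have "(\<integral>\<^sup>+x. ennreal (japanese_bracket x) * indicator {x. \<alpha> < g x} x \<partial>lborel)
          \<le> (\<integral>\<^sup>+x. ennreal (4 / \<alpha>\<^sup>2) * ennreal ((norm (phase_diff \<phi> f1 x))\<^sup>2) \<partial>lborel)"
        using pt by (intro nn_integral_mono) (auto simp: ennreal_mult[symmetric] split: split_indicator intro!: ennreal_leI)
      also have "\<dots> = ennreal (4 / \<alpha>\<^sup>2) * (\<integral>\<^sup>+x. ennreal ((norm (phase_diff \<phi> f1 x))\<^sup>2) \<partial>lborel)"
        by (intro nn_integral_cmult) measurable
      also have "\<dots> \<le> ennreal (4 / \<alpha>\<^sup>2) * (ennreal (2 * (L + 1)) * (\<integral>\<^sup>+t. ennreal ((norm (f1 t))\<^sup>2) \<partial>lborel))"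
        by (intro mult_left_mono phase_diff_L2 f12) auto
      also have "\<dots> = ennreal (?D / \<alpha>\<^sup>2) * (\<integral>\<^sup>+t. ennreal ((norm (f1 t))\<^sup>2) \<partial>lborel)"
      proof -
        have "ennreal (4 / \<alpha>\<^sup>2) * ennreal (2 * (L + 1)) = ennreal (?D / \<alpha>\<^sup>2)"
          using L_pos by (subst ennreal_mult[symmetric]) auto
        then show ?thesis by (simp only: mult.assoc[symmetric])
      qed
      also have "(\<integral>\<^sup>+t. ennreal ((norm (f1 t))\<^sup>2) \<partial>lborel) = (\<integral>\<^sup>+t. ennreal ((norm (f t))\<^sup>2) * indicator S t \<partial>lborel)"
        by (intro nn_integral_cong) (auto simp: f1_def split: split_indicator)
      finally show ?thesis unfolding S_def .
    qed
    have "(\<integral>\<^sup>+x. ennreal (japanese_bracket x * g x powr p) \<partial>lborel) \<le> ennreal ?K * (\<integral>\<^sup>+t. ennreal (norm (f t) powr p) \<partial>lborel)"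
      by (rule Marcinkiewicz_level_sets[OF _ _ _ _ _ _ _ p weak]) (use C L_pos in \<open>auto simp: g_def\<close>)
    also have "(\<lambda>x. japanese_bracket x * g x powr p) = (\<lambda>x. japanese_bracket x powr (1 - p / 2) * norm (phase_diff \<phi> f x) powr p)"
    proof
      fix x
      let ?j = "japanese_bracket x"
      \<comment> \<open>The endpoint weight arises here: the density <x> times <x>^(-p/2) from the
        division in \<open>g\<close>.\<close>
      have "?j powr (1 - p / 2) = ?j / (sqrt ?j powr p)"
        by (simp add: powr_diff powr_half_sqrt[symmetric] powr_powr)
      then show "?j * g x powr p = ?j powr (1 - p / 2) * norm (phase_diff \<phi> f x) powr p"
        by (simp add: g_def powr_divide)
    qed
    finally show ?thesis .
  qed
  with K show ?thesis by (rule that)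
qed

lemma bounded_on_Lp_bracket_powr:
  assumes p: "p > 2" and m: "m \<le> - (1 / 2 - 1 / p)"
  shows "bounded_on_Lp p (fourier_integral_operator \<phi> (\<lambda>x \<eta>. complex_of_real (japanese_bracket x powr m)))"
proof -
  obtain K where K: "K \<ge> 0" "\<And>f. integrable lborel f \<Longrightarrow>
      (\<integral>\<^sup>+x. ennreal (japanese_bracket x powr (1 - p / 2) * norm (phase_diff \<phi> f x) powr p) \<partial>lborel)
        \<le> ennreal K * (\<integral>\<^sup>+t. ennreal (norm (f t) powr p) \<partial>lborel)"
    using phase_diff_weighted_Lp[OF p] by blast
  define E where "E = 2 powr p * (1 + K)"
  have E0: "E \<ge> 0" using K by (simp add: E_def)
  \<comment> \<open>The second inequality is the hypothesis multiplied by p and controls the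
    \<open>phase_diff\<close> term; the first makes the weight at most 1, which is enough for the
    term f.\<close>
  have m0: "m \<le> 0" "m * p \<le> 1 - p / 2"
  proof -
    have "1 / p \<le> 1 / 2" using p by simp
    then show "m \<le> 0" using m by simp
    have "m * p \<le> - (1 / 2 - 1 / p) * p" using m p by (intro mult_right_mono) auto
    also have "\<dots> = 1 - p / 2" using p by (simp add: field_simps)
    finally show "m * p \<le> 1 - p / 2" .
  qed
  have "in_Lp p (fourier_integral_operator \<phi> (\<lambda>x \<eta>. complex_of_real (japanese_bracket x powr m)) f) \<and>
    Lp_norm p (fourier_integral_operator \<phi> (\<lambda>x \<eta>. complex_of_real (japanese_bracket x powr m)) f) \<le> E powr (1 / p) * Lp_norm p f"
    if fS: "f \<in> schwartz_space" for f
  proof -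
    define A where "A = fourier_integral_operator \<phi> (\<lambda>x \<eta>. complex_of_real (japanese_bracket x powr m)) f"
    note F = schwartz_facts[OF fS, of 0, unfolded iter_deriv_0]
    have [measurable]: "f \<in> borel_measurable borel" using F(2) by auto
    note fh = schwartz_fourier_integrable[OF fS]
    obtain B where B: "\<And>t. norm (f t) \<le> B" using F(3) by blast
    obtain a where a: "a \<ge> 0" "(\<integral>\<^sup>+t. ennreal ((norm (f t))\<^sup>2) \<partial>lborel) \<le> ennreal a" using F(6) by blast
    have "(\<integral>\<^sup>+t. ennreal (norm (f t) powr p) \<partial>lborel) \<le> ennreal (B powr (p - 2)) * (\<integral>\<^sup>+t. ennreal ((norm (f t))\<^sup>2) \<partial>lborel)"
      by (rule nn_integral_powr_le_sup_L2[OF _ B p]) measurable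
    also have "\<dots> \<le> ennreal (B powr (p - 2)) * ennreal a"
      by (intro mult_left_mono a) simp
    also have "\<dots> < \<infinity>" by (simp add: ennreal_mult_less_top)
    \<comment> \<open>Finiteness has to be known before \<open>Lp_norm\<close> is meaningful: the
      Bochner integral defining the norm of f would otherwise be 0 by default.\<close>
    finally have fp: "integrable lborel (\<lambda>t. norm (f t) powr p)"
      by (simp add: integrable_iff_bounded)
    have nf: "(\<integral>\<^sup>+t. ennreal (norm (f t) powr p) \<partial>lborel) = ennreal (LINT t|lborel. norm (f t) powr p)"
      by (rule nn_integral_eq_integral[OF fp]) simp
    have A_eq: "A x = of_real (japanese_bracket x powr m) * (f x + phase_diff \<phi> f x)" for x
    proof -
      have "phase_diff \<phi> f x = (LINT \<eta>|lborel. cis (2 * pi * \<phi> \<eta> * x) * osc_int uminus f \<eta> - cis (2 * pi * \<eta> * x) * osc_int uminus f \<eta>)"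
        unfolding phase_diff_def by (simp add: left_diff_distrib)
      also have "\<dots> = osc_int \<phi> (osc_int uminus f) x - osc_int (\<lambda>\<eta>. \<eta>) (osc_int uminus f) x"
        unfolding osc_int_def[of \<phi>] osc_int_def[of "\<lambda>\<eta>. \<eta>"]
        by (rule Bochner_Integration.integral_diff) (auto intro!: integrable_cis_mult fh)
      finally show ?thesis
        unfolding A_def fourier_integral_operator_eq schwartz_inversion[OF fS] by simp
    qed
    have [measurable]: "A \<in> borel_measurable borel" unfolding A_eq[abs_def] by measurable
    have pt: "norm (A x) powr p \<le> 2 powr p * (norm (f x) powr p + japanese_bracket x powr (1 - p / 2) * norm (phase_diff \<phi> f x) powr p)" for x
    proof -
      let ?j = "japanese_bracket x" and ?u = "norm (f x)" and ?v = "norm (phase_diff \<phi> f x)"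
      have j: "?j \<ge> 1" "?j > 0" using japanese_bracket_ge_1[of x] by auto
      have "?j powr m * norm (f x + phase_diff \<phi> f x) \<le> ?j powr m * (?u + ?v)"
        by (intro mult_left_mono norm_triangle_ineq) simp
      \<comment> \<open>Replacing u + v by 2 max(u, v) makes the p-th power split at once, at the
        price of the factor 2^p in \<open>E\<close>.\<close>
      also have "\<dots> \<le> ?j powr m * (2 * max ?u ?v)" by (intro mult_left_mono) auto
      finally have "norm (A x) \<le> 2 * ?j powr m * max ?u ?v" by (simp add: A_eq norm_mult mult_ac)
      then have "norm (A x) powr p \<le> (2 * ?j powr m * max ?u ?v) powr p" using p by (intro powr_mono2) auto
      also have "\<dots> = 2 powr p * (?j powr (m * p) * max ?u ?v powr p)" using j by (simp add: powr_mult powr_powr mult.assoc)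
      also have "\<dots> \<le> 2 powr p * (?u powr p + ?j powr (1 - p / 2) * ?v powr p)"
      proof (intro mult_left_mono)
        have 1: "?j powr (m * p) * ?u powr p \<le> 1 * ?u powr p"
          using powr_mono[of "m * p" 0 ?j] j m0 p by (intro mult_right_mono) (auto simp: mult_nonpos_nonneg)
        have 2: "?j powr (m * p) * ?v powr p \<le> ?j powr (1 - p / 2) * ?v powr p"
          using j m0 by (intro mult_right_mono powr_mono) auto
        have 3: "0 \<le> ?u powr p" "0 \<le> ?j powr (1 - p / 2) * ?v powr p" by auto
        show "?j powr (m * p) * max ?u ?v powr p \<le> ?u powr p + ?j powr (1 - p / 2) * ?v powr p"
        proof (cases "?u \<le> ?v")
          case True
          then have mx: "max ?u ?v = ?v" by simp
          show ?thesis unfolding mx using 2 3(1) by linarith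
        next
          case False
          then have mx: "max ?u ?v = ?u" by simp
          show ?thesis unfolding mx using 1 3(2) by linarith
        qed
      qed simp
      finally show ?thesis .
    qed
    have "(\<integral>\<^sup>+x. ennreal (norm (A x) powr p) \<partial>lborel)
        \<le> (\<integral>\<^sup>+x. ennreal (2 powr p) * (ennreal (norm (f x) powr p) + ennreal (japanese_bracket x powr (1 - p / 2) * norm (phase_diff \<phi> f x) powr p)) \<partial>lborel)"
      using pt by (intro nn_integral_mono) (simp add: ennreal_mult[symmetric] ennreal_leI flip: ennreal_plus)
    also have "\<dots> = ennreal (2 powr p) * ((\<integral>\<^sup>+x. ennreal (norm (f x) powr p) \<partial>lborel)
        + (\<integral>\<^sup>+x. ennreal (japanese_bracket x powr (1 - p / 2) * norm (phase_diff \<phi> f x) powr p) \<partial>lborel))"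
      by (simp add: nn_integral_cmult nn_integral_add)
    also have "\<dots> \<le> ennreal (2 powr p) * ((\<integral>\<^sup>+x. ennreal (norm (f x) powr p) \<partial>lborel)
        + ennreal K * (\<integral>\<^sup>+x. ennreal (norm (f x) powr p) \<partial>lborel))"
      by (intro mult_left_mono add_mono order_refl K(2) F(2)) auto
    also have "\<dots> = ennreal (E * (LINT t|lborel. norm (f t) powr p))"
      unfolding nf E_def using K(1) by (simp add: ennreal_mult[symmetric] integral_nonneg_AE algebra_simps flip: ennreal_plus)
    finally have fin: "(\<integral>\<^sup>+x. ennreal (norm (A x) powr p) \<partial>lborel) \<le> ennreal (E * (LINT t|lborel. norm (f t) powr p))" .
    then have Ap: "integrable lborel (\<lambda>x. norm (A x) powr p)"
      by (auto simp: integrable_iff_bounded intro: order_le_less_trans)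
    have "ennreal (LINT x|lborel. norm (A x) powr p) \<le> ennreal (E * (LINT t|lborel. norm (f t) powr p))"
      using fin nn_integral_eq_integral[OF Ap] by simp
    then have le: "(LINT x|lborel. norm (A x) powr p) \<le> E * (LINT t|lborel. norm (f t) powr p)"
      by (subst (asm) ennreal_le_iff) (use E0 in \<open>auto intro!: mult_nonneg_nonneg integral_nonneg_AE\<close>)
    have "Lp_norm p A \<le> (E * (LINT t|lborel. norm (f t) powr p)) powr (1 / p)"
      unfolding Lp_norm_def using p le by (intro powr_mono2) (auto intro!: integral_nonneg_AE)
    also have "\<dots> = E powr (1 / p) * Lp_norm p f"
      unfolding Lp_norm_def by (rule powr_mult)
    finally show ?thesis using Ap by (simp add: A_def[symmetric] in_Lp_def)
  qed
  then show ?thesis unfolding bounded_on_Lp_def by blast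
qed

end

section \<open>Van der Corput estimate and Schwartz approximation\<close>

text \<open>
  Instead of splitting at the stationary point, integrate the derivative of
  \<open>e(\<Phi>) \<Phi>1 / (\<Phi>1\<^sup>2 + \<kappa>)\<close>; all error terms are dominated by the derivative of an arctangent.
\<close>

lemma van_der_Corput:
  fixes \<Phi> \<Phi>1 \<Phi>2 :: "real \<Rightarrow> real"
  assumes ab: "a \<le> b"
    and d1: "\<And>\<eta>. (\<Phi> has_real_derivative \<Phi>1 \<eta>) (at \<eta>)"
    and d2: "\<And>\<eta>. (\<Phi>1 has_real_derivative \<Phi>2 \<eta>) (at \<eta>)"
    and \<kappa>: "\<kappa> > 0" and s: "\<bar>s\<bar> = 1" and conv: "\<And>\<eta>. \<eta> \<in> {a..b} \<Longrightarrow> \<kappa> \<le> s * \<Phi>2 \<eta>"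
  shows "norm (integral {a..b} (\<lambda>\<eta>. cis (2 * pi * \<Phi> \<eta>))) \<le> 9 / sqrt \<kappa>"
proof -
  define N where "N = (\<lambda>\<eta>. (\<Phi>1 \<eta>)\<^sup>2 + \<kappa>)"
  have N: "N \<eta> > 0" for \<eta> using \<kappa> by (simp add: N_def add_nonneg_pos)
  \<comment> \<open>A regularised reciprocal of \<open>\<Phi>1\<close>: close to it where
    \<open>\<Phi>1\<close> is large compared with sqrt \<kappa>, and zero instead of singular at a
    stationary point.\<close>
  let ?q = "\<lambda>\<eta>. \<Phi>1 \<eta> / N \<eta>"
  let ?q' = "\<lambda>\<eta>. \<Phi>2 \<eta> * (\<kappa> - (\<Phi>1 \<eta>)\<^sup>2) / (N \<eta>)\<^sup>2"
  let ?c = "\<lambda>\<eta>. cis (2 * pi * \<Phi> \<eta>)"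
  let ?w = "\<lambda>\<eta>. ?c \<eta> * of_real (?q \<eta>)"
  let ?w' = "\<lambda>\<eta>. ?c \<eta> * of_real (?q' \<eta>) + \<i> * of_real (2 * pi * \<Phi>1 \<eta>) * ?c \<eta> * of_real (?q \<eta>)"
  define r where "r = sqrt \<kappa>"
  have r: "r > 0" "r * r = \<kappa>" using \<kappa> by (auto simp: r_def)
  have dq: "(?q has_real_derivative ?q' \<eta>) (at \<eta>)" for \<eta>
  proof -
    have dN: "(N has_real_derivative 2 * \<Phi>1 \<eta> * \<Phi>2 \<eta>) (at \<eta>)"
      unfolding N_def by (auto intro!: derivative_eq_intros d2)
    have "(?q has_real_derivative (\<Phi>2 \<eta> * N \<eta> - \<Phi>1 \<eta> * (2 * \<Phi>1 \<eta> * \<Phi>2 \<eta>)) / (N \<eta> * N \<eta>)) (at \<eta>)"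
      using N[of \<eta>] by (intro DERIV_divide d2 dN) auto
    moreover have "\<Phi>2 \<eta> * N \<eta> - \<Phi>1 \<eta> * (2 * \<Phi>1 \<eta> * \<Phi>2 \<eta>) = \<Phi>2 \<eta> * (\<kappa> - (\<Phi>1 \<eta>)\<^sup>2)"
      by (simp add: N_def power2_eq_square algebra_simps)
    ultimately show ?thesis by (simp add: power2_eq_square)
  qed
  have dw: "(?w has_vector_derivative ?w' \<eta>) (at \<eta>)" for \<eta>
  proof -
    have "(?c has_vector_derivative \<i> * of_real (2 * pi * \<Phi>1 \<eta>) * ?c \<eta>) (at \<eta>)"
      by (rule has_vector_derivative_cis) (auto intro!: derivative_eq_intros d1)
    moreover have "((\<lambda>\<eta>. complex_of_real (?q \<eta>)) has_vector_derivative of_real (?q' \<eta>)) (at \<eta>)"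
      using dq[of \<eta>] by (intro has_vector_derivative_of_real) (simp add: has_real_derivative_iff_has_vector_derivative)
    ultimately show ?thesis by (rule has_vector_derivative_mult)
  qed
  \<comment> \<open>The common majorant: on {a..b} its derivative is |\<Phi>2| / N, while its total
    increase is at most pi/r however large \<Phi>2 becomes.\<close>
  let ?\<theta> = "\<lambda>\<eta>. s * arctan (\<Phi>1 \<eta> / r) / r"
  have d\<theta>: "(?\<theta> has_real_derivative s * \<Phi>2 \<eta> / N \<eta>) (at \<eta>)" for \<eta>
  proof -
    have "(?\<theta> has_real_derivative s * (inverse (1 + (\<Phi>1 \<eta> / r)\<^sup>2) * (\<Phi>2 \<eta> / r)) / r) (at \<eta>)"
      by (rule DERIV_cdivide DERIV_cmult DERIV_chain2[OF DERIV_arctan] d2)+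
    moreover have "s * (inverse (1 + (\<Phi>1 \<eta> / r)\<^sup>2) * (\<Phi>2 \<eta> / r)) / r = s * \<Phi>2 \<eta> / N \<eta>"
    proof -
      have "(1 + (\<Phi>1 \<eta> / r)\<^sup>2) * (r * r) = N \<eta>"
        using r(1) by (simp add: N_def r(2)[symmetric] power2_eq_square field_simps)
      then show ?thesis by (metis (no_types, lifting) divide_divide_eq_left divide_inverse mult.assoc mult.commute inverse_mult_distrib times_divide_eq_right)
    qed
    ultimately show ?thesis by simp
  qed
  have Iw: "(?w' has_integral (?w b - ?w a)) {a..b}"
    by (rule fundamental_theorem_of_calculus[OF ab]) (rule has_vector_derivative_at_within[OF dw])
  have I\<theta>: "((\<lambda>\<eta>. s * \<Phi>2 \<eta> / N \<eta>) has_integral (?\<theta> b - ?\<theta> a)) {a..b}"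
    by (rule fundamental_theorem_of_calculus[OF ab])
       (rule has_vector_derivative_at_within, use d\<theta> in \<open>simp add: has_real_derivative_iff_has_vector_derivative\<close>)
  have c\<Phi>: "continuous_on {a..b} \<Phi>" using d1 by (intro continuous_at_imp_continuous_on) (auto intro: DERIV_isCont)
  have Ic: "?c integrable_on {a..b}" by (intro integrable_continuous_real continuous_intros c\<Phi>)
  let ?W = "\<lambda>\<eta>. ?w' \<eta> / (2 * pi * \<i>)"
  have IW: "(?W has_integral ((?w b - ?w a) / (2 * pi * \<i>))) {a..b}" by (rule has_integral_divide[OF Iw])
  \<comment> \<open>Two errors: \<open>\<Phi>1 \<eta> * ?q \<eta>\<close> misses 1 by \<kappa>/N,
    and differentiating \<open>?q\<close> leaves |q'|/(2 pi). The lower bound on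
    \<open>s * \<Phi>2 \<eta>\<close> handles the first, |\<kappa> - \<Phi>1^2| \<le> N the second;
    each is at most one copy of the majorant.\<close>
  have pt: "norm (?c \<eta> - ?W \<eta>) \<le> 2 * (s * \<Phi>2 \<eta> / N \<eta>)" if "\<eta> \<in> {a..b}" for \<eta>
  proof -
    have split: "complex_of_real (\<Phi>1 \<eta> * ?q \<eta>) = 1 - of_real (\<kappa> / N \<eta>)"
    proof -
      have "\<Phi>1 \<eta> * ?q \<eta> = 1 - \<kappa> / N \<eta>" using N[of \<eta>] by (simp add: field_simps power2_eq_square) (simp add: N_def power2_eq_square)
      then show ?thesis by (metis of_real_1 of_real_diff)
    qed
    have "?W \<eta> = ?c \<eta> * of_real (?q' \<eta>) / (2 * pi * \<i>) + ?c \<eta> * of_real (\<Phi>1 \<eta> * ?q \<eta>)"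
      by (simp add: add_divide_distrib)
    then have "?c \<eta> - ?W \<eta> = ?c \<eta> * of_real (\<kappa> / N \<eta>) - ?c \<eta> * of_real (?q' \<eta>) / (2 * pi * \<i>)"
      unfolding split by (simp add: algebra_simps)
    then have "norm (?c \<eta> - ?W \<eta>) \<le> norm (?c \<eta> * of_real (\<kappa> / N \<eta>)) + norm (?c \<eta> * of_real (?q' \<eta>) / (2 * pi * \<i>))"
      by (simp only: norm_triangle_ineq4)
    also have "\<dots> = \<kappa> / N \<eta> + \<bar>?q' \<eta>\<bar> / (2 * pi)"
      using N[of \<eta>] \<kappa> by (simp only: norm_mult norm_divide norm_of_real norm_cis norm_ii norm_numeral mult_1 mult_1_right) simp
    also have "\<dots> \<le> s * \<Phi>2 \<eta> / N \<eta> + s * \<Phi>2 \<eta> / N \<eta>"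
    proof (rule add_mono)
      show "\<kappa> / N \<eta> \<le> s * \<Phi>2 \<eta> / N \<eta>" using N[of \<eta>] conv[OF that] by (intro divide_right_mono) auto
      have s2: "s * \<Phi>2 \<eta> = \<bar>\<Phi>2 \<eta>\<bar>" using conv[OF that] \<kappa> s by (auto simp: abs_if split: if_splits)
      have "\<bar>\<kappa> - (\<Phi>1 \<eta>)\<^sup>2\<bar> \<le> N \<eta>" using \<kappa> by (simp add: N_def abs_le_iff)
      then have "\<bar>?q' \<eta>\<bar> \<le> \<bar>\<Phi>2 \<eta>\<bar> * N \<eta> / (N \<eta>)\<^sup>2"
        by (simp add: abs_mult divide_right_mono mult_left_mono)
      also have "\<dots> = s * \<Phi>2 \<eta> / N \<eta>" using N[of \<eta>] by (simp add: s2 power2_eq_square)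
      finally have 1: "\<bar>?q' \<eta>\<bar> \<le> s * \<Phi>2 \<eta> / N \<eta>" .
      have "\<bar>?q' \<eta>\<bar> / (2 * pi) \<le> \<bar>?q' \<eta>\<bar> / 1" using pi_gt3 by (intro divide_left_mono) auto
      with 1 show "\<bar>?q' \<eta>\<bar> / (2 * pi) \<le> s * \<Phi>2 \<eta> / N \<eta>" by simp
    qed
    finally show ?thesis by simp
  qed
  have "norm (integral {a..b} (\<lambda>\<eta>. ?c \<eta> - ?W \<eta>)) \<le> integral {a..b} (\<lambda>\<eta>. 2 * (s * \<Phi>2 \<eta> / N \<eta>))"
    by (rule Henstock_Kurzweil_Integration.integral_norm_bound_integral[OF
          Henstock_Kurzweil_Integration.integrable_diff[OF Ic has_integral_integrable[OF IW]]
          has_integral_integrable[OF has_integral_mult_right[OF I\<theta>]] pt])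
  also have "\<dots> = 2 * (?\<theta> b - ?\<theta> a)"
    by (rule integral_unique[OF has_integral_mult_right[OF I\<theta>]])
  also have "\<dots> \<le> 2 * (pi / r)"
  proof -
    have "\<bar>arctan (\<Phi>1 b / r) - arctan (\<Phi>1 a / r)\<bar> \<le> pi"
      using arctan_lbound[of "\<Phi>1 b / r"] arctan_ubound[of "\<Phi>1 b / r"] arctan_lbound[of "\<Phi>1 a / r"] arctan_ubound[of "\<Phi>1 a / r"] by linarith
    moreover have "s * (arctan (\<Phi>1 b / r) - arctan (\<Phi>1 a / r)) \<le> \<bar>arctan (\<Phi>1 b / r) - arctan (\<Phi>1 a / r)\<bar>"
      using s by (metis abs_ge_self abs_mult mult_1)
    ultimately have "s * (arctan (\<Phi>1 b / r) - arctan (\<Phi>1 a / r)) / r \<le> pi / r" using r by (intro divide_right_mono) auto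
    then show ?thesis by (simp add: diff_divide_distrib right_diff_distrib)
  qed
  finally have 1: "norm (integral {a..b} (\<lambda>\<eta>. ?c \<eta> - ?W \<eta>)) \<le> 2 * (pi / r)" .
  have qb: "norm (?w \<eta>) \<le> 1 / r" for \<eta>
  proof -
    have "0 \<le> (\<bar>\<Phi>1 \<eta>\<bar> - r)\<^sup>2" by simp
    then have "2 * (\<bar>\<Phi>1 \<eta>\<bar> * r) \<le> N \<eta>" using r(2) by (simp add: N_def power2_eq_square algebra_simps)
    moreover have "0 \<le> \<bar>\<Phi>1 \<eta>\<bar> * r" using r by simp
    ultimately have "\<bar>\<Phi>1 \<eta>\<bar> * r \<le> N \<eta>" by linarith
    then have "\<bar>\<Phi>1 \<eta>\<bar> / N \<eta> \<le> 1 / r" using N[of \<eta>] r by (simp add: field_simps)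
    then show ?thesis using N[of \<eta>] by (simp add: norm_mult norm_divide)
  qed
  have "norm ((?w b - ?w a) / (2 * pi * \<i>)) = norm (?w b - ?w a) / (2 * pi)" by (simp add: norm_divide norm_mult)
  also have "\<dots> \<le> norm (?w b - ?w a) / 2" using pi_gt3 by (intro divide_left_mono) auto
  also have "\<dots> \<le> (1 / r + 1 / r) / 2"
    by (intro divide_right_mono order_trans[OF norm_triangle_ineq4] add_mono qb) auto
  also have "(1 / r + 1 / r) / 2 = 1 / r" by simp
  finally have 2: "norm ((?w b - ?w a) / (2 * pi * \<i>)) \<le> 1 / r" .
  have "integral {a..b} ?c = integral {a..b} (\<lambda>\<eta>. ?c \<eta> - ?W \<eta>) + (?w b - ?w a) / (2 * pi * \<i>)"
    unfolding Henstock_Kurzweil_Integration.integral_diff[OF Ic has_integral_integrable[OF IW]] integral_unique[OF IW]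
    by (simp only: diff_add_cancel)
  then have "norm (integral {a..b} ?c) \<le> 2 * (pi / r) + 1 / r"
    by (simp only: norm_triangle_mono[OF 1 2])
  \<comment> \<open>2 pi/r comes from the two errors and 1/r from the boundary terms; pi < 4 gives
    9.\<close>
  also have "\<dots> \<le> 9 / r" using pi_less_4 r by (simp add: field_simps)
  finally show ?thesis by (simp add: r_def)
qed

section \<open>Gaussian-damped test functions\<close>

lemma power_gauss_bounded:
  assumes "\<delta> > 0"
  shows "\<exists>B. \<forall>t. \<bar>t\<bar> ^ k * gauss \<delta> t \<le> B"
  using assms
proof (induction k arbitrary: \<delta>)
  case 0
  show ?case by (intro exI[of _ 1]) simp
next
  case (Suc k)
  \<comment> \<open>\<open>gauss \<delta>\<close> is the square of \<open>gauss d\<close>: one copy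
    absorbs the new factor |t|, the other is left to the induction hypothesis, which is why \<delta>
    is generalised.\<close>
  define d where "d = \<delta> / sqrt 2"
  have d: "d > 0" using Suc.prems by (simp add: d_def)
  have g: "gauss \<delta> t = gauss d t * gauss d t" for t
    by (simp add: gauss_def d_def exp_add[symmetric] power_mult_distrib power_divide)
  obtain B where B: "\<And>t. \<bar>t\<bar> ^ k * gauss d t \<le> B" using Suc.IH[OF d] by blast
  have one: "\<bar>t\<bar> * gauss d t \<le> 1 / d" for t
  proof -
    have "d * \<bar>t\<bar> \<le> 1 + (d * t)\<^sup>2"
    proof -
      have "2 * (d * \<bar>t\<bar>) \<le> 1 + (d * t)\<^sup>2"
        using sum_squares_bound[of 1 "d * \<bar>t\<bar>"] by (simp add: power_mult_distrib)
      moreover have "0 \<le> d * \<bar>t\<bar>" using d by simp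
      ultimately show ?thesis by linarith
    qed
    also have "\<dots> \<le> 1 + pi * (d * t)\<^sup>2" using pi_gt3 by (simp add: mult_right_mono[of 1 pi, simplified])
    also have "\<dots> \<le> exp (pi * (d * t)\<^sup>2)" by (rule exp_ge_add_one_self)
    finally show ?thesis using d by (simp add: gauss_def exp_minus field_simps)
  qed
  show ?case
  proof (intro exI allI)
    fix t
    have "\<bar>t\<bar> ^ Suc k * gauss \<delta> t = (\<bar>t\<bar> * gauss d t) * (\<bar>t\<bar> ^ k * gauss d t)" by (simp add: g mult_ac)
    also have "\<dots> \<le> (1 / d) * B" using d by (intro mult_mono one B) auto
    finally show "\<bar>t\<bar> ^ Suc k * gauss \<delta> t \<le> (1 / d) * B" .
  qed
qed

text \<open>
  Closed under differentiation and rapidly decreasing. Damping by a Gaussian allows test functions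
  whose Fourier transform is close to a sharply truncated one, so that no smooth cutoff is needed.
\<close>

inductive_set gauss_class :: "real \<Rightarrow> real \<Rightarrow> real \<Rightarrow> (real \<Rightarrow> complex) set" for \<delta> a b where
  base: "continuous_on {a..b} h \<Longrightarrow>
    (\<lambda>t. of_real (gauss \<delta> t) * integral {a..b} (\<lambda>\<eta>. cis (2 * pi * t * \<eta>) * h \<eta>)) \<in> gauss_class \<delta> a b"
| times: "f \<in> gauss_class \<delta> a b \<Longrightarrow> (\<lambda>t. of_real t * f t) \<in> gauss_class \<delta> a b"
| scale: "f \<in> gauss_class \<delta> a b \<Longrightarrow> (\<lambda>t. c * f t) \<in> gauss_class \<delta> a b"
| add: "f \<in> gauss_class \<delta> a b \<Longrightarrow> g \<in> gauss_class \<delta> a b \<Longrightarrow> (\<lambda>t. f t + g t) \<in> gauss_class \<delta> a b"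

text \<open>The closure rules are dictated by the base case: differentiating the integral multiplies
  h by 2 pi i \<eta>, which stays continuous, and differentiating the Gaussian produces the factor
  -2 pi \<delta>^2 t.\<close>

lemma gauss_class_deriv:
  assumes "f \<in> gauss_class \<delta> a b"
  shows "\<exists>f'\<in>gauss_class \<delta> a b. \<forall>t. (f has_vector_derivative f' t) (at t)"
  using assms
proof induction
  case (base h)
  let ?H = "\<lambda>t. integral {a..b} (\<lambda>\<eta>. cis (2 * pi * t * \<eta>) * h \<eta>)"
  let ?k = "\<lambda>\<eta>. \<i> * of_real (2 * pi * \<eta>) * h \<eta>"
  let ?H' = "\<lambda>t. integral {a..b} (\<lambda>\<eta>. cis (2 * pi * t * \<eta>) * ?k \<eta>)"
  have ck: "continuous_on {a..b} ?k" by (intro continuous_intros base)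
  have dH: "(?H has_vector_derivative ?H' t) (at t)" for t
  proof -
    have ch: "continuous_on (UNIV \<times> {a..b}) (\<lambda>z::real \<times> real. h (snd z))"
      by (rule continuous_on_compose2[OF base(1)]) (auto intro!: continuous_intros)
    have "((\<lambda>t. integral (cbox a b) (\<lambda>\<eta>. cis (2 * pi * t * \<eta>) * h \<eta>)) has_vector_derivative
        integral (cbox a b) (\<lambda>\<eta>. cis (2 * pi * t * \<eta>) * ?k \<eta>)) (at t within UNIV)"
    proof (rule leibniz_rule_vector_derivative)
      fix x \<eta> :: real
      have "((\<lambda>x. cis (2 * pi * x * \<eta>)) has_vector_derivative \<i> * of_real (2 * pi * \<eta>) * cis (2 * pi * x * \<eta>)) (at x)"
        by (rule has_vector_derivative_cis) (auto intro!: derivative_eq_intros)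
      from has_vector_derivative_mult_left[OF this, of "h \<eta>"]
      show "((\<lambda>x. cis (2 * pi * x * \<eta>) * h \<eta>) has_vector_derivative cis (2 * pi * x * \<eta>) * ?k \<eta>) (at x within UNIV)"
        by (simp add: mult_ac)
      show "(\<lambda>\<eta>. cis (2 * pi * x * \<eta>) * h \<eta>) integrable_on cbox a b"
        using base by (auto intro!: integrable_continuous_real continuous_intros)
    next
      show "continuous_on (UNIV \<times> cbox a b) (\<lambda>(x, \<eta>). cis (2 * pi * x * \<eta>) * ?k \<eta>)"
        using ch by (auto simp: case_prod_beta' intro!: continuous_intros)
    qed auto
    then show ?thesis by simp
  qed
  have dg: "((\<lambda>t. complex_of_real (gauss \<delta> t)) has_vector_derivative of_real (- (2 * pi * \<delta>\<^sup>2) * (t * gauss \<delta> t))) (at t)" for t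
    by (rule has_vector_derivative_of_real)
       (auto simp: gauss_def has_real_derivative_iff_has_vector_derivative[symmetric] power2_eq_square intro!: derivative_eq_intros)
  let ?f' = "\<lambda>t. of_real (gauss \<delta> t) * ?H' t + of_real (- (2 * pi * \<delta>\<^sup>2)) * (of_real t * (of_real (gauss \<delta> t) * ?H t))"
  have "?f' \<in> gauss_class \<delta> a b"
    by (intro gauss_class.intros ck base)
  moreover have "((\<lambda>t. of_real (gauss \<delta> t) * ?H t) has_vector_derivative ?f' t) (at t)" for t
    using has_vector_derivative_mult[OF dg dH, of t] by (simp add: mult_ac)
  ultimately show ?case by (intro bexI[of _ ?f'] allI)
next
  case (times f)
  then obtain f' where f': "f' \<in> gauss_class \<delta> a b" "\<And>t. (f has_vector_derivative f' t) (at t)" by blast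
  have "(\<lambda>t. of_real t * f' t + f t) \<in> gauss_class \<delta> a b"
    using times f' by (intro gauss_class.add gauss_class.times)
  moreover have "((\<lambda>t. of_real t * f t) has_vector_derivative (of_real t * f' t + f t)) (at t)" for t
  proof -
    have "((\<lambda>t. complex_of_real t) has_vector_derivative of_real 1) (at t)"
      by (rule has_vector_derivative_of_real) (rule DERIV_ident)
    from has_vector_derivative_mult[OF this f'(2)] show ?thesis by simp
  qed
  ultimately show ?case by (intro bexI[of _ "\<lambda>t. of_real t * f' t + f t"] allI)
next
  case (scale f c)
  then obtain f' where f': "f' \<in> gauss_class \<delta> a b" "\<And>t. (f has_vector_derivative f' t) (at t)" by blast
  then show ?case
    by (intro bexI[of _ "\<lambda>t. c * f' t"] allI has_vector_derivative_mult_right gauss_class.scale) auto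
next
  case (add f g)
  then obtain f' g' where "f' \<in> gauss_class \<delta> a b" "\<And>t. (f has_vector_derivative f' t) (at t)"
    "g' \<in> gauss_class \<delta> a b" "\<And>t. (g has_vector_derivative g' t) (at t)" by blast
  then show ?case
    by (intro bexI[of _ "\<lambda>t. f' t + g' t"] allI has_vector_derivative_add gauss_class.add) auto
qed

text \<open>Induction for all powers at once: the rule \<open>times\<close> trades k for
  \<open>Suc k\<close>, and the base case is a Gaussian times a bounded function.\<close>

lemma gauss_class_decay:
  assumes "f \<in> gauss_class \<delta> a b" and \<delta>: "\<delta> > 0"
  shows "bounded (range (\<lambda>t. t ^ k *\<^sub>R f t))"
  using assms(1)
proof (induction arbitrary: k)
  case (base h)
  have Hb: "norm (integral {a..b} (\<lambda>\<eta>. cis (2 * pi * t * \<eta>) * h \<eta>)) \<le> integral {a..b} (\<lambda>\<eta>. norm (h \<eta>))" for t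
    by (rule Henstock_Kurzweil_Integration.integral_norm_bound_integral)
       (auto intro!: integrable_continuous_real continuous_intros base simp: norm_mult)
  obtain B where B: "\<And>t. \<bar>t\<bar> ^ k * gauss \<delta> t \<le> B" using power_gauss_bounded[OF \<delta>] by blast
  show ?case unfolding bounded_iff
  proof (intro exI ballI)
    fix y assume "y \<in> range (\<lambda>t. t ^ k *\<^sub>R (of_real (gauss \<delta> t) * integral {a..b} (\<lambda>\<eta>. cis (2 * pi * t * \<eta>) * h \<eta>)))"
    then obtain t where y: "y = t ^ k *\<^sub>R (of_real (gauss \<delta> t) * integral {a..b} (\<lambda>\<eta>. cis (2 * pi * t * \<eta>) * h \<eta>))" by blast
    have "norm y = (\<bar>t\<bar> ^ k * gauss \<delta> t) * norm (integral {a..b} (\<lambda>\<eta>. cis (2 * pi * t * \<eta>) * h \<eta>))"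
      by (simp add: y norm_mult power_abs)
    also have "\<dots> \<le> B * integral {a..b} (\<lambda>\<eta>. norm (h \<eta>))"
      using B[of 0] by (intro mult_mono B Hb order_trans[OF _ B[of 0]]) auto
    finally show "norm y \<le> B * integral {a..b} (\<lambda>\<eta>. norm (h \<eta>))" .
  qed
next
  case (times f)
  then have "bounded (range (\<lambda>t. t ^ Suc k *\<^sub>R f t))" by blast
  then show ?case by (simp add: scaleR_conv_of_real mult_ac)
next
  case (scale f c)
  then have "bounded ((\<lambda>z. c * z) ` range (\<lambda>t. t ^ k *\<^sub>R f t))"
    by (intro bounded_linear_image[OF scale.IH bounded_linear_mult_right])
  then show ?case by (simp add: image_image)
next
  case (add f g)
  then have "bounded (range (\<lambda>t. t ^ k *\<^sub>R f t + t ^ k *\<^sub>R g t))" by (intro bounded_plus_comp) auto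
  then show ?case by (simp add: scaleR_add_right)
qed

lemma gauss_class_subset_schwartz:
  assumes \<delta>: "\<delta> > 0"
  shows "gauss_class \<delta> a b \<subseteq> schwartz_space"
proof
  fix f assume f: "f \<in> gauss_class \<delta> a b"
  have it: "iter_deriv n f \<in> gauss_class \<delta> a b" for n
  proof (induction n)
    case (Suc n)
    then obtain f' where f': "f' \<in> gauss_class \<delta> a b" "\<And>t. (iter_deriv n f has_vector_derivative f' t) (at t)"
      using gauss_class_deriv by blast
    have "iter_deriv (Suc n) f = f'"
      unfolding iter_deriv_Suc using f'(2) by (auto intro: vector_derivative_at)
    with f' show ?case by simp
  qed (use f in simp)
  have "iter_deriv n f differentiable at t" for n t
    using gauss_class_deriv[OF it[of n]] by (auto intro: differentiableI_vector)
  then show "f \<in> schwartz_space"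
    using gauss_class_decay[OF it \<delta>] by (auto simp: schwartz_space_def smooth_real_def)
qed

text \<open>Bridge from the Lebesgue integral, used for Fubini and L^2 estimates, to the
  Henstock-Kurzweil integral, used for the fundamental theorem and for differentiation under the
  integral.\<close>

lemma osc_int_indicator_eq_integral:
  assumes "continuous_on {a..b} \<Psi>" "continuous_on {a..b} h"
  shows "osc_int \<Psi> (\<lambda>\<eta>. indicator {a..b} \<eta> * h \<eta>) x = integral {a..b} (\<lambda>\<eta>. cis (2 * pi * \<Psi> \<eta> * x) * h \<eta>)"
proof -
  have "set_integrable lborel {a..b} (\<lambda>\<eta>. cis (2 * pi * \<Psi> \<eta> * x) * h \<eta>)"
    by (intro borel_integrable_atLeastAtMost' continuous_intros assms)
  note set_borel_integral_eq_integral(2)[OF this, unfolded set_lebesgue_integral_def]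
  moreover have "indicator {a..b} \<eta> *\<^sub>R (cis (2 * pi * \<Psi> \<eta> * x) * h \<eta>) = cis (2 * pi * \<Psi> \<eta> * x) * (indicator {a..b} \<eta> * h \<eta>)" for \<eta>
    by (simp split: split_indicator)
  ultimately show ?thesis by (simp add: osc_int_def)
qed

text \<open>Damping on the space side by \<open>gauss \<delta>\<close> is averaging of the amplitude
  on the frequency side at width \<delta>; the substitution \<xi> = \<eta> + \<delta> s leaves a
  fixed Gaussian measure in s.\<close>

lemma fourier_gauss_mult:
  assumes A: "integrable lborel A" and \<delta>: "\<delta> > 0"
  shows "osc_int uminus (\<lambda>t. of_real (gauss \<delta> t) * osc_int (\<lambda>\<xi>. \<xi>) A t) \<eta> = (LINT s|lborel. A (\<eta> + \<delta> * s) * gauss 1 s)"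
proof -
  have [measurable]: "A \<in> borel_measurable borel" using A by auto
  have G: "integrable lborel (\<lambda>t. cis (2 * pi * - t * \<eta>) * complex_of_real (gauss \<delta> t))"
    using integrable_gauss[of \<delta>] \<delta> by (auto intro!: integrable_cis_mult integrable_of_real)
  have "osc_int uminus (\<lambda>t. of_real (gauss \<delta> t) * osc_int (\<lambda>\<xi>. \<xi>) A t) \<eta>
      = (LINT t|lborel. (cis (2 * pi * - t * \<eta>) * complex_of_real (gauss \<delta> t)) * (LINT \<xi>|lborel. cis (2 * pi * \<xi> * t) * A \<xi>))"
    unfolding osc_int_def by (simp only: mult.assoc)
  also have "\<dots> = (LINT \<xi>|lborel. A \<xi> * (LINT t|lborel. cis (2 * pi * \<xi> * t) * (cis (2 * pi * - t * \<eta>) * complex_of_real (gauss \<delta> t))))"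
    by (rule Fubini_bounded_kernel[where B=1]) (use G A in auto)
  also have "(\<lambda>\<xi>. LINT t|lborel. cis (2 * pi * \<xi> * t) * (cis (2 * pi * - t * \<eta>) * complex_of_real (gauss \<delta> t))) = (\<lambda>\<xi>. of_real (gauss (1 / \<delta>) (\<xi> - \<eta>) / \<delta>))"
  proof
    fix \<xi>
    have "cis (2 * pi * \<xi> * t) * (cis (2 * pi * - t * \<eta>) * complex_of_real (gauss \<delta> t)) = cis (2 * pi * (\<xi> - \<eta>) * t) * gauss \<delta> t" for t
    proof -
      have "cis (2 * pi * \<xi> * t) * cis (2 * pi * - t * \<eta>) = cis (2 * pi * (\<xi> - \<eta>) * t)"
        unfolding cis_mult by (simp add: algebra_simps)
      then show ?thesis by (simp only: mult.assoc[symmetric])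
    qed
    then show "(LINT t|lborel. cis (2 * pi * \<xi> * t) * (cis (2 * pi * - t * \<eta>) * complex_of_real (gauss \<delta> t))) = of_real (gauss (1 / \<delta>) (\<xi> - \<eta>) / \<delta>)"
      by (simp only: fourier_gauss[OF \<delta>])
  qed
  also have "(LINT \<xi>|lborel. A \<xi> * of_real (gauss (1 / \<delta>) (\<xi> - \<eta>) / \<delta>))
      = \<bar>\<delta>\<bar> *\<^sub>R (LINT s|lborel. A (\<eta> + \<delta> * s) * of_real (gauss (1 / \<delta>) (\<eta> + \<delta> * s - \<eta>) / \<delta>))"
    using \<delta> by (subst lborel_integral_real_affine[where c=\<delta> and t=\<eta>]) auto
  also have "\<dots> = (LINT s|lborel. A (\<eta> + \<delta> * s) * gauss 1 s)"
    using \<delta> unfolding integral_scaleR_right[symmetric]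
    by (simp add: gauss_def scaleR_conv_of_real mult_ac)
  finally show ?thesis .
qed

text \<open>The weight 3 + 2 s^2 is the loss in the tail bound for smoothed amplitudes below; half
  of the Gaussian exponent absorbs it.\<close>

lemma integrable_gauss_second_moment: "integrable lborel (\<lambda>s. (3 + 2 * s\<^sup>2) * gauss 1 s)"
proof (rule Bochner_Integration.integrable_bound)
  let ?d = "1 / sqrt 2"
  show "integrable lborel (\<lambda>s. 5 * gauss ?d s)" by (intro integrable_mult_right integrable_gauss) simp
  show "AE s in lborel. norm ((3 + 2 * s\<^sup>2) * gauss 1 s) \<le> norm (5 * gauss ?d s)"
  proof (rule AE_I2)
    fix s :: real
    have "3 + 2 * s\<^sup>2 \<le> 5 * (1 + pi * s\<^sup>2 / 2)"
    proof -
      have "2 * s\<^sup>2 \<le> 5 * pi / 2 * s\<^sup>2" using pi_gt3 by (intro mult_right_mono) auto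
      then show ?thesis by simp
    qed
    also have "\<dots> \<le> 5 * exp (pi * s\<^sup>2 / 2)" by (intro mult_left_mono exp_ge_add_one_self) simp
    finally have "(3 + 2 * s\<^sup>2) * gauss 1 s \<le> 5 * exp (pi * s\<^sup>2 / 2) * gauss 1 s" by (intro mult_right_mono) auto
    also have "\<dots> = 5 * gauss ?d s"
    proof -
      have "exp (pi * s\<^sup>2 / 2) * gauss 1 s = exp (pi * s\<^sup>2 / 2 + - pi * (1 * s)\<^sup>2)" unfolding gauss_def by (rule exp_add[symmetric])
      also have "pi * s\<^sup>2 / 2 + - pi * (1 * s)\<^sup>2 = - pi * (?d * s)\<^sup>2" by (simp add: power_divide field_simps)
      finally show ?thesis by (simp add: gauss_def)
    qed
    finally show "norm ((3 + 2 * s\<^sup>2) * gauss 1 s) \<le> norm (5 * gauss ?d s)"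
      by (simp add: abs_mult add_nonneg_nonneg)
  qed
qed simp

text \<open>Smoothed amplitudes converge to \<open>A\<close> at its continuity points, hence almost
  everywhere, which admits sharply truncated \<open>A\<close>. The oscillating factor is unimodular,
  so dominated convergence applies for each x.\<close>

lemma osc_int_gauss_approx:
  assumes [measurable]: "\<phi> \<in> borel_measurable borel" "A \<in> borel_measurable borel"
    and A: "\<And>\<eta>. norm (A \<eta>) \<le> indicator {-1..1} \<eta>" and cA: "AE \<eta> in lborel. isCont A \<eta>"
  shows "(\<lambda>n. osc_int \<phi> (osc_int uminus (\<lambda>t. of_real (gauss (1 / Suc n) t) * osc_int (\<lambda>\<xi>. \<xi>) A t)) x) \<longlonglongrightarrow> osc_int \<phi> A x"
proof -
  have iA: "integrable lborel A"
  proof (rule Bochner_Integration.integrable_bound)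
    show "integrable lborel (indicator {-1..1} :: real \<Rightarrow> real)"
      by (intro integrable_real_indicator) (simp_all add: emeasure_lborel_Icc_eq)
    show "AE \<eta> in lborel. norm (A \<eta>) \<le> norm (indicator {-1..1} \<eta> :: real)" using A by auto
  qed simp
  define F where "F = (\<lambda>n \<eta>. LINT s|lborel. A (\<eta> + (1 / real (Suc n)) * s) * gauss 1 s)"
  have F: "osc_int uminus (\<lambda>t. of_real (gauss (1 / Suc n) t) * osc_int (\<lambda>\<xi>. \<xi>) A t) = F n" for n
    unfolding F_def by (rule ext) (rule fourier_gauss_mult[OF iA], simp)
  have [measurable]: "F n \<in> borel_measurable borel" for n unfolding F_def by measurable
  have A1: "norm (A \<eta>) \<le> 1" for \<eta> using A[of \<eta>] by (auto split: split_indicator_asm)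
  have e0: "(\<lambda>n. 1 / real (Suc n)) \<longlonglongrightarrow> 0" using LIMSEQ_inverse_real_of_nat by (simp add: inverse_eq_divide)
  define K where "K = (LINT s|lborel. (3 + 2 * s\<^sup>2) * gauss 1 s)"
  \<comment> \<open>Smoothing destroys compact support, so a majorant uniform in n is needed. If
    \<eta> + s/(n+1) lies in [-1,1], then |\<eta>| \<le> 1 + |s| and 1 + \<eta>^2 \<le> 3 + 2 s^2;
    integrating in s gives K/(1 + \<eta>^2).\<close>
  have Fb: "norm (F n \<eta>) \<le> K * (1 / (1 + \<eta>\<^sup>2))" for n \<eta>
  proof -
    let ?\<delta> = "1 / real (Suc n)"
    have "norm (F n \<eta>) \<le> (LINT s|lborel. (3 + 2 * s\<^sup>2) * gauss 1 s * (1 / (1 + \<eta>\<^sup>2)))"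
      unfolding F_def
    proof (rule Bochner_Integration.integral_norm_bound_integral)
      show "integrable lborel (\<lambda>s. (3 + 2 * s\<^sup>2) * gauss 1 s * (1 / (1 + \<eta>\<^sup>2)))"
        by (intro integrable_mult_left integrable_gauss_second_moment)
      show "integrable lborel (\<lambda>s. A (\<eta> + ?\<delta> * s) * complex_of_real (gauss 1 s))"
        by (rule Bochner_Integration.integrable_bound[OF fourier_std_gauss(1)])
           (use A1 in \<open>auto intro!: AE_I2 simp: norm_mult mult_left_le_one_le\<close>)
      fix s :: real
      have "norm (A (\<eta> + ?\<delta> * s)) \<le> (3 + 2 * s\<^sup>2) * (1 / (1 + \<eta>\<^sup>2))"
      proof (cases "\<eta> + ?\<delta> * s \<in> {-1..1}")
        case True
        have "\<bar>?\<delta> * s\<bar> \<le> \<bar>s\<bar>" by (simp add: abs_mult divide_le_eq mult_le_cancel_left1)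
        with True have "\<bar>\<eta>\<bar> \<le> 1 + \<bar>s\<bar>" unfolding atLeastAtMost_iff by linarith
        then have "\<bar>\<eta>\<bar>\<^sup>2 \<le> (1 + \<bar>s\<bar>)\<^sup>2" by (intro power_mono) auto
        also have "(1 + \<bar>s\<bar>)\<^sup>2 \<le> 2 + 2 * s\<^sup>2"
          using sum_squares_bound[of 1 "\<bar>s\<bar>"] by (simp add: power2_sum)
        finally have "1 \<le> (3 + 2 * s\<^sup>2) * (1 / (1 + \<eta>\<^sup>2))"
          by (simp add: add_pos_nonneg)
        then show ?thesis using A1[of "\<eta> + ?\<delta> * s"] by linarith
      next
        case False
        then have "norm (A (\<eta> + ?\<delta> * s)) \<le> 0" using A[of "\<eta> + ?\<delta> * s"] by simp
        also have "0 \<le> (3 + 2 * s\<^sup>2) * (1 / (1 + \<eta>\<^sup>2))" by (simp add: add_nonneg_nonneg)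
        finally show ?thesis .
      qed
      from mult_right_mono[OF this, of "gauss 1 s"]
      show "norm (A (\<eta> + ?\<delta> * s) * complex_of_real (gauss 1 s)) \<le> (3 + 2 * s\<^sup>2) * gauss 1 s * (1 / (1 + \<eta>\<^sup>2))"
        by (simp add: norm_mult)
    qed
    then show ?thesis by (simp add: K_def)
  qed
  have Flim: "(\<lambda>n. F n \<eta>) \<longlonglongrightarrow> A \<eta>" if "isCont A \<eta>" for \<eta>
  proof -
    have "(\<lambda>n. F n \<eta>) \<longlonglongrightarrow> (LINT s|lborel. A \<eta> * gauss 1 s)"
      unfolding F_def
    proof (rule integral_dominated_convergence[where w="gauss 1"])
      show "AE s in lborel. (\<lambda>n. A (\<eta> + 1 / real (Suc n) * s) * complex_of_real (gauss 1 s)) \<longlonglongrightarrow> A \<eta> * complex_of_real (gauss 1 s)"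
      proof (rule AE_I2)
        fix s
        have "(\<lambda>n. \<eta> + 1 / real (Suc n) * s) \<longlonglongrightarrow> \<eta> + 0 * s" by (intro tendsto_intros e0)
        then have "(\<lambda>n. A (\<eta> + 1 / real (Suc n) * s)) \<longlonglongrightarrow> A \<eta>"
          by (intro isCont_tendsto_compose[OF that]) simp
        then show "(\<lambda>n. A (\<eta> + 1 / real (Suc n) * s) * complex_of_real (gauss 1 s)) \<longlonglongrightarrow> A \<eta> * complex_of_real (gauss 1 s)"
          by (intro tendsto_intros)
      qed
      show "AE s in lborel. norm (A (\<eta> + 1 / real (Suc n) * s) * complex_of_real (gauss 1 s)) \<le> gauss 1 s" for n
        using A1 by (auto intro!: AE_I2 simp: norm_mult mult_left_le_one_le)
    qed (use fourier_std_gauss(1) in auto)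
    also have "(LINT s|lborel. A \<eta> * gauss 1 s) = A \<eta>" by (simp add: integral_gauss_1)
    finally show ?thesis .
  qed
  show ?thesis
    unfolding F unfolding osc_int_def
  proof (rule integral_dominated_convergence[where w="\<lambda>\<eta>. K * (1 / (1 + \<eta>\<^sup>2))"])
    show "integrable lborel (\<lambda>\<eta>. K * (1 / (1 + \<eta>\<^sup>2)))"
      by (intro integrable_mult_right integrable_inverse_1_plus_square_UNIV)
    show "AE \<eta> in lborel. (\<lambda>n. cis (2 * pi * \<phi> \<eta> * x) * F n \<eta>) \<longlonglongrightarrow> cis (2 * pi * \<phi> \<eta> * x) * A \<eta>"
      using cA by eventually_elim (intro tendsto_intros Flim)
    show "AE \<eta> in lborel. norm (cis (2 * pi * \<phi> \<eta> * x) * F n \<eta>) \<le> K * (1 / (1 + \<eta>\<^sup>2))" for n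
      using Fb[of n] by (intro AE_I2) (simp add: norm_mult)
  qed auto
qed

text \<open>Raised to the power p and stated with nonnegative integrals, boundedness becomes
  compatible with Fatou. The constant in \<open>bounded_on_Lp\<close> may be negative, hence the
  absolute value.\<close>

lemma bounded_on_Lp_nn_integral:
  assumes "bounded_on_Lp p T" and p: "p > 0"
  obtains C where "C \<ge> 0" "\<And>f. f \<in> schwartz_space \<Longrightarrow>
    (\<integral>\<^sup>+x. ennreal (norm (T f x) powr p) \<partial>lborel) \<le> ennreal C * (\<integral>\<^sup>+x. ennreal (norm (f x) powr p) \<partial>lborel)"
proof -
  obtain C where C: "\<And>f. f \<in> schwartz_space \<Longrightarrow> in_Lp p (T f) \<and> Lp_norm p (T f) \<le> C * Lp_norm p f"
    using assms unfolding bounded_on_Lp_def by blast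
  have pw: "Lp_norm p f powr p = (LINT x|lborel. norm (f x) powr p)" for f
    using p by (simp add: Lp_norm_def powr_powr integral_nonneg_AE)
  have "(\<integral>\<^sup>+x. ennreal (norm (T f x) powr p) \<partial>lborel) \<le> ennreal (\<bar>C\<bar> powr p) * (\<integral>\<^sup>+x. ennreal (norm (f x) powr p) \<partial>lborel)"
    if f: "f \<in> schwartz_space" for f
  proof -
    have n0: "0 \<le> Lp_norm p g" for g by (simp add: Lp_norm_def)
    have "Lp_norm p (T f) \<le> \<bar>C\<bar> * Lp_norm p f"
      using C[OF f] mult_right_mono[OF abs_ge_self[of C] n0[of f]] by linarith
    then have "Lp_norm p (T f) powr p \<le> (\<bar>C\<bar> * Lp_norm p f) powr p" using n0 p by (intro powr_mono2) auto
    also have "\<dots> = \<bar>C\<bar> powr p * Lp_norm p f powr p" by (rule powr_mult)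
    finally have le: "(LINT x|lborel. norm (T f x) powr p) \<le> \<bar>C\<bar> powr p * (LINT x|lborel. norm (f x) powr p)"
      unfolding pw .
    have "(\<integral>\<^sup>+x. ennreal (norm (T f x) powr p) \<partial>lborel) = ennreal (LINT x|lborel. norm (T f x) powr p)"
      using C[OF f] by (intro nn_integral_eq_integral) (auto simp: in_Lp_def)
    also have "\<dots> \<le> ennreal (\<bar>C\<bar> powr p) * ennreal (LINT x|lborel. norm (f x) powr p)"
      using le by (simp add: ennreal_mult[symmetric] integral_nonneg_AE ennreal_leI)
    \<comment> \<open>Only this direction is required, and it holds even where the Bochner integral
      takes its default value.\<close>
    also have "\<dots> \<le> ennreal (\<bar>C\<bar> powr p) * (\<integral>\<^sup>+x. ennreal (norm (f x) powr p) \<partial>lborel)"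
      using norm_integral_le_nn_integral[of lborel "\<lambda>x. norm (f x) powr p"]
      by (intro mult_left_mono) (auto simp: integral_nonneg_AE)
    finally show ?thesis .
  qed
  then show ?thesis by (intro that[of "\<bar>C\<bar> powr p"]) auto
qed

text \<open>Near \<mu> the bracket lies between \<mu>/2 and 3 \<mu>; the minimum of the two
  constants covers both signs of m.\<close>

lemma japanese_bracket_powr_lower:
  assumes "\<mu> \<ge> 1" "\<bar>x - \<mu>\<bar> \<le> 1 / 8"
  shows "min ((1 / 2) powr m) (3 powr m) * \<mu> powr m \<le> japanese_bracket x powr m"
proof -
  have j: "\<mu> / 2 \<le> japanese_bracket x" "japanese_bracket x \<le> 3 * \<mu>"
  proof -
    show "\<mu> / 2 \<le> japanese_bracket x" using japanese_bracket_ge_abs[of x] assms by linarith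
    have "japanese_bracket x \<le> 1 + \<bar>x\<bar>" unfolding japanese_bracket_def by (rule real_le_lsqrt) (auto simp: power2_sum)
    then show "japanese_bracket x \<le> 3 * \<mu>" using assms by linarith
  qed
  show ?thesis
  proof (cases "m \<ge> 0")
    case True
    have "min ((1 / 2) powr m) (3 powr m) * \<mu> powr m \<le> (1 / 2) powr m * \<mu> powr m" by (intro mult_right_mono) auto
    also have "\<dots> = (\<mu> / 2) powr m" by (simp add: powr_mult[symmetric])
    also have "\<dots> \<le> japanese_bracket x powr m" using True j assms by (intro powr_mono2) auto
    finally show ?thesis .
  next
    case False
    have "min ((1 / 2) powr m) (3 powr m) * \<mu> powr m \<le> 3 powr m * \<mu> powr m" by (intro mult_right_mono) auto
    also have "\<dots> = (3 * \<mu>) powr m" by (simp add: powr_mult)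
    also have "\<dots> \<le> japanese_bracket x powr m" using False j assms by (intro powr_mono2') auto
    finally show ?thesis .
  qed
qed

section \<open>Necessity\<close>

context phase
begin

text \<open>For each t the phase is t \<eta> - \<mu> \<phi>(\<eta>). Its second derivative has size
  at least \<mu> c regardless of t, so van der Corput gives a uniform sup bound; the squared L^2
  norm is at most the length b - a.\<close>

lemma packet_Lp_bound:
  assumes d2: "\<And>\<eta>. (\<phi>' has_real_derivative \<phi>'' \<eta>) (at \<eta>)"
    and ab: "a \<le> b" and c: "c > 0" and s: "\<bar>s\<bar> = 1" and conv: "\<And>\<eta>. \<eta> \<in> {a..b} \<Longrightarrow> c \<le> s * \<phi>'' \<eta>"
    and p: "p > 2" and \<mu>: "\<mu> > 0"
  shows "(\<integral>\<^sup>+t. ennreal (norm (osc_int (\<lambda>\<xi>. \<xi>) (\<lambda>\<eta>. indicator {a..b} \<eta> * cis (- (2 * pi * \<mu> * \<phi> \<eta>))) t) powr p) \<partial>lborel)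
    \<le> ennreal ((9 / sqrt (\<mu> * c)) powr (p - 2) * (b - a))"
proof -
  let ?A = "\<lambda>\<eta>. indicator {a..b} \<eta> * cis (- (2 * pi * \<mu> * \<phi> \<eta>))"
  let ?f = "osc_int (\<lambda>\<xi>. \<xi>) ?A"
  have nA: "norm (?A \<eta>) = indicator {a..b} \<eta>" for \<eta> by (simp split: split_indicator)
  have iA: "integrable lborel ?A"
  proof (rule Bochner_Integration.integrable_bound)
    show "integrable lborel (indicator {a..b} :: real \<Rightarrow> real)"
      using ab by (intro integrable_real_indicator) (simp_all add: emeasure_lborel_Icc_eq)
  qed (auto simp: nA)
  have sup: "norm (?f t) \<le> 9 / sqrt (\<mu> * c)" for t
  proof -
    have "?f t = integral {a..b} (\<lambda>\<eta>. cis (2 * pi * \<eta> * t) * cis (- (2 * pi * \<mu> * \<phi> \<eta>)))"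
      by (intro osc_int_indicator_eq_integral continuous_intros continuous_on_subset[OF continuous]) auto
    also have "\<dots> = integral {a..b} (\<lambda>\<eta>. cis (2 * pi * (t * \<eta> - \<mu> * \<phi> \<eta>)))"
      unfolding cis_mult by (simp add: algebra_simps)
    also have "norm \<dots> \<le> 9 / sqrt (\<mu> * c)"
    proof (rule van_der_Corput[OF ab])
      show "((\<lambda>\<eta>. t * \<eta> - \<mu> * \<phi> \<eta>) has_real_derivative t - \<mu> * \<phi>' \<eta>) (at \<eta>)" for \<eta>
        by (auto intro!: derivative_eq_intros deriv)
      show "((\<lambda>\<eta>. t - \<mu> * \<phi>' \<eta>) has_real_derivative - (\<mu> * \<phi>'' \<eta>)) (at \<eta>)" for \<eta>
        by (auto intro!: derivative_eq_intros d2)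
      \<comment> \<open>The sign is -s because \<phi> enters the phase with coefficient
        -\<mu>.\<close>
      show "\<mu> * c \<le> (- s) * - (\<mu> * \<phi>'' \<eta>)" if "\<eta> \<in> {a..b}" for \<eta>
        using mult_left_mono[OF conv[OF that], of \<mu>] \<mu> by (simp add: mult_ac)
    qed (use \<mu> c s in auto)
    finally show ?thesis .
  qed
  let ?S = "9 / sqrt (\<mu> * c)"
  have "(\<integral>\<^sup>+t. ennreal (norm (?f t) powr p) \<partial>lborel) \<le> ennreal (?S powr (p - 2)) * (\<integral>\<^sup>+t. ennreal ((norm (?f t))\<^sup>2) \<partial>lborel)"
    by (rule nn_integral_powr_le_sup_L2[OF _ sup p]) measurable
  also have "\<dots> \<le> ennreal (?S powr (p - 2)) * (ennreal 1 * (\<integral>\<^sup>+\<eta>. ennreal ((norm (?A \<eta>))\<^sup>2) \<partial>lborel))"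
    by (intro mult_left_mono osc_int_L2_bound iA) auto
  also have "(\<integral>\<^sup>+\<eta>. ennreal ((norm (?A \<eta>))\<^sup>2) \<partial>lborel) = (\<integral>\<^sup>+\<eta>. indicator {a..b} \<eta> \<partial>lborel)"
    unfolding nA by (intro nn_integral_cong) (simp split: split_indicator)
  also have "\<dots> = ennreal (b - a)" using ab by simp
  also have "ennreal (?S powr (p - 2)) * (ennreal 1 * ennreal (b - a)) = ennreal (?S powr (p - 2) * (b - a))"
    using ab by (simp add: ennreal_mult[symmetric])
  finally show ?thesis .
qed

text \<open>At x = \<mu> the operator cancels the oscillation of the packet completely. Nearby the
  leftover phase is at most 2 pi/8, so the real part of the integrand stays above 1/2.\<close>

lemma focusing_lower_bound:
  assumes ab: "a < b" and P: "P > 0" "\<And>\<eta>. \<eta> \<in> {a..b} \<Longrightarrow> \<bar>\<phi> \<eta>\<bar> \<le> P" and x: "\<bar>x - \<mu>\<bar> \<le> 1 / (8 * P)"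
  shows "(b - a) / 2 \<le> norm (osc_int \<phi> (\<lambda>\<eta>. indicator {a..b} \<eta> * cis (- (2 * pi * \<mu> * \<phi> \<eta>))) x)"
proof -
  let ?\<theta> = "\<lambda>\<eta>. 2 * pi * (x - \<mu>) * \<phi> \<eta>"
  have c\<phi>: "continuous_on {a..b} \<phi>" by (rule continuous_on_subset[OF continuous]) auto
  have "osc_int \<phi> (\<lambda>\<eta>. indicator {a..b} \<eta> * cis (- (2 * pi * \<mu> * \<phi> \<eta>))) x
      = integral {a..b} (\<lambda>\<eta>. cis (2 * pi * \<phi> \<eta> * x) * cis (- (2 * pi * \<mu> * \<phi> \<eta>)))"
    by (intro osc_int_indicator_eq_integral continuous_intros c\<phi>)
  also have "\<dots> = integral {a..b} (\<lambda>\<eta>. cis (?\<theta> \<eta>))"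
    unfolding cis_mult by (simp add: algebra_simps)
  finally have eq: "osc_int \<phi> (\<lambda>\<eta>. indicator {a..b} \<eta> * cis (- (2 * pi * \<mu> * \<phi> \<eta>))) x = integral {a..b} (\<lambda>\<eta>. cis (?\<theta> \<eta>))" .
  have I: "(\<lambda>\<eta>. cis (?\<theta> \<eta>)) integrable_on {a..b}" by (intro integrable_continuous_real continuous_intros c\<phi>)
  have cos: "1 / 2 \<le> cos (?\<theta> \<eta>)" if "\<eta> \<in> {a..b}" for \<eta>
  proof -
    have "\<bar>?\<theta> \<eta>\<bar> = 2 * pi * (\<bar>x - \<mu>\<bar> * \<bar>\<phi> \<eta>\<bar>)" by (simp add: abs_mult)
    also have "\<dots> \<le> 2 * pi * (1 / (8 * P) * P)" using P x that by (intro mult_left_mono mult_mono) auto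
    also have "\<dots> \<le> pi / 3" using P by simp
    finally have "cos (pi / 3) \<le> cos \<bar>?\<theta> \<eta>\<bar>" using pi_gt3 by (subst cos_mono_le_eq) auto
    then show ?thesis by (simp add: cos_60)
  qed
  have "(b - a) / 2 = integral {a..b} (\<lambda>\<eta>. 1 / 2)" using ab by simp
  also have "\<dots> \<le> integral {a..b} (\<lambda>\<eta>. Re (cis (?\<theta> \<eta>)))"
    by (rule Henstock_Kurzweil_Integration.integral_le) (use cos in \<open>auto intro!: integrable_continuous_real continuous_intros c\<phi>\<close>)
  also have "\<dots> = Re (integral {a..b} (\<lambda>\<eta>. cis (?\<theta> \<eta>)))"
    using integral_linear[OF I bounded_linear_Re] by (simp add: o_def)
  also have "\<dots> \<le> norm (integral {a..b} (\<lambda>\<eta>. cis (?\<theta> \<eta>)))" by (rule complex_Re_le_cmod)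
  finally show ?thesis unfolding eq .
qed

lemma bounded_on_Lp_bracket_powr_necessary:
  assumes d2: "\<And>\<eta>. (\<phi>' has_real_derivative \<phi>'' \<eta>) (at \<eta>)"
    and ab: "a < b" "{a..b} \<subseteq> {-1..1}" and c: "c > 0" and s: "\<bar>s\<bar> = 1" and conv: "\<And>\<eta>. \<eta> \<in> {a..b} \<Longrightarrow> c \<le> s * \<phi>'' \<eta>"
    and p: "p > 2"
    and bd: "bounded_on_Lp p (fourier_integral_operator \<phi> (\<lambda>x \<eta>. complex_of_real (japanese_bracket x powr m)))"
  shows "m \<le> - (1 / 2 - 1 / p)"
proof -
  let ?T = "fourier_integral_operator \<phi> (\<lambda>x \<eta>. complex_of_real (japanese_bracket x powr m))"
  obtain C where C: "C \<ge> 0" "\<And>f. f \<in> schwartz_space \<Longrightarrow>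
    (\<integral>\<^sup>+x. ennreal (norm (?T f x) powr p) \<partial>lborel) \<le> ennreal C * (\<integral>\<^sup>+x. ennreal (norm (f x) powr p) \<partial>lborel)"
    using bounded_on_Lp_nn_integral[OF bd] p by auto
  have c\<phi>: "continuous_on {a..b} \<phi>" by (rule continuous_on_subset[OF continuous]) auto
  obtain P where P: "P \<ge> 1" "\<And>\<eta>. \<eta> \<in> {a..b} \<Longrightarrow> \<bar>\<phi> \<eta>\<bar> \<le> P"
  proof -
    have "bounded (\<phi> ` {a..b})" by (intro compact_imp_bounded compact_continuous_image c\<phi>) simp
    then obtain B where "\<And>\<eta>. \<eta> \<in> {a..b} \<Longrightarrow> \<bar>\<phi> \<eta>\<bar> \<le> B" unfolding bounded_iff by (metis imageI real_norm_def)
    \<comment> \<open>Enforcing P \<ge> 1 makes the window radius 1/(8P) at most 1/8, as the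
      comparison of <x> with \<mu> requires.\<close>
    then show ?thesis by (intro that[of "max 1 B"]) (auto simp: le_max_iff_disj)
  qed
  define r where "r = 1 / (8 * P)"
  have r: "r > 0" "r \<le> 1 / 8" using P by (auto simp: r_def field_simps)
  define k where "k = min ((1 / 2) powr m) (3 powr m) * ((b - a) / 2)"
  have k: "k > 0" using ab by (simp add: k_def)
  define D where "D = C * ((9 / sqrt c) powr (p - 2) * (b - a))"
  \<comment> \<open>Left: the operator is at least k \<mu>^m on a window of length 2r. Right: C
    times the L^p mass of the packet. Neither r nor k depends on \<mu>.\<close>
  have key: "(k * \<mu> powr m) powr p * (2 * r) \<le> D * \<mu> powr (- (p - 2) / 2)" if \<mu>: "\<mu> \<ge> 1" for \<mu>
  proof -
    define A where "A = (\<lambda>\<eta>. indicator {a..b} \<eta> * cis (- (2 * pi * \<mu> * \<phi> \<eta>)))"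
    define f where "f = osc_int (\<lambda>\<xi>. \<xi>) A"
    define g where "g = (\<lambda>n t. of_real (gauss (1 / Suc n) t) * f t)"
    have [measurable]: "A \<in> borel_measurable borel" unfolding A_def by measurable
    have [measurable]: "f \<in> borel_measurable borel" unfolding f_def by measurable
    have fb: "(\<integral>\<^sup>+t. ennreal (norm (f t) powr p) \<partial>lborel) \<le> ennreal ((9 / sqrt (\<mu> * c)) powr (p - 2) * (b - a))"
      unfolding f_def A_def by (rule packet_Lp_bound[OF d2 _ c s conv p]) (use ab \<mu> in auto)
    have ch: "continuous_on {a..b} (\<lambda>\<eta>. cis (- (2 * pi * \<mu> * \<phi> \<eta>)))" by (intro continuous_intros c\<phi>)
    have gS: "g n \<in> schwartz_space" for n
    proof -
      have "f t = integral {a..b} (\<lambda>\<eta>. cis (2 * pi * t * \<eta>) * cis (- (2 * pi * \<mu> * \<phi> \<eta>)))" for t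
        unfolding f_def A_def by (subst osc_int_indicator_eq_integral[OF _ ch]) (auto intro!: continuous_intros simp: mult_ac)
      then have "g n \<in> gauss_class (1 / Suc n) a b"
        unfolding g_def by (simp only:) (rule gauss_class.base[OF ch])
      then show ?thesis using gauss_class_subset_schwartz[of "1 / Suc n" a b] by auto
    qed
    \<comment> \<open>The truncated amplitude can jump only at a and b, a null set, so the damped
      packets have images converging at every x.\<close>
    have Tg: "(\<lambda>n. ?T (g n) x) \<longlonglongrightarrow> of_real (japanese_bracket x powr m) * osc_int \<phi> A x" for x
      unfolding fourier_integral_operator_eq g_def f_def
    proof (intro tendsto_mult tendsto_const osc_int_gauss_approx)
      show "norm (A \<eta>) \<le> indicator {-1..1} \<eta>" for \<eta> using ab(2) by (auto simp: A_def split: split_indicator)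
      show "AE \<eta> in lborel. isCont A \<eta>"
        using AE_lborel_singleton[of a] AE_lborel_singleton[of b]
      proof eventually_elim
        case (elim \<eta>)
        show ?case
        proof (cases "\<eta> \<in> {a..b}")
          case True
          then have "\<eta> \<in> {a<..<b}" using elim by auto
          moreover have "continuous_on {a<..<b} A"
            by (rule continuous_on_eq[OF continuous_on_subset[OF ch]]) (auto simp: A_def)
          ultimately show ?thesis by (simp add: continuous_on_eq_continuous_at)
        next
          case False
          then have "\<eta> \<in> - {a..b}" by simp
          moreover have "continuous_on (- {a..b}) A"
            by (rule continuous_on_eq[OF continuous_on_const[of _ 0]]) (auto simp: A_def)
          ultimately show ?thesis using continuous_on_eq_continuous_at[of "- {a..b}" A] by (simp add: open_Compl)
        qed
      qed
    qed auto
    have lower: "k * \<mu> powr m \<le> norm (of_real (japanese_bracket x powr m) * osc_int \<phi> A x)" if x: "x \<in> {\<mu> - r..\<mu> + r}" for x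
    proof -
      have xr: "\<bar>x - \<mu>\<bar> \<le> r" using x by (auto simp: abs_le_iff)
      have "k * \<mu> powr m = (min ((1 / 2) powr m) (3 powr m) * \<mu> powr m) * ((b - a) / 2)" by (simp add: k_def)
      also have "\<dots> \<le> japanese_bracket x powr m * norm (osc_int \<phi> A x)"
      proof (intro mult_mono)
        show "min ((1 / 2) powr m) (3 powr m) * \<mu> powr m \<le> japanese_bracket x powr m"
          using xr r \<mu> by (intro japanese_bracket_powr_lower) auto
        show "(b - a) / 2 \<le> norm (osc_int \<phi> A x)"
          unfolding A_def using P xr ab by (intro focusing_lower_bound[where P=P]) (auto simp: r_def)
      qed (use ab in auto)
      finally show ?thesis by (simp add: norm_mult)
    qed
    have gf: "(\<integral>\<^sup>+t. ennreal (norm (g n t) powr p) \<partial>lborel) \<le> (\<integral>\<^sup>+t. ennreal (norm (f t) powr p) \<partial>lborel)" for n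
      using p by (intro nn_integral_mono ennreal_leI powr_mono2) (auto simp: g_def norm_mult mult_left_le_one_le)
    have "ennreal ((k * \<mu> powr m) powr p * (2 * r)) = (\<integral>\<^sup>+x. ennreal ((k * \<mu> powr m) powr p) * indicator {\<mu> - r..\<mu> + r} x \<partial>lborel)"
      using r by (simp add: nn_integral_cmult_indicator ennreal_mult[symmetric])
    also have "\<dots> \<le> (\<integral>\<^sup>+x. ennreal (norm (of_real (japanese_bracket x powr m) * osc_int \<phi> A x) powr p) \<partial>lborel)"
      using lower k p by (intro nn_integral_mono) (auto intro!: ennreal_leI powr_mono2 simp del: norm_mult split: split_indicator)
    also have "\<dots> = (\<integral>\<^sup>+x. liminf (\<lambda>n. ennreal (norm (?T (g n) x) powr p)) \<partial>lborel)"
    proof (rule nn_integral_cong)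
      fix x
      have "(\<lambda>n. norm (?T (g n) x) powr p) \<longlonglongrightarrow> norm (of_real (japanese_bracket x powr m) * osc_int \<phi> A x) powr p"
        using p by (intro tendsto_powr' tendsto_norm Tg tendsto_const) auto
      then have "(\<lambda>n. ennreal (norm (?T (g n) x) powr p)) \<longlonglongrightarrow> ennreal (norm (of_real (japanese_bracket x powr m) * osc_int \<phi> A x) powr p)"
        by (rule tendsto_ennrealI)
      from lim_imp_Liminf[OF sequentially_bot this]
      show "ennreal (norm (of_real (japanese_bracket x powr m) * osc_int \<phi> A x) powr p) = liminf (\<lambda>n. ennreal (norm (?T (g n) x) powr p))" by simp
    qed
    \<comment> \<open>Boundedness is given on Schwartz functions only. Fatou transfers it to the
      packet, since damping never increases the L^p mass (\<open>gf\<close>).\<close>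
    also have "\<dots> \<le> liminf (\<lambda>n. \<integral>\<^sup>+x. ennreal (norm (?T (g n) x) powr p) \<partial>lborel)"
    proof (rule nn_integral_liminf)
      fix n
      have [measurable]: "g n \<in> borel_measurable borel" unfolding g_def by measurable
      show "(\<lambda>x. ennreal (norm (?T (g n) x) powr p)) \<in> borel_measurable lborel"
        unfolding fourier_integral_operator_eq by measurable
    qed
    also have "\<dots> \<le> liminf (\<lambda>n. ennreal C * ennreal ((9 / sqrt (\<mu> * c)) powr (p - 2) * (b - a)))"
      by (intro Liminf_mono always_eventually allI order_trans[OF C(2)[OF gS]] mult_left_mono order_trans[OF gf fb]) auto
    also have "\<dots> = ennreal (C * ((9 / sqrt (\<mu> * c)) powr (p - 2) * (b - a)))"
      using C(1) ab by (simp add: Liminf_const ennreal_mult)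
    finally have "(k * \<mu> powr m) powr p * (2 * r) \<le> C * ((9 / sqrt (\<mu> * c)) powr (p - 2) * (b - a))"
      using C(1) ab by (subst (asm) ennreal_le_iff) auto
    also have "(9 / sqrt (\<mu> * c)) powr (p - 2) = (9 / sqrt c) powr (p - 2) * \<mu> powr (- (p - 2) / 2)"
    proof -
      have "9 / sqrt (\<mu> * c) = (9 / sqrt c) * \<mu> powr (- (1 / 2))"
        using \<mu> by (simp add: real_sqrt_mult powr_minus powr_half_sqrt field_simps)
      then have "(9 / sqrt (\<mu> * c)) powr (p - 2) = (9 / sqrt c) powr (p - 2) * (\<mu> powr (- (1 / 2))) powr (p - 2)"
        by (simp only: powr_mult)
      moreover have "- (1 / 2) * (p - 2) = - (p - 2) / 2" by (simp add: field_simps)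
      ultimately show ?thesis by (simp only: powr_powr)
    qed
    finally show ?thesis by (simp add: D_def mult_ac)
  qed
  \<comment> \<open>The net power of \<mu> after collecting both sides of \<open>key\<close>;
    \<open>e \<le> 0\<close> is the claim multiplied by p.\<close>
  define e where "e = m * p + (p - 2) / 2"
  define Q where "Q = D / (k powr p * (2 * r))"
  have growth: "\<mu> powr e \<le> Q" if \<mu>: "\<mu> \<ge> 1" for \<mu>
  proof -
    have "(k * \<mu> powr m) powr p = k powr p * \<mu> powr (m * p)" by (simp add: powr_mult powr_powr)
    with key[OF \<mu>] have "k powr p * (2 * r) * \<mu> powr (m * p) \<le> D * \<mu> powr (- (p - 2) / 2)" by (simp add: mult_ac)
    then have "k powr p * (2 * r) * \<mu> powr (m * p) * \<mu> powr ((p - 2) / 2) \<le> D * \<mu> powr (- (p - 2) / 2) * \<mu> powr ((p - 2) / 2)"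
      by (rule mult_right_mono) simp
    moreover have z: "- (p - 2) / 2 + (p - 2) / 2 = 0" by (simp add: field_simps)
    ultimately have "k powr p * (2 * r) * \<mu> powr e \<le> D"
      using \<mu> by (simp only: mult.assoc powr_add[symmetric] e_def z) simp
    then show ?thesis using k r by (simp add: Q_def pos_le_divide_eq mult.commute)
  qed
  have "e \<le> 0"
  proof (rule ccontr)
    assume "\<not> e \<le> 0"
    then have e: "e > 0" by simp
    \<comment> \<open>Chosen as the value of \<mu> whose e-th power is |Q| + 1, which already
      exceeds Q.\<close>
    have "(\<bar>Q\<bar> + 1) powr (1 / e) \<ge> 1" using e by (intro ge_one_powr_ge_zero) auto
    from growth[OF this] have "\<bar>Q\<bar> + 1 \<le> Q" using e by (simp add: powr_powr)
    then show False by linarith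
  qed
  moreover have "- (1 / 2 - 1 / p) * p = 1 - p / 2" using p by (simp add: field_simps)
  ultimately have "m * p \<le> - (1 / 2 - 1 / p) * p" by (simp add: e_def diff_divide_distrib)
  then show ?thesis using p by (simp only: mult_le_cancel_right)
qed

end

section \<open>From the diffeomorphism to the data of the locale\<close>

lemma deriv_bounded_of_id_outside:
  fixes \<phi> \<phi>' :: "real \<Rightarrow> real"
  assumes d: "\<And>\<eta>. (\<phi> has_real_derivative \<phi>' \<eta>) (at \<eta>)" and c: "continuous_on UNIV \<phi>'"
    and id: "\<And>\<eta>. \<bar>\<eta>\<bar> \<ge> 1 \<Longrightarrow> \<phi> \<eta> = \<eta>"
  obtains M where "M > 0" "\<And>\<eta>. \<bar>\<phi>' \<eta>\<bar> \<le> M"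
proof -
  have "bounded (\<phi>' ` {-1..1})"
    by (intro compact_imp_bounded compact_continuous_image continuous_on_subset[OF c]) auto
  then obtain B where B: "\<And>\<eta>. \<eta> \<in> {-1..1} \<Longrightarrow> \<bar>\<phi>' \<eta>\<bar> \<le> B" unfolding bounded_iff by (metis imageI real_norm_def)
  have "\<bar>\<phi>' \<eta>\<bar> \<le> max 1 B" for \<eta>
  proof (cases "\<eta> \<in> {-1..1}")
    case True
    then show ?thesis using B by (simp add: le_max_iff_disj)
  next
    case False
    then show ?thesis using deriv_eq_1_of_id_outside[OF d id, of \<eta>] by (auto simp: abs_if split: if_splits)
  qed
  then show ?thesis by (intro that[of "max 1 B"]) auto
qed

theorem theorem1p1:
  fixes \<phi> :: "real \<Rightarrow> real" and p :: real
  assumes "diffeomorphism_real \<phi>"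
    and "\<And>\<eta>. \<bar>\<eta>\<bar> \<ge> 1 \<Longrightarrow> \<phi> \<eta> = \<eta>"
    and "\<not> (\<exists>L. linear L \<and> (\<forall>\<eta>\<in>{-1<..<1}. \<phi> \<eta> = L \<eta>))"
    and "2 < p"
  shows "\<not> bounded_on_Lp p (fourier_integral_operator \<phi> (\<lambda>x \<eta>. 1)) \<and>
    (\<forall>m::real. bounded_on_Lp p
        (fourier_integral_operator \<phi> (\<lambda>x \<eta>. complex_of_real (japanese_bracket x powr m)))
      \<longleftrightarrow> m \<le> - (1 / 2 - 1 / p))"
proof -
  define \<psi> where "\<psi> = inv \<phi>"
  have bij: "bij \<phi>" and sm: "smooth_real \<phi>" "smooth_real \<psi>" using assms(1) by (auto simp: diffeomorphism_real_def \<psi>_def)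
  note id = assms(2)
  have deriv: "(iter_deriv n f has_real_derivative iter_deriv (Suc n) f \<eta>) (at \<eta>)" if "smooth_real f" for f :: "real \<Rightarrow> real" and n \<eta>
    using smooth_real_has_derivative[OF that] by (simp add: has_real_derivative_iff_has_vector_derivative)
  have id\<psi>: "\<psi> \<eta> = \<eta>" if "\<bar>\<eta>\<bar> \<ge> 1" for \<eta>
    using id[OF that] bij_is_inj[OF bij] unfolding \<psi>_def by (metis inv_f_f)
  define \<phi>1 where "\<phi>1 = iter_deriv 1 \<phi>"
  define \<phi>2 where "\<phi>2 = iter_deriv 2 \<phi>"
  have d1: "(\<phi> has_real_derivative \<phi>1 \<eta>) (at \<eta>)" for \<eta> using deriv[OF sm(1), of 0] by (simp add: \<phi>1_def)
  have d2: "(\<phi>1 has_real_derivative \<phi>2 \<eta>) (at \<eta>)" for \<eta>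
    using deriv[OF sm(1), of 1] by (simp add: \<phi>1_def \<phi>2_def numeral_2_eq_2)
  have c1: "continuous_on UNIV \<phi>1" and c2: "continuous_on UNIV \<phi>2"
    unfolding \<phi>1_def \<phi>2_def by (intro smooth_real_continuous sm)+
  have d\<psi>: "(\<psi> has_real_derivative iter_deriv 1 \<psi> \<eta>) (at \<eta>)" for \<eta> using deriv[OF sm(2), of 0] by simp
  obtain M where M: "\<And>\<eta>. \<bar>\<phi>1 \<eta>\<bar> \<le> M" by (rule deriv_bounded_of_id_outside[OF d1 c1]) (use id in blast)+
  \<comment> \<open>A bound on the derivative of the inverse is a Lipschitz constant for it, that
    is, the expansion property of \<open>\<phi>\<close>. The inverse is also the identity outside
    (-1,1), so the same compactness argument applies.\<close>
  obtain L where L: "L > 0" "\<And>\<eta>. \<bar>iter_deriv 1 \<psi> \<eta>\<bar> \<le> L"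
    by (rule deriv_bounded_of_id_outside[OF d\<psi> smooth_real_continuous[OF sm(2)]]) (use id\<psi> in blast)+
  have exp: "\<bar>\<eta> - \<xi>\<bar> \<le> L * \<bar>\<phi> \<eta> - \<phi> \<xi>\<bar>" for \<eta> \<xi>
  proof -
    have "norm (\<psi> (\<phi> \<eta>) - \<psi> (\<phi> \<xi>)) \<le> L * norm (\<phi> \<eta> - \<phi> \<xi>)"
      by (rule field_differentiable_bound[of UNIV _ "iter_deriv 1 \<psi>"]) (use d\<psi> L in auto)
    then show ?thesis using bij_is_inj[OF bij] by (simp add: \<psi>_def)
  qed
  interpret phase \<phi> \<phi>1 M L
    by unfold_locales (use d1 c1 id M L exp in auto)
  \<comment> \<open>If the second derivative vanished throughout (-1,1), \<open>\<phi>\<close> would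
    be k \<eta> + l there, and the boundary values would force l = 0.\<close>
  obtain \<eta>0 where \<eta>0: "\<eta>0 \<in> {-1<..<1}" "\<phi>2 \<eta>0 \<noteq> 0"
  proof (rule ccontr)
    assume "\<not> thesis"
    with that have z: "\<phi>2 \<eta> = 0" if "\<eta> \<in> {-1<..<1}" for \<eta> using that by blast
    obtain k where k: "\<And>\<eta>. \<eta> \<in> {-1<..<1} \<Longrightarrow> \<phi>1 \<eta> = k"
      using has_field_derivative_zero_constant[of "{-1<..<1}" \<phi>1] d2 z
      by (metis convex_real_interval(8) has_field_derivative_at_within)
    have "((\<lambda>\<eta>. \<phi> \<eta> - k * \<eta>) has_real_derivative 0) (at \<eta> within {-1<..<1})" if "\<eta> \<in> {-1<..<1}" for \<eta>
      using k[OF that] by (auto intro!: derivative_eq_intros has_field_derivative_at_within[OF d1])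
    then obtain l where l: "\<And>\<eta>. \<eta> \<in> {-1<..<1} \<Longrightarrow> \<phi> \<eta> - k * \<eta> = l"
      using has_field_derivative_zero_constant[of "{-1<..<1}" "\<lambda>\<eta>. \<phi> \<eta> - k * \<eta>"] by (metis convex_real_interval(8))
    have l': "\<phi> \<eta> - k * \<eta> = l" if "\<eta> \<in> {-1..1}" for \<eta>
    proof (rule continuous_constant_on_closure[of "{-1<..<1}" "\<lambda>\<eta>. \<phi> \<eta> - k * \<eta>" l])
      show "continuous_on (closure {-1<..<1}) (\<lambda>\<eta>. \<phi> \<eta> - k * \<eta>)"
        by (intro continuous_intros continuous_on_subset[OF continuous]) auto
    qed (use l that in auto)
    \<comment> \<open>\<open>linear\<close> means homogeneous, so l must be shown to vanish: by
      continuity the formula reaches both endpoints, where it reads 1 - k = l and k - 1 = l.\<close>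
    have "l = 0" using l'[of 1] l'[of "-1"] id[of 1] id[of "-1"] by simp
    then have "\<forall>\<eta>\<in>{-1<..<1}. \<phi> \<eta> = k * \<eta>" using l by fastforce
    moreover have "linear (\<lambda>\<eta>. k * \<eta>)" by (simp add: linear_times)
    ultimately show False using assms(3) by blast
  qed
  define s where "s = sgn (\<phi>2 \<eta>0)"
  \<comment> \<open>Half of the value at \<eta>0 leaves room for continuity: the lower bound c
    survives on a closed ball, which becomes the interval of the packet.\<close>
  define c where "c = \<bar>\<phi>2 \<eta>0\<bar> / 2"
  have s: "\<bar>s\<bar> = 1" "s * \<phi>2 \<eta>0 = 2 * c" using \<eta>0(2) by (auto simp: s_def c_def sgn_if)
  have c: "c > 0" using \<eta>0(2) by (simp add: c_def)
  have "open ({-1<..<1} \<inter> {\<eta>. c < s * \<phi>2 \<eta>})"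
    by (intro open_Int open_Collect_less continuous_intros c2 open_real_greaterThanLessThan)
  moreover have "\<eta>0 \<in> {-1<..<1} \<inter> {\<eta>. c < s * \<phi>2 \<eta>}" using \<eta>0 s c by simp
  ultimately obtain d where d: "d > 0" "cball \<eta>0 d \<subseteq> {-1<..<1} \<inter> {\<eta>. c < s * \<phi>2 \<eta>}"
    by (meson open_contains_cball)
  have J: "{\<eta>0 - d..\<eta>0 + d} = cball \<eta>0 d" by (simp add: cball_eq_atLeastAtMost)
  have nec: "m \<le> - (1 / 2 - 1 / p)"
    if "bounded_on_Lp p (fourier_integral_operator \<phi> (\<lambda>x \<eta>. complex_of_real (japanese_bracket x powr m)))" for m
  proof (rule bounded_on_Lp_bracket_powr_necessary[OF d2 _ _ c s(1) _ assms(4) that])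
    show "\<eta>0 - d < \<eta>0 + d" using d by simp
    show "{\<eta>0 - d..\<eta>0 + d} \<subseteq> {-1..1}" using d(2) unfolding J by auto
    show "c \<le> s * \<phi>2 \<eta>" if "\<eta> \<in> {\<eta>0 - d..\<eta>0 + d}" for \<eta> using d(2) that unfolding J by auto
  qed
  have iff: "bounded_on_Lp p (fourier_integral_operator \<phi> (\<lambda>x \<eta>. complex_of_real (japanese_bracket x powr m)))
      \<longleftrightarrow> m \<le> - (1 / 2 - 1 / p)" for m
    using nec bounded_on_Lp_bracket_powr[OF assms(4)] by blast
  have "\<not> 0 \<le> - (1 / 2 - 1 / p)" using assms(4) by (simp add: field_simps)
  \<comment> \<open>\<open>powr\<close> sends base 0 to 0 even at exponent 0, so positivity of the
    bracket is what identifies the unweighted operator with the case m = 0.\<close>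
  moreover have "japanese_bracket x powr 0 = 1" for x using japanese_bracket_pos(1)[of x] by (simp del: japanese_bracket_pos)
  ultimately have "\<not> bounded_on_Lp p (fourier_integral_operator \<phi> (\<lambda>x \<eta>. 1))"
    using iff[of 0] by simp
  with iff show ?thesis by blast
qed

end
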